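(* Let $\alpha\ge 1/2$, $\lambda>0$, and let $X$ be a positive random variable with $E[X^{\alpha+4}]<\infty$ and $E[X]=\alpha/\lambda$. Let $P^X$ denote the law of $X$. Then for every $r>0$, $$\frac{d}{dr} I(X;X_r)=\lambda\left(\int_{(0,\infty)} x\, E\Big[E\big[\mathcal V_r(x)\,\big|\,X_r(x)\big]^2\Big]\,P^X(dx)\;-\;E\Big[E\big[\sqrt{X}\,\mathcal V_r(X)\,\big|\,X_r\big]^2\Big]\right),$$ where $X_r(x)$, $\mathcal V_r(x)$, $X_r=X_r(X)$ and $\mathcal V_r(X)$ are the outputs and ratios of the quadratic gamma channel defined in the context.
   Context: For $a,b>0$, $\gamma(a,b)$ denotes (a random variable with) the gamma distribution with density $\frac{b^{a}}{\Gamma(a)}x^{a-1}e^{-bx}$ on $(0,\infty)$; $\gamma(0,b)$ is understood as the constant $0$. Quadratic gamma channel: let $\gamma(\alpha-\tfrac12,\lambda)$ be a gamma random variable and $N$ a standard Gaussian random variable, with $X$, $\gamma(\alpha-\tfrac12,\lambda)$, $N$ mutually independent. For $r>0$ and deterministic $x\ge 0$ put $$Y_r(x)=\sqrt{rx}+\frac{N}{\sqrt{2\lambda}},\qquad X_r(x)=\gamma(\alpha-\tfrac12,\lambda)+Y_r(x)^2,\qquad \mathcal V_r(x)=\frac{Y_r(x)}{\sqrt{X_r(x)}},$$ and $Y_r=Y_r(X)$, $X_r=X_r(X)$, $\mathcal V_r(X)=Y_r/\sqrt{X_r}$ (the random input $X$ substituted for $x$). In $E[E[\mathcal V_r(x)\mid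 X_r(x)]^2]$ the number $x$ is fixed (deterministic input). Mutual information: $I(X;Y)=E\big[\log\frac{dP^{X,Y}}{d(P^X\otimes P^Y)}(X,Y)\big]$, where $P^{X,Y}$ is the joint law of $(X,Y)$ and $P^X,P^Y$ are its marginals. *)

theory Defs
  imports "HOL-Probability.Probability"
begin

definition gamma_density :: "real \<Rightarrow> real \<Rightarrow> real \<Rightarrow> real" where
  "gamma_density a b x =
     (if 0 < x then b powr a / Gamma a * x powr (a - 1) * exp (- b * x) else 0)"

text \<open>Law of the gamma variable with shape \<open>a\<close> and rate \<open>b\<close>; shape \<open>0\<close> is the point mass at \<open>0\<close>.\<close>

definition gamma_law :: "real \<Rightarrow> real \<Rightarrow> real measure" where
  "gamma_law a b = (if a = 0 then return borel 0 else density lborel (gamma_density a b))"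

text \<open>
  The quadratic gamma channel with deterministic input \<open>x\<close>. Here \<open>G\<close> is the gamma noise and \<open>N\<close> the
  Gaussian noise, both random variables on the underlying probability space. The output for a random
  input \<open>X\<close> is obtained by substituting \<open>X \<omega>\<close> for \<open>x\<close> at the sample point \<open>\<omega>\<close>.
\<close>

definition qgc_Y :: "real \<Rightarrow> ('a \<Rightarrow> real) \<Rightarrow> real \<Rightarrow> real \<Rightarrow> 'a \<Rightarrow> real" where
  "qgc_Y lam N r x \<omega> = sqrt (r * x) + N \<omega> / sqrt (2 * lam)"

definition qgc_X ::
  "real \<Rightarrow> ('a \<Rightarrow> real) \<Rightarrow> ('a \<Rightarrow> real) \<Rightarrow> real \<Rightarrow> real \<Rightarrow> 'a \<Rightarrow> real" where
  "qgc_X lam G N r x \<omega> = G \<omega> + (qgc_Y lam N r x \<omega>)\<^sup>2"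

definition qgc_V ::
  "real \<Rightarrow> ('a \<Rightarrow> real) \<Rightarrow> ('a \<Rightarrow> real) \<Rightarrow> real \<Rightarrow> real \<Rightarrow> 'a \<Rightarrow> real" where
  "qgc_V lam G N r x \<omega> = qgc_Y lam N r x \<omega> / sqrt (qgc_X lam G N r x \<omega>)"

text \<open>Conditional expectation \<open>E[f | Z]\<close>, that is, with respect to the sigma-algebra generated by \<open>Z\<close>.\<close>

definition cond_exp_on :: "'a measure \<Rightarrow> ('a \<Rightarrow> real) \<Rightarrow> ('a \<Rightarrow> real) \<Rightarrow> 'a \<Rightarrow> real" where
  "cond_exp_on M f Z = real_cond_exp M (vimage_algebra (space M) Z borel) f"

text \<open>Mutual information of two real random variables, with the natural logarithm.\<close>

definition mutual_info :: "'a measure \<Rightarrow> ('a \<Rightarrow> real) \<Rightarrow> ('a \<Rightarrow> real) \<Rightarrow> real" where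
  "mutual_info M X Y = prob_space.mutual_information M (exp 1) borel borel X Y"

end

theory Submission
  imports Defs "HOL-Real_Asymp.Real_Asymp"
begin

text \<open>
  Let \<open>q\<close> be the gamma density of shape \<open>\<alpha>\<close> and rate \<open>lam\<close>, which is the output density at input \<open>0\<close>.
  At a fixed input \<open>x\<close> the output has the noncentral gamma density \<open>q y * L (r * x) y\<close>, where the
  likelihood ratio \<open>L\<close> (\<open>lik\<close>) is an explicit entire function of Bessel type; at a random input it has
  the density \<open>q y * l r y\<close> with \<open>l r y = E (L (r * X) y)\<close> (\<open>ell\<close>). Hence
  \<open>I(X; X_r) = E (D (r * X)) - H r\<close>, where \<open>D s\<close> and \<open>H r\<close> are the integrals of \<open>q L ln L\<close> and of
  \<open>q l ln l\<close> over the output (\<open>mutual_info_decomposition\<close>). Since \<open>D (r * x)\<close> is \<open>H\<close> for the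
  deterministic input \<open>x\<close>, both terms of the theorem come from a single formula, applied once to the
  input \<open>X\<close> and once to every constant input:
  \<open>H' r = lam * E (E [sqrt X * V_r | X_r]^2)\<close>.

  This formula rests on two properties of the noncentral gamma densities \<open>p_a s y\<close> of shape \<open>a\<close> and
  noncentrality \<open>s\<close>. Their derivative in \<open>s\<close> is \<open>lam * (p_(a+1) - p_a)\<close>, and the derivative of
  \<open>p_(a+1)\<close> in \<open>y\<close> is the negative of the same expression. So \<open>H'\<close>, which is the integral of the
  derivative of \<open>l\<close> in \<open>r\<close> against \<open>1 + ln l\<close>, becomes after an integration by parts in \<open>y\<close> a Fisher
  information type integral, proportional to that of \<open>y q (l_y)^2 / l\<close> with \<open>l_y\<close> the derivative of \<open>l\<close> in \<open>y\<close>
  (\<open>entropy_by_parts\<close>, \<open>entropy_rate_eq_posterior\<close>). The second property is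
  \<open>E (Y f(X_r(x))) = sqrt (r x) * integral of f against p_(\<alpha>+1) (r x)\<close>
  (\<open>channel_output_law_tilted\<close>), which identifies the posterior mean of \<open>sqrt X * V_r\<close> with a multiple
  of \<open>sqrt y * l_y / l\<close> (\<open>cond_exp_weighted_ratio\<close>), so that the integral is the required one.

  Differentiating \<open>H\<close> under the integral sign needs care: the evident bound on the integrand that is
  uniform in \<open>r\<close> grows like the expectation of \<open>X exp (c X)\<close>, which may be infinite. Instead \<open>H\<close> is
  recovered by Fubini's theorem as the integral over \<open>r\<close> of the expected derivative, whose absolute
  integral over \<open>y\<close> at a fixed \<open>r\<close> is controlled by the first two moments of \<open>X\<close>
  (\<open>rel_entropy_increment\<close>), and this derivative is continuous in \<open>r\<close> by dominated convergence with a
  bound that varies with \<open>r\<close> (\<open>continuous_entropy_rate\<close>).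
\<close>

section \<open>The Bessel-type series\<close>

text \<open>
  Up to the factor \<open>t powr ((a - 1) / 2)\<close> this is the modified Bessel function of order \<open>a - 1\<close> at
  \<open>2 * sqrt t\<close>. Leaving this factor out makes the function entire.
\<close>

definition bessel_series :: "real \<Rightarrow> real \<Rightarrow> real" where
  "bessel_series a t = (\<Sum>k. t ^ k / (fact k * Gamma (a + real k)))"

lemma Gamma_plus1_real: "Gamma (x + 1) = x * Gamma x" if "x > 0" for x :: real
  using that by (intro Gamma_plus1) (auto dest: nonpos_Ints_nonpos)

text \<open>
  Passing from \<open>k\<close> to \<open>k + 1\<close> multiplies the left side by \<open>(2 k + 2) (2 k + 1)\<close> and the right side by
  \<open>(2 k + 2) (2 (a + k))\<close>. This is how the series is dominated by that of \<open>cosh (2 * sqrt t)\<close>.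
\<close>

lemma Gamma_shift_lower_bound:
  fixes a :: real
  assumes "a \<ge> 1/2"
  shows "Gamma a * fact (2 * k) \<le> 4 ^ k * fact k * Gamma (a + real k)"
proof (induction k)
  case 0
  then show ?case by simp
next
  case (Suc k)
  have G: "Gamma (a + real (Suc k)) = (a + real k) * Gamma (a + real k)"
    using Gamma_plus1_real[of "a + real k"] assms by (simp add: add_ac)
  have "Gamma a * fact (2 * Suc k) =
      (Gamma a * fact (2 * k)) * ((2 * real k + 2) * (2 * real k + 1))"
    by (simp add: algebra_simps)
  also have "\<dots> \<le> (4 ^ k * fact k * Gamma (a + real k)) * ((2 * real k + 2) * (2 * (a + real k)))"
    using assms by (intro mult_mono Suc.IH mult_nonneg_nonneg) (auto intro!: Gamma_real_nonneg)
  also have "\<dots> = 4 ^ Suc k * fact (Suc k) * Gamma (a + real (Suc k))"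
    unfolding G by (simp add: algebra_simps)
  finally show ?case .
qed

lemma bessel_series_term_le:
  assumes "a \<ge> 1/2" "t \<ge> 0"
  shows "t ^ k / (fact k * Gamma (a + real k)) \<le> (4 * t) ^ k / fact (2 * k) / Gamma a"
proof -
  have pos: "Gamma a > 0" "Gamma (a + real k) > 0"
    using assms by (auto intro!: Gamma_real_pos)
  have "Gamma a * fact (2 * k) * t ^ k \<le> 4 ^ k * fact k * Gamma (a + real k) * t ^ k"
    using Gamma_shift_lower_bound[OF assms(1), of k] assms by (intro mult_right_mono) auto
  then show ?thesis
    using pos by (simp add: field_simps power_mult_distrib)
qed

lemma cosh_sqrt_sums:
  assumes "t \<ge> 0"
  shows "(\<lambda>k. (4 * t) ^ k / fact (2 * k)) sums cosh (2 * sqrt t)"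
proof -
  have "(\<lambda>n. if even n then (2 * sqrt t) ^ n /\<^sub>R fact n else 0) sums cosh (2 * sqrt t)"
    by (rule cosh_converges)
  then have "(\<lambda>k. (if even (2 * k) then (2 * sqrt t) ^ (2 * k) /\<^sub>R fact (2 * k) else 0))
      sums cosh (2 * sqrt t)"
    by (subst sums_mono_reindex[of "\<lambda>k. 2 * k"]) (auto simp: strict_mono_def elim!: evenE)
  moreover have "(2 * sqrt t) ^ (2 * k) = (4 * t) ^ k" for k
    using assms by (simp only: power_mult power_mult_distrib real_sqrt_pow2) simp
  ultimately show ?thesis by (simp add: divide_inverse mult.commute)
qed

lemma summable_bessel_series:
  assumes "a \<ge> 1/2"
  shows "summable (\<lambda>k. t ^ k / (fact k * Gamma (a + real k)))"
proof (rule summable_comparison_test')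
  show "summable (\<lambda>k. (4 * \<bar>t\<bar>) ^ k / fact (2 * k) / Gamma a)"
    using cosh_sqrt_sums[of "\<bar>t\<bar>"] by (intro summable_divide) (auto simp: sums_iff)
  show "norm (t ^ k / (fact k * Gamma (a + real k))) \<le> (4 * \<bar>t\<bar>) ^ k / fact (2 * k) / Gamma a" for k
    using bessel_series_term_le[OF assms, of "\<bar>t\<bar>" k] assms
    by (simp add: power_abs abs_mult)
qed

lemma bessel_series_pos:
  assumes "a \<ge> 1/2" "t \<ge> 0"
  shows "1 / Gamma a \<le> bessel_series a t" "0 < bessel_series a t"
proof -
  have "sum (\<lambda>k. t ^ k / (fact k * Gamma (a + real k))) {0} \<le> bessel_series a t"
    unfolding bessel_series_def using assms
    by (intro sum_le_suminf summable_bessel_series)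
       (auto intro!: divide_nonneg_nonneg mult_nonneg_nonneg Gamma_real_nonneg)
  then show *: "1 / Gamma a \<le> bessel_series a t" by simp
  have "0 < 1 / Gamma a" using assms by (auto intro!: Gamma_real_pos)
  with * show "0 < bessel_series a t" by linarith
qed

lemma bessel_series_le_exp:
  assumes "a \<ge> 1/2" "t \<ge> 0"
  shows "Gamma a * bessel_series a t \<le> exp (2 * sqrt t)"
proof -
  have G: "Gamma a > 0" using assms by (auto intro!: Gamma_real_pos)
  have "bessel_series a t \<le> (\<Sum>k. (4 * t) ^ k / fact (2 * k) / Gamma a)"
    unfolding bessel_series_def using assms cosh_sqrt_sums[of t]
    by (intro suminf_le summable_bessel_series bessel_series_term_le summable_divide)
       (auto simp: sums_iff)
  also have "\<dots> = cosh (2 * sqrt t) / Gamma a"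
    using sums_divide[OF cosh_sqrt_sums[OF assms(2)], of "Gamma a"] by (simp only: sums_iff)
  also have "cosh (2 * sqrt t) \<le> exp (2 * sqrt t)"
    using assms by (simp add: cosh_def) 
  finally show ?thesis using G by (simp add: field_simps)
qed

lemma DERIV_bessel_series:
  assumes "a \<ge> 1/2"
  shows "(bessel_series a has_real_derivative bessel_series (a + 1) t) (at t)"
proof -
  define c where "c = (\<lambda>k. 1 / (fact k * Gamma (a + real k)))"
  have d: "diffs c = (\<lambda>k. 1 / (fact k * Gamma (a + 1 + real k)))"
  proof
    fix k
    have "a + real (Suc k) = a + 1 + real k" by simp
    then show "diffs c k = 1 / (fact k * Gamma (a + 1 + real k))"
      by (simp only: diffs_def c_def fact_Suc) (simp add: divide_simps)
  qed
  have eq: "bessel_series a = (\<lambda>t. \<Sum>k. c k * t ^ k)"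
           "bessel_series (a + 1) = (\<lambda>t. \<Sum>k. diffs c k * t ^ k)"
    unfolding d by (auto simp: bessel_series_def c_def fun_eq_iff)
  have "summable (\<lambda>k. c k * y ^ k)" for y
    using summable_bessel_series[OF assms, of y] by (simp add: c_def)
  then show ?thesis
    unfolding eq by (intro termdiffs_strong_converges_everywhere)
qed

lemma continuous_bessel_series:
  assumes "a \<ge> 1/2"
  shows "continuous_on A (bessel_series a)"
  using DERIV_bessel_series[OF assms] by (meson DERIV_continuous_on has_field_derivative_at_within)

lemma borel_measurable_bessel_series [measurable]: "bessel_series a \<in> borel_measurable borel"
  unfolding bessel_series_def by measurable

text \<open>
  Coefficientwise this is \<open>(a + k) / Gamma (a + k + 1) = 1 / Gamma (a + k)\<close>.
\<close>

lemma bessel_series_recurrence: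
  assumes "a \<ge> 1/2"
  shows "bessel_series a t = a * bessel_series (a + 1) t + t * bessel_series (a + 2) t"
proof -
  have s: "summable (\<lambda>k. t ^ k / (fact k * Gamma (a + 1 + real k)))" 
    using assms by (intro summable_bessel_series) auto
  have sh: "(\<lambda>k. t * (t ^ k / (fact k * Gamma (a + 2 + real k)))) sums (t * bessel_series (a + 2) t)"
    unfolding bessel_series_def using assms by (intro sums_mult summable_sums summable_bessel_series) auto
  define f where "f = (\<lambda>k. real k * t ^ k / (fact k * Gamma (a + 1 + real k)))"
  have "f (Suc k) = t * (t ^ k / (fact k * Gamma (a + 2 + real k)))" for k
  proof -
    have "a + 1 + real (Suc k) = a + 2 + real k" by simp
    then show ?thesis
      by (simp only: f_def fact_Suc) (simp add: divide_simps)
  qed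
  then have "(\<lambda>k. f (Suc k)) sums (t * bessel_series (a + 2) t)"
    using sh by simp
  then have f: "f sums (t * bessel_series (a + 2) t)"
    by (subst (asm) sums_Suc_iff) (simp add: f_def)
  have "(\<lambda>k. a * (t ^ k / (fact k * Gamma (a + 1 + real k))) + f k)
      sums (a * bessel_series (a + 1) t + t * bessel_series (a + 2) t)"
    unfolding bessel_series_def[of "a + 1"] by (intro sums_add f sums_mult summable_sums s)
  moreover have "a * (t ^ k / (fact k * Gamma (a + 1 + real k))) + f k =
      t ^ k / (fact k * Gamma (a + real k))" for k
  proof -
    have "Gamma (a + 1 + real k) = (a + real k) * Gamma (a + real k)" "a + real k > 0"
      using Gamma_plus1_real[of "a + real k"] assms by (auto simp: add_ac)
    moreover have "Gamma (a + real k) > 0" using assms by (auto intro!: Gamma_real_pos)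
    ultimately have "a * (t ^ k / (fact k * Gamma (a + 1 + real k))) + f k =
       (a + real k) * t ^ k / (fact k * ((a + real k) * Gamma (a + real k)))"
      by (simp add: f_def distrib_right add_divide_distrib)
    also have "\<dots> = t ^ k / (fact k * Gamma (a + real k))" using \<open>a + real k > 0\<close> by simp
    finally show ?thesis .
  qed
  ultimately show ?thesis
    by (simp add: bessel_series_def[of a] sums_iff)
qed

text \<open>
  For \<open>a = 1/2\<close> the comparison with \<open>cosh\<close> is an equality in every coefficient. Together with the next
  lemma this recognises the Gaussian component of the channel as the case of shapes \<open>1/2\<close> and \<open>3/2\<close>.
\<close>

lemma bessel_series_half:
  assumes "t \<ge> 0"
  shows "bessel_series (1/2) t = cosh (2 * sqrt t) / sqrt pi"
proof -
  have G: "4 ^ k * fact k * Gamma (1/2 + real k) = sqrt pi * fact (2 * k)" for k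
  proof (induction k)
    case (Suc k)
    have "Gamma (1/2 + real (Suc k)) = (1/2 + real k) * Gamma (1/2 + real k)"
      using Gamma_plus1_real[of "1/2 + real k"] by (simp add: add_ac)
    then have "4 ^ Suc k * fact (Suc k) * Gamma (1/2 + real (Suc k)) =
        (4 ^ k * fact k * Gamma (1/2 + real k)) * ((2 * real k + 2) * (2 * real k + 1))"
      by (simp add: algebra_simps)
    also have "\<dots> = sqrt pi * fact (2 * Suc k)"
      unfolding Suc.IH by (simp add: algebra_simps)
    finally show ?case .
  qed (simp add: Gamma_one_half_real)
  have "t ^ k / (fact k * Gamma (1/2 + real k)) = (4 * t) ^ k / fact (2 * k) / sqrt pi" for k
  proof -
    have "t ^ k / (fact k * Gamma (1/2 + real k)) = (4 * t) ^ k / (4 ^ k * fact k * Gamma (1/2 + real k))"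
      by (simp add: power_mult_distrib)
    then show ?thesis unfolding G by simp
  qed
  then show ?thesis
    using sums_divide[OF cosh_sqrt_sums[OF assms], of "sqrt pi"]
    by (simp only: bessel_series_def sums_iff)
qed

text \<open>
  Both sides are the derivative of \<open>bessel_series (1/2)\<close>.
\<close>

lemma bessel_series_three_halves:
  assumes "t > 0"
  shows "bessel_series (3/2) t = sinh (2 * sqrt t) / (sqrt pi * sqrt t)"
proof -
  have "((\<lambda>t. cosh (2 * sqrt t) / sqrt pi) has_real_derivative
      sinh (2 * sqrt t) / (sqrt pi * sqrt t)) (at t)"
    using assms by (auto intro!: derivative_eq_intros simp: field_simps)
  then have "(bessel_series (1/2) has_real_derivative sinh (2 * sqrt t) / (sqrt pi * sqrt t)) (at t)"
    by (rule has_field_derivative_transform_within_open[of _ _ _ "{0<..}"])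
       (use assms in \<open>auto simp: bessel_series_half\<close>)
  moreover have "(bessel_series (1/2) has_real_derivative bessel_series (3/2) t) (at t)"
    using DERIV_bessel_series[of "1/2" t] by simp
  ultimately show ?thesis by (rule DERIV_unique[symmetric])
qed

section \<open>Noncentral gamma densities\<close>

lemma gamma_density_nonneg: "a > 0 \<Longrightarrow> gamma_density a b y \<ge> 0"
  by (auto simp: gamma_density_def intro!: mult_nonneg_nonneg divide_nonneg_nonneg less_imp_le[OF Gamma_real_pos])

lemma borel_measurable_gamma_density [measurable]:
  assumes [measurable]: "f \<in> borel_measurable M"
  shows "(\<lambda>x. gamma_density a b (f x)) \<in> borel_measurable M"
  unfolding gamma_density_def by measurable

locale gamma_rate =
  fixes lam :: real
  assumes lam_pos: "lam > 0"
begin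

text \<open>
  The noncentral gamma density of shape \<open>a\<close> and noncentrality \<open>s\<close>. It is the mixture, with Poisson
  weights of mean \<open>lam * s\<close>, of the gamma densities of shapes \<open>a + k\<close>; see \<open>ncgamma_mixture\<close>.
\<close>

definition ncgamma :: "real \<Rightarrow> real \<Rightarrow> real \<Rightarrow> real" where
  "ncgamma a s y = (if 0 < y
     then lam powr a * y powr (a - 1) * exp (- lam * (s + y)) * bessel_series a (lam\<^sup>2 * s * y) else 0)"

lemma borel_measurable_ncgamma [measurable]:
  assumes [measurable]: "f \<in> borel_measurable M" "g \<in> borel_measurable M"
  shows "(\<lambda>x. ncgamma a (f x) (g x)) \<in> borel_measurable M"
  unfolding ncgamma_def by measurable

lemma ncgamma_nonneg: "a \<ge> 1/2 \<Longrightarrow> s \<ge> 0 \<Longrightarrow> ncgamma a s y \<ge> 0"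
  unfolding ncgamma_def
  by (auto intro!: mult_nonneg_nonneg less_imp_le[OF bessel_series_pos(2)])

lemma ncgamma_outside [simp]: "y \<le> 0 \<Longrightarrow> ncgamma a s y = 0"
  by (simp add: ncgamma_def)

definition poisson_weight :: "real \<Rightarrow> nat \<Rightarrow> real" where
  "poisson_weight s k = exp (- lam * s) * (lam * s) ^ k / fact k"

lemma poisson_weight_nonneg: "s \<ge> 0 \<Longrightarrow> poisson_weight s k \<ge> 0"
  using lam_pos by (simp add: poisson_weight_def)

lemma ncgamma_mixture:
  assumes "a \<ge> 1/2"
  shows "(\<lambda>k. poisson_weight s k * gamma_density (a + real k) lam y) sums ncgamma a s y"
proof (cases "y > 0")
  case True
  have "(\<lambda>k. (lam\<^sup>2 * s * y) ^ k / (fact k * Gamma (a + real k))) sums bessel_series a (lam\<^sup>2 * s * y)"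
    unfolding bessel_series_def using assms by (intro summable_sums summable_bessel_series)
  then have "(\<lambda>k. lam powr a * y powr (a - 1) * exp (- lam * (s + y)) *
      ((lam\<^sup>2 * s * y) ^ k / (fact k * Gamma (a + real k)))) sums ncgamma a s y"
    using True unfolding ncgamma_def by (simp only: if_True sums_mult)
  moreover have "lam powr a * y powr (a - 1) * exp (- lam * (s + y)) *
      ((lam\<^sup>2 * s * y) ^ k / (fact k * Gamma (a + real k))) =
      poisson_weight s k * gamma_density (a + real k) lam y" for k
  proof -
    have 1: "lam powr (a + real k) = lam powr a * lam ^ k"
      using lam_pos by (simp add: powr_add powr_realpow)
    have 2: "y powr (a + real k - 1) = y powr (a - 1) * y ^ k"
    proof -
      have "a + real k - 1 = (a - 1) + real k" by simp
      then show ?thesis using True by (simp only: powr_add powr_realpow)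
    qed
    have 3: "exp (- lam * (s + y)) = exp (- lam * s) * exp (- lam * y)"
      by (simp add: algebra_simps exp_add[symmetric])
    show ?thesis
      using True unfolding poisson_weight_def gamma_density_def 1 2 3
      by (simp add: power_mult_distrib power2_eq_square mult_ac)
  qed
  ultimately show ?thesis by simp
qed (auto simp: gamma_density_def)

text \<open>
  The derivative of the Poisson weights in their mean moves mass from the index \<open>k\<close> to \<open>k + 1\<close>, that
  is, from the shape \<open>a\<close> to the shape \<open>a + 1\<close>.
\<close>

lemma DERIV_ncgamma_noncentrality:
  assumes "a \<ge> 1/2"
  shows "((\<lambda>s. ncgamma a s y) has_real_derivative lam * (ncgamma (a + 1) s y - ncgamma a s y)) (at s)"
proof (cases "y > 0")
  case True
  have lp: "lam powr (a + 1) = lam powr a * lam"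
    using lam_pos by (simp add: powr_add)
  note lp' = lp[unfolded add.commute[of a]]
  have yp: "y powr a = y powr (a - 1) * y"
    using True by (simp add: powr_diff)
  have "((\<lambda>s. lam powr a * y powr (a - 1) * exp (- lam * (s + y)) * bessel_series a (lam\<^sup>2 * s * y))
      has_real_derivative lam * (ncgamma (a + 1) s y - ncgamma a s y)) (at s)"
    by (rule derivative_eq_intros DERIV_chain2[OF DERIV_bessel_series] assms refl)+
       (use True in \<open>simp add: ncgamma_def lp' yp power2_eq_square algebra_simps\<close>)
  then show ?thesis using True by (simp add: ncgamma_def)
qed (simp add: ncgamma_def)

text \<open>
  The same difference as in \<open>DERIV_ncgamma_noncentrality\<close>, with the opposite sign: changing the
  noncentrality transports mass along the output axis with flux \<open>ncgamma (a + 1) s\<close>. This is what makes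
  the later integration by parts possible.
\<close>

lemma DERIV_ncgamma_Suc:
  assumes "a \<ge> 1/2" "y > 0"
  shows "(ncgamma (a + 1) s has_real_derivative lam * (ncgamma a s y - ncgamma (a + 1) s y)) (at y)"
proof -
  have lp: "lam powr (a + 1) = lam powr a * lam"
    using lam_pos by (simp add: powr_add)
  note lp' = lp[unfolded add.commute[of a]]
  have yp: "y powr a = y powr (a - 1) * y"
    using assms by (simp add: powr_diff)
  have ex: "exp (- (lam * y) - lam * s) = exp (- (lam * s) - lam * y)"
    by (simp add: algebra_simps)
  have D: "((\<lambda>y. lam powr (a + 1) * y powr a * exp (- lam * (s + y)) * bessel_series (a + 1) (lam\<^sup>2 * s * y))
      has_real_derivative
        lam powr (a + 1) * ((a * y powr (a - 1)) * exp (- lam * (s + y)) * bessel_series (a + 1) (lam\<^sup>2 * s * y)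
        + y powr a * (- lam * exp (- lam * (s + y))) * bessel_series (a + 1) (lam\<^sup>2 * s * y)
        + y powr a * exp (- lam * (s + y)) * (lam\<^sup>2 * s * bessel_series (a + 2) (lam\<^sup>2 * s * y)))) (at y)"
    using assms
    by (auto intro!: derivative_eq_intros DERIV_chain2[OF DERIV_bessel_series]
         simp: algebra_simps ex)
  have "lam powr (a + 1) * ((a * y powr (a - 1)) * exp (- lam * (s + y)) * bessel_series (a + 1) (lam\<^sup>2 * s * y)
        + y powr a * (- lam * exp (- lam * (s + y))) * bessel_series (a + 1) (lam\<^sup>2 * s * y)
        + y powr a * exp (- lam * (s + y)) * (lam\<^sup>2 * s * bessel_series (a + 2) (lam\<^sup>2 * s * y)))
     = lam * (ncgamma a s y - ncgamma (a + 1) s y)"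
    using assms unfolding ncgamma_def bessel_series_recurrence[OF assms(1)]
    by (simp add: lp' yp algebra_simps)
  with D have D': "((\<lambda>y. lam powr (a + 1) * y powr a * exp (- lam * (s + y)) * bessel_series (a + 1) (lam\<^sup>2 * s * y))
      has_real_derivative lam * (ncgamma a s y - ncgamma (a + 1) s y)) (at y)" by simp
  show ?thesis
    by (rule has_field_derivative_transform_within_open[OF D', of "{0<..}"])
       (use assms in \<open>auto simp: ncgamma_def\<close>)
qed

text \<open>
  The recurrence of the series, rewritten for the densities; it gives their mean.
\<close>

lemma ncgamma_times:
  assumes "a \<ge> 1/2"
  shows "y * ncgamma a s y = a / lam * ncgamma (a + 1) s y + s * ncgamma (a + 2) s y"
proof (cases "y > 0")
  case True
  have lp: "lam powr (a + 1) = lam powr a * lam" "lam powr (a + 2) = lam powr a * lam\<^sup>2"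
    using lam_pos by (simp_all add: powr_add)
  have yp: "y powr a = y powr (a - 1) * y" "y powr (a + 1) = y powr (a - 1) * y * y"
    using True by (simp_all add: powr_diff powr_add)
  have ar: "a + 1 - 1 = a" "a + 2 - 1 = a + 1" by simp_all
  show ?thesis
    using True lam_pos unfolding ncgamma_def bessel_series_recurrence[OF assms(1)] ar lp yp
    by (simp add: field_simps power2_eq_square)
qed (simp add: ncgamma_def)

lemma nn_integral_gamma_density:
  assumes "a > 0"
  shows "(\<integral>\<^sup>+y. ennreal (gamma_density a lam y) \<partial>lborel) = 1"
proof -
  have G: "Gamma a > 0" using assms by (rule Gamma_real_pos)
  have *: "ennreal (gamma_density a lam y) = ennreal (lam / Gamma a) *
      (ennreal ((lam * y) powr (a - 1) / exp (lam * y)) * indicator {0..} (lam * y))" for y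
  proof (cases "y > 0")
    case True
    then have e: "gamma_density a lam y = lam / Gamma a * ((lam * y) powr (a - 1) / exp (lam * y))"
      using lam_pos by (simp add: gamma_density_def powr_mult powr_diff exp_minus field_simps)
    have "ennreal (gamma_density a lam y) = ennreal (lam / Gamma a) * ennreal ((lam * y) powr (a - 1) / exp (lam * y))"
      unfolding e by (rule ennreal_mult') (use lam_pos G in simp)
    then show ?thesis using True lam_pos by simp
  next
    case False
    then show ?thesis
      using lam_pos by (cases "y = 0") (auto simp: gamma_density_def zero_le_mult_iff)
  qed
  have "(\<integral>\<^sup>+y. ennreal (gamma_density a lam y) \<partial>lborel) =
      (\<integral>\<^sup>+t. ennreal (lam / Gamma a) * (ennreal (t powr (a - 1) / exp t) * indicator {0..} t)
         \<partial>distr lborel borel (\<lambda>y. lam * y))"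
    unfolding * by (subst nn_integral_distr) auto
  also have "\<dots> = ennreal (lam / Gamma a) * (\<integral>\<^sup>+t. (ennreal (t powr (a - 1) / exp t) * indicator {0..} t)
         \<partial>distr lborel borel (\<lambda>y. lam * y))"
    by (intro nn_integral_cmult) auto
  also have "(\<integral>\<^sup>+t. (ennreal (t powr (a - 1) / exp t) * indicator {0..} t) \<partial>distr lborel borel (\<lambda>y. lam * y)) =
      ennreal (1 / lam) * (\<integral>\<^sup>+t. (ennreal (t powr (a - 1) / exp t) * indicator {0..} t) \<partial>lborel)"
    using lam_pos
    by (subst lborel_distr_mult) (auto simp: nn_integral_density nn_integral_cmult inverse_eq_divide)
  also have "(\<integral>\<^sup>+t. (ennreal (t powr (a - 1) / exp t) * indicator {0..} t) \<partial>lborel) =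
      (\<integral>\<^sup>+t. ennreal (indicator {0..} t * (t powr (a - 1) / exp t)) \<partial>lborel)"
    by (intro nn_integral_cong) (auto split: split_indicator)
  also have "\<dots> = ennreal (Gamma a)"
    using nn_integral_has_integral_lebesgue[OF _ Gamma_integral_real[OF assms]] by simp
  finally show ?thesis
    using lam_pos G by (simp add: ennreal_mult'[symmetric])
qed

lemma gamma_law_prob_space:
  assumes "a \<ge> 0"
  shows "prob_space (gamma_law a lam)" and "AE g in gamma_law a lam. g \<ge> 0"
proof -
  show "prob_space (gamma_law a lam)"
  proof (cases "a = 0")
    case False
    then have "emeasure (gamma_law a lam) (space (gamma_law a lam)) = 1"
      using nn_integral_gamma_density[of a] assms by (simp add: gamma_law_def emeasure_density)
    then show ?thesis by (rule prob_spaceI)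
  qed (simp add: gamma_law_def prob_space_return)
  show "AE g in gamma_law a lam. g \<ge> 0"
  proof (cases "a = 0")
    case False
    then have e: "gamma_law a lam = density lborel (\<lambda>g. ennreal (gamma_density a lam g))"
      by (simp add: gamma_law_def)
    show ?thesis
      unfolding e by (subst AE_density) (auto simp: gamma_density_def intro!: AE_I2)
  next
    case True
    then have e: "gamma_law a lam = return borel 0" by (simp add: gamma_law_def)
    show ?thesis unfolding e by (subst AE_return) auto
  qed
qed

lemma nn_integral_ncgamma:
  assumes "a \<ge> 1/2" "s \<ge> 0"
  shows "(\<integral>\<^sup>+y. ennreal (ncgamma a s y) \<partial>lborel) = 1"
proof -
  have *: "ennreal (ncgamma a s y) = (\<Sum>k. ennreal (poisson_weight s k * gamma_density (a + real k) lam y))" for y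
    using assms ncgamma_mixture[OF assms(1), of s y]
    by (intro sums_unique[symmetric, THEN sym])
       (auto intro!: sums_ennreal[THEN iffD2] mult_nonneg_nonneg poisson_weight_nonneg gamma_density_nonneg ncgamma_nonneg)
  have "(\<integral>\<^sup>+y. ennreal (ncgamma a s y) \<partial>lborel) =
      (\<Sum>k. \<integral>\<^sup>+y. ennreal (poisson_weight s k * gamma_density (a + real k) lam y) \<partial>lborel)"
    unfolding * by (intro nn_integral_suminf) simp
  also have "\<dots> = (\<Sum>k. ennreal (poisson_weight s k))"
    using assms
    by (intro suminf_cong)
       (simp add: ennreal_mult poisson_weight_nonneg gamma_density_nonneg nn_integral_cmult nn_integral_gamma_density)
  also have "\<dots> = ennreal (\<Sum>k. poisson_weight s k)"
  proof (rule suminf_ennreal2)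
    show "summable (poisson_weight s)"
      unfolding poisson_weight_def using summable_mult[OF summable_exp[of "lam * s"], of "exp (- lam * s)"]
      by (simp add: divide_inverse mult_ac)
  qed (use assms in \<open>auto simp: poisson_weight_nonneg\<close>)
  also have "(\<Sum>k. poisson_weight s k) = 1"
  proof -
    have "(\<lambda>k. exp (- lam * s) * ((lam * s) ^ k /\<^sub>R fact k)) sums (exp (- lam * s) * exp (lam * s))"
      by (intro sums_mult exp_converges)
    then have "poisson_weight s sums 1"
      by (simp add: poisson_weight_def[abs_def] exp_minus divide_inverse mult_ac)
    then show ?thesis by (simp add: sums_iff)
  qed
  finally show ?thesis by simp
qed

lemma integrable_ncgamma:
  assumes "a \<ge> 1/2" "s \<ge> 0"
  shows "integrable lborel (ncgamma a s)" and "integral\<^sup>L lborel (ncgamma a s) = 1"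
proof -
  have "has_bochner_integral lborel (ncgamma a s) 1"
    using assms by (intro has_bochner_integral_nn_integral) (auto simp: ncgamma_nonneg nn_integral_ncgamma)
  then show "integrable lborel (ncgamma a s)" "integral\<^sup>L lborel (ncgamma a s) = 1"
    by (auto simp: has_bochner_integral_iff)
qed

lemma integrable_ncgamma_mean:
  assumes "a \<ge> 1/2" "s \<ge> 0"
  shows "integrable lborel (\<lambda>y. y * ncgamma a s y)" and "(\<integral>y. y * ncgamma a s y \<partial>lborel) = a / lam + s"
  unfolding ncgamma_times[OF assms(1)] using integrable_ncgamma[of "a+1" s] integrable_ncgamma[of "a+2" s] assms
  by auto

end

section \<open>The law of the channel output\<close>

lemma nn_integral_exhaust:
  fixes h :: "real \<Rightarrow> ennreal"
  assumes [measurable]: "h \<in> borel_measurable borel" and h: "\<And>x. x < 0 \<Longrightarrow> h x = 0"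
    and b: "incseq b" "\<And>n. real n \<le> b n"
  shows "(\<lambda>n. \<integral>\<^sup>+x. h x * indicator {0..b n} x \<partial>lborel) \<longlonglongrightarrow> (\<integral>\<^sup>+x. h x \<partial>lborel)"
proof (rule nn_integral_LIMSEQ)
  show "incseq (\<lambda>n x. h x * indicator {0..b n} x)"
    using incseq_SucD[OF b(1)]
    by (intro incseq_SucI le_funI mult_left_mono) (auto intro: order_trans split: split_indicator)
  fix x :: real
  have "eventually (\<lambda>n. h x * indicator {0..b n} x = h x) sequentially"
  proof (rule eventually_sequentiallyI[of "nat \<lceil>x\<rceil>"])
    fix n assume "nat \<lceil>x\<rceil> \<le> n"
    then have "x \<le> b n" using b(2)[of n] by linarith
    then show "h x * indicator {0..b n} x = h x"
      using h[of x] by (auto split: split_indicator)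
  qed
  then show "(\<lambda>n. h x * indicator {0..b n} x) \<longlonglongrightarrow> h x" by (rule tendsto_eventually)
qed simp

text \<open>
  The substitution rule on \<open>{0..n + 1}\<close>, followed by monotone convergence in \<open>n\<close>.
\<close>

lemma nn_integral_positive_square_substitution:
  fixes F :: "real \<Rightarrow> ennreal"
  assumes [measurable]: "F \<in> borel_measurable borel"
  shows "(\<integral>\<^sup>+u. F u * indicator {0<..} u \<partial>lborel) =
    (\<integral>\<^sup>+w. F (sqrt w) * ennreal (1 / (2 * sqrt w)) * indicator {0<..} w \<partial>lborel)"
proof -
  define h where "h = (\<lambda>w. F (sqrt w) * ennreal (1 / (2 * sqrt w)) * indicator {0<..} w)"
  have [measurable]: "h \<in> borel_measurable borel" unfolding h_def by measurable
  have step: "(\<integral>\<^sup>+w. h w * indicator {0..(real n + 1)\<^sup>2} w \<partial>lborel) =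
      (\<integral>\<^sup>+u. F u * indicator {0<..} u * indicator {0..real n + 1} u \<partial>lborel)" for n
  proof -
    have "(\<integral>\<^sup>+w. h w * indicator {0\<^sup>2..(real n + 1)\<^sup>2} w \<partial>lborel) =
        (\<integral>\<^sup>+u. h (u\<^sup>2) * ennreal (2 * u) * indicator {0..real n + 1} u \<partial>lborel)"
      by (rule nn_integral_substitution_aux) (auto intro!: derivative_eq_intros continuous_intros)
    also have "\<dots> = (\<integral>\<^sup>+u. F u * indicator {0<..} u * indicator {0..real n + 1} u \<partial>lborel)"
    proof (rule nn_integral_cong)
      fix u :: real
      show "h (u\<^sup>2) * ennreal (2 * u) * indicator {0..real n + 1} u =
          F u * indicator {0<..} u * indicator {0..real n + 1} u"
      proof (cases "u > 0")
        case True
        then have "ennreal (1 / (2 * u)) * ennreal (2 * u) = 1"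
          by (simp add: ennreal_mult'[symmetric])
        then show ?thesis using True by (simp add: h_def mult.assoc)
      next
        case False
        then show ?thesis by (cases "u = 0") (auto simp: h_def)
      qed
    qed
    finally show ?thesis by simp
  qed
  have sq: "real n \<le> (real n + 1)\<^sup>2" for n by (simp add: power2_eq_square algebra_simps)
  have 1: "(\<lambda>n. \<integral>\<^sup>+w. h w * indicator {0..(real n + 1)\<^sup>2} w \<partial>lborel) \<longlonglongrightarrow> (\<integral>\<^sup>+w. h w \<partial>lborel)"
    by (rule nn_integral_exhaust) (auto simp: h_def sq intro!: incseq_SucI power_mono)
  have 2: "(\<lambda>n. \<integral>\<^sup>+u. F u * indicator {0<..} u * indicator {0..real n + 1} u \<partial>lborel)
      \<longlonglongrightarrow> (\<integral>\<^sup>+u. F u * indicator {0<..} u \<partial>lborel)"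
    by (rule nn_integral_exhaust) (auto intro!: incseq_SucI)
  show ?thesis
    using LIMSEQ_unique[OF 1[unfolded step] 2] by (simp add: h_def)
qed

lemma nn_integral_square_fibres:
  fixes F :: "real \<Rightarrow> ennreal"
  assumes [measurable]: "F \<in> borel_measurable borel"
  shows "(\<integral>\<^sup>+u. F u \<partial>lborel) =
    (\<integral>\<^sup>+w. (F (sqrt w) + F (- sqrt w)) * ennreal (1 / (2 * sqrt w)) * indicator {0<..} w \<partial>lborel)"
proof -
  have "(\<integral>\<^sup>+u. F u \<partial>lborel) = (\<integral>\<^sup>+u. F u * indicator {0<..} u + F u * indicator {..<0} u \<partial>lborel)"
  proof (rule nn_integral_cong_AE)
    have "AE u in lborel. u \<noteq> (0::real)" by (rule AE_lborel_singleton)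
    then show "AE u in lborel. F u = F u * indicator {0<..} u + F u * indicator {..<0} u"
      by eventually_elim (auto split: split_indicator)
  qed
  also have "\<dots> = (\<integral>\<^sup>+u. F u * indicator {0<..} u \<partial>lborel) + (\<integral>\<^sup>+u. F u * indicator {..<0} u \<partial>lborel)"
    by (intro nn_integral_add) auto
  also have "(\<integral>\<^sup>+u. F u * indicator {..<0} u \<partial>lborel) = (\<integral>\<^sup>+u. F (- u) * indicator {0<..} u \<partial>lborel)"
    by (subst nn_integral_real_affine[of _ "-1" 0])
       (auto intro!: nn_integral_cong split: split_indicator)
  also have "(\<integral>\<^sup>+u. F u * indicator {0<..} u \<partial>lborel) + \<dots> =
    (\<integral>\<^sup>+w. (F (sqrt w) + F (- sqrt w)) * ennreal (1 / (2 * sqrt w)) * indicator {0<..} w \<partial>lborel)"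
    by (subst (1 2) nn_integral_positive_square_substitution, simp, simp, subst nn_integral_add[symmetric])
       (auto intro!: nn_integral_cong simp: distrib_right)
  finally show ?thesis .
qed

context gamma_rate begin

text \<open>
  Scaling \<open>g = y * t\<close> turns the left side into a Beta integral.
\<close>

lemma gamma_density_convolution:
  assumes "a > 0" "b > 0"
  shows "(\<integral>\<^sup>+g. ennreal (gamma_density a lam g) * ennreal (gamma_density b lam (y - g)) \<partial>lborel) =
    ennreal (gamma_density (a + b) lam y)"
proof (cases "y > 0")
  case False
  then have "gamma_density a lam g = 0 \<or> gamma_density b lam (y - g) = 0" for g
    by (auto simp: gamma_density_def)
  then have *: "ennreal (gamma_density a lam g) * ennreal (gamma_density b lam (y - g)) = 0" for g
    by (metis ennreal_0 mult_zero_left mult_zero_right)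
  show ?thesis using False unfolding * by (simp add: gamma_density_def)
next
  case True
  have G: "Gamma a > 0" "Gamma b > 0" "Gamma (a + b) > 0" using assms by (auto intro!: Gamma_real_pos)
  define C where "C = lam powr (a + b) / (Gamma a * Gamma b) * y powr (a + b - 2) * exp (- lam * y)"
  have C: "C \<ge> 0" unfolding C_def using G by (intro mult_nonneg_nonneg divide_nonneg_nonneg) auto
  have eq: "ennreal (gamma_density a lam (y * t)) * ennreal (gamma_density b lam (y - y * t)) =
      ennreal C * (ennreal (t powr (a - 1) * (1 - t) powr (b - 1)) * indicator {0..1} t)"
    if t: "t \<noteq> 0" "t \<noteq> 1" for t
  proof (cases "0 < t \<and> t < 1")
    case t: True
    then have pos: "y * t > 0" "y - y * t > 0" "y - y * t = y * (1 - t)"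
      using True by (auto simp: algebra_simps)
    have e: "exp (- lam * y) = exp (- lam * (y * t)) * exp (- lam * (y - y * t))"
      by (simp add: exp_add[symmetric] algebra_simps)
    have p: "y powr (a + b - 2) = y powr (a - 1) * y powr (b - 1)"
      by (simp add: powr_add[symmetric])
    have "gamma_density a lam (y * t) * gamma_density b lam (y - y * t) =
        C * (t powr (a - 1) * (1 - t) powr (b - 1))"
      using pos(1,2) t True unfolding gamma_density_def C_def e p powr_add
      by (simp add: pos(3) powr_mult)
    then have "ennreal (gamma_density a lam (y * t)) * ennreal (gamma_density b lam (y - y * t)) =
        ennreal (C * (t powr (a - 1) * (1 - t) powr (b - 1)))"
      using assms by (simp add: ennreal_mult'[symmetric] gamma_density_nonneg)
    also have "\<dots> = ennreal C * ennreal (t powr (a - 1) * (1 - t) powr (b - 1))"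
      using C by (simp add: ennreal_mult')
    finally show ?thesis using t by simp
  next
    case False
    then have "t < 0 \<or> t > 1" using t by auto
    then have "y * t \<le> 0 \<or> y - y * t \<le> 0"
      using True by (auto simp: mult_le_0_iff)
    then have "gamma_density a lam (y * t) = 0 \<or> gamma_density b lam (y - y * t) = 0"
      by (auto simp: gamma_density_def)
    then show ?thesis using \<open>t < 0 \<or> t > 1\<close> by auto
  qed
  have ae: "AE t in lborel. t \<noteq> 0 \<and> t \<noteq> (1::real)"
    using AE_lborel_singleton[of "0::real"] AE_lborel_singleton[of "1::real"] by eventually_elim auto
  have "(\<integral>\<^sup>+g. ennreal (gamma_density a lam g) * ennreal (gamma_density b lam (y - g)) \<partial>lborel) =
      ennreal y * (\<integral>\<^sup>+t. ennreal (gamma_density a lam (y * t)) * ennreal (gamma_density b lam (y - y * t)) \<partial>lborel)"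
    using True by (subst nn_integral_real_affine[of _ y 0]) auto
  also have "(\<integral>\<^sup>+t. ennreal (gamma_density a lam (y * t)) * ennreal (gamma_density b lam (y - y * t)) \<partial>lborel) =
     (\<integral>\<^sup>+t. ennreal C * (ennreal (t powr (a - 1) * (1 - t) powr (b - 1)) * indicator {0..1} t) \<partial>lborel)"
    by (intro nn_integral_cong_AE eventually_mono[OF ae]) (auto simp: eq)
  also have "\<dots> = ennreal C * (\<integral>\<^sup>+t. ennreal (t powr (a - 1) * (1 - t) powr (b - 1)) * indicator {0..1} t \<partial>lborel)"
    by (intro nn_integral_cmult) measurable
  also have "(\<integral>\<^sup>+t. ennreal (t powr (a - 1) * (1 - t) powr (b - 1)) * indicator {0..1} t \<partial>lborel) =
      (\<integral>\<^sup>+t. ennreal (indicator {0..1} t * (t powr (a - 1) * (1 - t) powr (b - 1))) \<partial>lborel)"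
    by (intro nn_integral_cong) (auto split: split_indicator)
  also have "\<dots> = ennreal (Beta a b)"
    using nn_integral_has_integral_lebesgue[OF _ has_integral_Beta_real[OF assms]] by simp
  also have "ennreal y * (ennreal C * ennreal (Beta a b)) = ennreal (y * (C * Beta a b))"
  proof -
    have "Beta a b \<ge> 0" unfolding Beta_def using G by simp
    then show ?thesis using True C by (simp add: ennreal_mult')
  qed
  also have "y * (C * Beta a b) = gamma_density (a + b) lam y"
  proof -
    have "y powr (a + b - 1) = y powr ((a + b - 2) + 1)" by (rule arg_cong[of _ _ "\<lambda>z. y powr z"]) simp
    also have "\<dots> = y powr (a + b - 2) * y" using True by (simp only: powr_add) simp
    finally show ?thesis
      using True G unfolding gamma_density_def Beta_def C_def by (simp add: field_simps)
  qed
  finally show ?thesis .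
qed

text \<open>
  Stated for the law instead of the density in the first argument, so that it includes \<open>a = 0\<close>,
  the point mass at \<open>0\<close>; this is the channel with \<open>\<alpha> = 1/2\<close>.
\<close>

lemma gamma_law_convolution:
  fixes f :: "real \<Rightarrow> ennreal"
  assumes "a \<ge> 0" "b > 0" and [measurable]: "f \<in> borel_measurable borel"
  shows "(\<integral>\<^sup>+g. \<integral>\<^sup>+w. f (g + w) * ennreal (gamma_density b lam w) \<partial>lborel \<partial>gamma_law a lam) =
    (\<integral>\<^sup>+y. f y * ennreal (gamma_density (a + b) lam y) \<partial>lborel)"
proof (cases "a = 0")
  case True
  then show ?thesis by (simp add: gamma_law_def nn_integral_return)
next
  case False
  with assms have a: "a > 0" by simp
  have shift: "(\<integral>\<^sup>+w. f (g + w) * ennreal (gamma_density b lam w) \<partial>lborel) =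
      (\<integral>\<^sup>+y. f y * ennreal (gamma_density b lam (y - g)) \<partial>lborel)" for g
    by (subst nn_integral_real_affine[of "\<lambda>w. f (g + w) * ennreal (gamma_density b lam w)" 1 "- g"]) auto
  have "(\<integral>\<^sup>+g. \<integral>\<^sup>+w. f (g + w) * ennreal (gamma_density b lam w) \<partial>lborel \<partial>gamma_law a lam) =
      (\<integral>\<^sup>+g. ennreal (gamma_density a lam g) * (\<integral>\<^sup>+y. f y * ennreal (gamma_density b lam (y - g)) \<partial>lborel) \<partial>lborel)"
    unfolding shift using a by (simp add: gamma_law_def nn_integral_density)
  also have "\<dots> = (\<integral>\<^sup>+g. (\<integral>\<^sup>+y. f y * (ennreal (gamma_density a lam g) * ennreal (gamma_density b lam (y - g))) \<partial>lborel) \<partial>lborel)"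
    by (intro nn_integral_cong) (simp add: nn_integral_cmult[symmetric] mult_ac)
  also have "\<dots> = (\<integral>\<^sup>+y. (\<integral>\<^sup>+g. f y * (ennreal (gamma_density a lam g) * ennreal (gamma_density b lam (y - g))) \<partial>lborel) \<partial>lborel)"
    by (rule lborel_pair.Fubini') simp
  also have "\<dots> = (\<integral>\<^sup>+y. f y * ennreal (gamma_density (a + b) lam y) \<partial>lborel)"
    by (simp add: nn_integral_cmult gamma_density_convolution a assms)
  finally show ?thesis .
qed

lemma ennreal_ncgamma_suminf:
  assumes "a \<ge> 1/2" "s \<ge> 0"
  shows "(\<Sum>k. ennreal (poisson_weight s k) * ennreal (gamma_density (a + real k) lam y)) = ennreal (ncgamma a s y)"
proof -
  have "(\<lambda>k. ennreal (poisson_weight s k * gamma_density (a + real k) lam y)) sums ennreal (ncgamma a s y)"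
    using assms ncgamma_mixture[OF assms(1), of s y]
    by (auto intro!: sums_ennreal[THEN iffD2] mult_nonneg_nonneg poisson_weight_nonneg gamma_density_nonneg ncgamma_nonneg)
  then show ?thesis
    using assms by (simp add: sums_iff ennreal_mult' poisson_weight_nonneg)
qed

lemma gamma_law_ncgamma_convolution:
  fixes f :: "real \<Rightarrow> ennreal"
  assumes "a \<ge> 0" "b \<ge> 1/2" "s \<ge> 0" and [measurable]: "f \<in> borel_measurable borel"
  shows "(\<integral>\<^sup>+g. \<integral>\<^sup>+w. f (g + w) * ennreal (ncgamma b s w) \<partial>lborel \<partial>gamma_law a lam) =
    (\<integral>\<^sup>+y. f y * ennreal (ncgamma (a + b) s y) \<partial>lborel)"
proof -
  have sets [measurable_cong]: "sets (gamma_law a lam) = sets borel"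
    by (simp add: gamma_law_def)
  have mix: "(\<integral>\<^sup>+w. F w * ennreal (ncgamma c s w) \<partial>lborel) =
      (\<Sum>k. ennreal (poisson_weight s k) * (\<integral>\<^sup>+w. F w * ennreal (gamma_density (c + real k) lam w) \<partial>lborel))"
    if "c \<ge> 1/2" and [measurable]: "F \<in> borel_measurable borel" for F :: "real \<Rightarrow> ennreal" and c
  proof -
    have "F w * ennreal (ncgamma c s w) =
        (\<Sum>k. ennreal (poisson_weight s k) * (F w * ennreal (gamma_density (c + real k) lam w)))" for w
      unfolding ennreal_ncgamma_suminf[OF that(1) assms(3), symmetric] ennreal_suminf_cmult[symmetric]
      by (simp only: mult.left_commute)
    then show ?thesis
      by (simp add: nn_integral_suminf nn_integral_cmult)
  qed
  have "(\<integral>\<^sup>+g. \<integral>\<^sup>+w. f (g + w) * ennreal (ncgamma b s w) \<partial>lborel \<partial>gamma_law a lam) =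
      (\<integral>\<^sup>+g. (\<Sum>k. ennreal (poisson_weight s k) *
        (\<integral>\<^sup>+w. f (g + w) * ennreal (gamma_density (b + real k) lam w) \<partial>lborel)) \<partial>gamma_law a lam)"
    by (intro nn_integral_cong mix assms(2)) simp
  also have "\<dots> = (\<Sum>k. ennreal (poisson_weight s k) *
      (\<integral>\<^sup>+g. \<integral>\<^sup>+w. f (g + w) * ennreal (gamma_density (b + real k) lam w) \<partial>lborel \<partial>gamma_law a lam))"
    by (simp add: nn_integral_suminf nn_integral_cmult)
  also have "\<dots> = (\<Sum>k. ennreal (poisson_weight s k) *
      (\<integral>\<^sup>+y. f y * ennreal (gamma_density (a + b + real k) lam y) \<partial>lborel))"
    using assms by (intro suminf_cong) (simp add: gamma_law_convolution add.assoc)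
  also have "\<dots> = (\<integral>\<^sup>+y. f y * ennreal (ncgamma (a + b) s y) \<partial>lborel)"
    using assms by (subst mix) auto
  finally show ?thesis .
qed

text \<open>
  The density of \<open>sqrt s + N / sqrt (2 * lam)\<close> for a standard Gaussian \<open>N\<close>.
\<close>

definition shifted_gauss :: "real \<Rightarrow> real \<Rightarrow> real" where
  "shifted_gauss s u = sqrt (lam / pi) * exp (- lam * (u - sqrt s)\<^sup>2)"

lemma borel_measurable_shifted_gauss [measurable]: "shifted_gauss s \<in> borel_measurable borel"
  unfolding shifted_gauss_def by measurable

lemma shifted_gauss_nonneg: "shifted_gauss s u \<ge> 0"
  using lam_pos by (simp add: shifted_gauss_def)

lemma nn_integral_affine_normal:
  fixes F :: "real \<Rightarrow> ennreal"
  assumes [measurable]: "F \<in> borel_measurable borel"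
  shows "(\<integral>\<^sup>+n. F (sqrt s + n / sqrt (2 * lam)) \<partial>density lborel std_normal_density) =
    (\<integral>\<^sup>+u. F u * ennreal (shifted_gauss s u) \<partial>lborel)"
proof -
  have l: "sqrt (2 * lam) > 0" using lam_pos by simp
  have d: "1 / sqrt (2 * lam) * shifted_gauss s (sqrt s + n / sqrt (2 * lam)) = std_normal_density n" for n
    using lam_pos unfolding shifted_gauss_def std_normal_density_def
    by (simp add: power_divide real_sqrt_divide real_sqrt_mult field_simps)
  have "(\<integral>\<^sup>+u. F u * ennreal (shifted_gauss s u) \<partial>lborel) =
      ennreal (1 / sqrt (2 * lam)) * (\<integral>\<^sup>+n. F (sqrt s + n / sqrt (2 * lam)) *
        ennreal (shifted_gauss s (sqrt s + n / sqrt (2 * lam))) \<partial>lborel)"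
    using l lam_pos by (subst nn_integral_real_affine[of _ "1 / sqrt (2 * lam)" "sqrt s"]) auto
  also have "\<dots> = (\<integral>\<^sup>+n. ennreal (1 / sqrt (2 * lam) * shifted_gauss s (sqrt s + n / sqrt (2 * lam))) *
      F (sqrt s + n / sqrt (2 * lam)) \<partial>lborel)"
  proof -
    have m: "ennreal (1 / sqrt (2 * lam) * shifted_gauss s (sqrt s + n / sqrt (2 * lam))) =
        ennreal (1 / sqrt (2 * lam)) * ennreal (shifted_gauss s (sqrt s + n / sqrt (2 * lam)))" for n
      by (rule ennreal_mult) (use lam_pos in \<open>auto simp: shifted_gauss_nonneg\<close>)
    show ?thesis
      unfolding m by (subst nn_integral_cmult[symmetric]) (simp_all add: mult_ac)
  qed
  finally show ?thesis
    unfolding d by (simp add: nn_integral_density)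
qed

text \<open>
  Expanding the squares leaves \<open>cosh\<close> and \<open>sinh\<close> of \<open>2 lam sqrt (s w)\<close>, which are the series of shapes
  \<open>1/2\<close> and \<open>3/2\<close>. The sum over the two square roots of \<open>w\<close> gives the law of the squared Gaussian, the
  difference governs expectations weighted with the Gaussian itself.
\<close>

lemma shifted_gauss_even_odd:
  assumes "s \<ge> 0" "w > 0"
  shows "(shifted_gauss s (sqrt w) + shifted_gauss s (- sqrt w)) * (1 / (2 * sqrt w)) = ncgamma (1/2) s w"
    and "(shifted_gauss s (sqrt w) - shifted_gauss s (- sqrt w)) * (1 / 2) = sqrt s * ncgamma (3/2) s w"
proof -
  define z where "z = lam * sqrt s * sqrt w"
  have l: "sqrt (lam\<^sup>2 * s * w) = z"
    using lam_pos by (simp add: real_sqrt_mult z_def)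
  have e: "exp (- lam * (sqrt w - sqrt s)\<^sup>2) = exp (- lam * (s + w)) * exp (2 * z)"
          "exp (- lam * (- sqrt w - sqrt s)\<^sup>2) = exp (- lam * (s + w)) * exp (- (2 * z))"
    using assms by (simp_all add: z_def exp_add[symmetric] power2_diff algebra_simps power2_eq_square[of "- sqrt w - sqrt s"])
  have w: "w powr (1/2 - 1) = 1 / sqrt w" "w powr (3/2 - 1) = sqrt w"
    using assms by (simp_all add: powr_half_sqrt powr_minus_divide)
  have lp: "lam powr (1/2) = sqrt lam" "lam powr (3/2) = lam * sqrt lam"
  proof -
    show "lam powr (1/2) = sqrt lam" using lam_pos by (simp add: powr_half_sqrt)
    have "lam powr (3/2) = lam powr (1 + 1/2)" by simp
    also have "\<dots> = lam * sqrt lam" using lam_pos by (simp only: powr_add powr_half_sqrt) simp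
    finally show "lam powr (3/2) = lam * sqrt lam" .
  qed
  show "(shifted_gauss s (sqrt w) + shifted_gauss s (- sqrt w)) * (1 / (2 * sqrt w)) = ncgamma (1/2) s w"
  proof -
    have "bessel_series (1/2) (lam\<^sup>2 * s * w) = cosh (2 * z) / sqrt pi"
      using assms by (subst bessel_series_half) (auto simp: l)
    then show ?thesis
      using assms lam_pos unfolding shifted_gauss_def e ncgamma_def w lp
      by (simp add: cosh_def real_sqrt_divide distrib_left distrib_right add_divide_distrib mult_ac)
  qed
  show "(shifted_gauss s (sqrt w) - shifted_gauss s (- sqrt w)) * (1 / 2) = sqrt s * ncgamma (3/2) s w"
  proof (cases "s = 0")
    case False
    with assms have "lam\<^sup>2 * s * w > 0" using lam_pos by auto
    from bessel_series_three_halves[OF this]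
    have b: "bessel_series (3/2) (lam\<^sup>2 * s * w) = sinh (2 * z) / (sqrt pi * (lam * sqrt s * sqrt w))"
      unfolding l by (simp add: z_def)
    then show ?thesis
      using assms False lam_pos unfolding shifted_gauss_def e ncgamma_def w lp b
      by (simp add: sinh_def real_sqrt_divide field_simps)
  qed (simp add: shifted_gauss_def)
qed

text \<open>
  By \<open>shifted_gauss_even_odd\<close> the squared Gaussian is noncentral gamma of shape \<open>1/2\<close>; the independent
  gamma variable adds its shape.
\<close>

lemma channel_output_law:
  fixes f :: "real \<Rightarrow> ennreal"
  assumes "a \<ge> 0" "s \<ge> 0" and [measurable]: "f \<in> borel_measurable borel"
  shows "(\<integral>\<^sup>+g. \<integral>\<^sup>+n. f (g + (sqrt s + n / sqrt (2 * lam))\<^sup>2) \<partial>density lborel std_normal_density \<partial>gamma_law a lam) =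
    (\<integral>\<^sup>+y. f y * ennreal (ncgamma (a + 1/2) s y) \<partial>lborel)"
proof -
  have "(\<integral>\<^sup>+n. f (g + (sqrt s + n / sqrt (2 * lam))\<^sup>2) \<partial>density lborel std_normal_density) =
      (\<integral>\<^sup>+w. f (g + w) * ennreal (ncgamma (1/2) s w) \<partial>lborel)" for g
  proof -
    have "(\<integral>\<^sup>+n. f (g + (sqrt s + n / sqrt (2 * lam))\<^sup>2) \<partial>density lborel std_normal_density) =
      (\<integral>\<^sup>+u. f (g + u\<^sup>2) * ennreal (shifted_gauss s u) \<partial>lborel)"
      by (rule nn_integral_affine_normal) simp
    also have "\<dots> = (\<integral>\<^sup>+w. (f (g + (sqrt w)\<^sup>2) * ennreal (shifted_gauss s (sqrt w)) +
        f (g + (- sqrt w)\<^sup>2) * ennreal (shifted_gauss s (- sqrt w))) * ennreal (1 / (2 * sqrt w)) * indicator {0<..} w \<partial>lborel)"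
      by (rule nn_integral_square_fibres) simp
    also have "\<dots> = (\<integral>\<^sup>+w. f (g + w) * ennreal (ncgamma (1/2) s w) \<partial>lborel)"
    proof (rule nn_integral_cong)
      fix w :: real
      show "(f (g + (sqrt w)\<^sup>2) * ennreal (shifted_gauss s (sqrt w)) +
          f (g + (- sqrt w)\<^sup>2) * ennreal (shifted_gauss s (- sqrt w))) * ennreal (1 / (2 * sqrt w)) * indicator {0<..} w =
          f (g + w) * ennreal (ncgamma (1/2) s w)"
      proof (cases "w > 0")
        case True
        have "ennreal (ncgamma (1/2) s w) = (ennreal (shifted_gauss s (sqrt w)) +
            ennreal (shifted_gauss s (- sqrt w))) * ennreal (1 / (2 * sqrt w))"
          unfolding shifted_gauss_even_odd(1)[OF assms(2) True, symmetric]
          using True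
          by (subst ennreal_mult, simp_all only: ennreal_plus shifted_gauss_nonneg add_nonneg_nonneg) simp
        then show ?thesis
          using True by (simp add: distrib_left distrib_right mult_ac)
      qed simp
    qed
    finally show ?thesis .
  qed
  then show ?thesis
    using gamma_law_ncgamma_convolution[OF assms(1) _ assms(2,3), of "1/2"] by simp
qed

text \<open>
  In terms of expectations, \<open>E (U f(G + U^2))\<close> is \<open>sqrt s\<close> times the integral of \<open>f\<close> against the
  noncentral gamma density of raised shape. The negative part of \<open>U\<close> stands on the right, so that the
  identity makes sense for every nonnegative \<open>f\<close>.
\<close>

lemma channel_output_law_tilted:
  fixes f :: "real \<Rightarrow> ennreal"
  assumes "a \<ge> 0" "s \<ge> 0" and [measurable]: "f \<in> borel_measurable borel"
  defines "U \<equiv> \<lambda>n. sqrt s + n / sqrt (2 * lam)"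
  shows "(\<integral>\<^sup>+g. \<integral>\<^sup>+n. ennreal (U n) * f (g + (U n)\<^sup>2) \<partial>density lborel std_normal_density \<partial>gamma_law a lam) =
    (\<integral>\<^sup>+g. \<integral>\<^sup>+n. ennreal (- U n) * f (g + (U n)\<^sup>2) \<partial>density lborel std_normal_density \<partial>gamma_law a lam) +
    ennreal (sqrt s) * (\<integral>\<^sup>+y. f y * ennreal (ncgamma (a + 3/2) s y) \<partial>lborel)"
proof -
  have sets [measurable_cong]: "sets (gamma_law a lam) = sets borel"
    by (simp add: gamma_law_def)
  have inner: "(\<integral>\<^sup>+n. ennreal (U n) * f (g + (U n)\<^sup>2) \<partial>density lborel std_normal_density) =
      (\<integral>\<^sup>+n. ennreal (- U n) * f (g + (U n)\<^sup>2) \<partial>density lborel std_normal_density) +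
      ennreal (sqrt s) * (\<integral>\<^sup>+w. f (g + w) * ennreal (ncgamma (3/2) s w) \<partial>lborel)" for g
  proof -
    have pos: "(\<integral>\<^sup>+n. ennreal (c * U n) * f (g + (U n)\<^sup>2) \<partial>density lborel std_normal_density) =
        (\<integral>\<^sup>+w. f (g + w) * ennreal (shifted_gauss s (c * sqrt w) / 2) * indicator {0<..} w \<partial>lborel)"
      if c: "c = 1 \<or> c = - 1" for c
    proof -
      have "(\<integral>\<^sup>+n. ennreal (c * U n) * f (g + (U n)\<^sup>2) \<partial>density lborel std_normal_density) =
          (\<integral>\<^sup>+u. ennreal (c * u) * f (g + u\<^sup>2) * ennreal (shifted_gauss s u) \<partial>lborel)"
        unfolding U_def by (rule nn_integral_affine_normal) simp
      also have "\<dots> = (\<integral>\<^sup>+w. (ennreal (c * sqrt w) * f (g + (sqrt w)\<^sup>2) * ennreal (shifted_gauss s (sqrt w)) +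
          ennreal (c * - sqrt w) * f (g + (- sqrt w)\<^sup>2) * ennreal (shifted_gauss s (- sqrt w))) * ennreal (1 / (2 * sqrt w)) * indicator {0<..} w \<partial>lborel)"
        by (rule nn_integral_square_fibres) simp
      also have "\<dots> = (\<integral>\<^sup>+w. f (g + w) * ennreal (shifted_gauss s (c * sqrt w) / 2) * indicator {0<..} w \<partial>lborel)"
      proof (rule nn_integral_cong)
        fix w :: real
        show "(ennreal (c * sqrt w) * f (g + (sqrt w)\<^sup>2) * ennreal (shifted_gauss s (sqrt w)) +
          ennreal (c * - sqrt w) * f (g + (- sqrt w)\<^sup>2) * ennreal (shifted_gauss s (- sqrt w))) * ennreal (1 / (2 * sqrt w)) * indicator {0<..} w =
          f (g + w) * ennreal (shifted_gauss s (c * sqrt w) / 2) * indicator {0<..} w"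
        proof (cases "w > 0")
          case True
          have "ennreal (sqrt w) * ennreal x * ennreal (1 / (2 * sqrt w)) = ennreal (x / 2)" if "x \<ge> 0" for x
            using True that by (simp add: ennreal_mult'[symmetric])
          then have *: "ennreal (sqrt w) * F * ennreal x * ennreal (1 / (2 * sqrt w)) = F * ennreal (x / 2)" if "x \<ge> 0" for x F
            using that by (metis mult.assoc mult.commute)
          from c True show ?thesis
            by (elim disjE) (simp_all add: * shifted_gauss_nonneg ennreal_neg)
        qed simp
      qed
      finally show ?thesis .
    qed
    have "f (g + w) * ennreal (shifted_gauss s (sqrt w) / 2) * indicator {0<..} w =
        f (g + w) * ennreal (shifted_gauss s (- sqrt w) / 2) * indicator {0<..} w +
        ennreal (sqrt s) * (f (g + w) * ennreal (ncgamma (3/2) s w))" for w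
    proof (cases "w > 0")
      case True
      have e: "shifted_gauss s (sqrt w) / 2 = shifted_gauss s (- sqrt w) / 2 + sqrt s * ncgamma (3/2) s w"
        using shifted_gauss_even_odd(2)[OF assms(2) True] by simp
      have "ennreal (shifted_gauss s (sqrt w) / 2) = ennreal (shifted_gauss s (- sqrt w) / 2) +
          ennreal (sqrt s) * ennreal (ncgamma (3/2) s w)"
        unfolding e using assms(2)
        by (subst ennreal_plus) (auto simp: ennreal_mult ncgamma_nonneg shifted_gauss_nonneg)
      then show ?thesis using True by (simp add: distrib_left mult_ac)
    qed simp
    then have "(\<integral>\<^sup>+w. f (g + w) * ennreal (shifted_gauss s (sqrt w) / 2) * indicator {0<..} w \<partial>lborel) =
        (\<integral>\<^sup>+w. f (g + w) * ennreal (shifted_gauss s (- sqrt w) / 2) * indicator {0<..} w \<partial>lborel) +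
        ennreal (sqrt s) * (\<integral>\<^sup>+w. f (g + w) * ennreal (ncgamma (3/2) s w) \<partial>lborel)"
      by (simp add: nn_integral_add nn_integral_cmult)
    then show ?thesis using pos[of 1] pos[of "- 1"] by simp
  qed
  have U [measurable]: "U \<in> borel_measurable borel" unfolding U_def by measurable
  interpret S: sigma_finite_measure "density lborel std_normal_density"
    by (simp add: prob_space_normal_density prob_space_imp_sigma_finite)
  show ?thesis
    unfolding inner
    using gamma_law_ncgamma_convolution[OF assms(1) _ assms(2,3), of "3/2"]
    by (simp add: nn_integral_add nn_integral_cmult)
qed

end

section \<open>Limits and derivatives of integrals\<close>

lemma continuous_on_integral_dominated:
  fixes f :: "real \<Rightarrow> 'a \<Rightarrow> real"
  assumes meas: "\<And>t. t \<in> S \<Longrightarrow> f t \<in> borel_measurable M"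
    and cont: "AE x in M. continuous_on S (\<lambda>t. f t x)"
    and bound: "AE x in M. \<forall>t\<in>S. \<bar>f t x\<bar> \<le> w x"
    and w: "integrable M w"
  shows "continuous_on S (\<lambda>t. \<integral>x. f t x \<partial>M)"
  unfolding continuous_on_sequentially
proof (intro allI ballI impI, elim conjE)
  fix X t assume t: "t \<in> S" and X: "\<forall>n. X n \<in> S" "X \<longlonglongrightarrow> t"
  have "(\<lambda>n. \<integral>x. f (X n) x \<partial>M) \<longlonglongrightarrow> (\<integral>x. f t x \<partial>M)"
  proof (rule integral_dominated_convergence[where w = w])
    show "AE x in M. (\<lambda>n. f (X n) x) \<longlonglongrightarrow> f t x"
      using cont by eventually_elim (use X t in \<open>auto simp: continuous_on_sequentially o_def\<close>)
    show "AE x in M. norm (f (X n) x) \<le> w x" for n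
      using bound by eventually_elim (use X in auto)
  qed (use meas X t w in auto)
  then show "((\<lambda>t. \<integral>x. f t x \<partial>M) \<circ> X) \<longlonglongrightarrow> (\<integral>x. f t x \<partial>M)" by (simp add: o_def)
qed

lemma has_real_derivative_integral:
  fixes f f' :: "real \<Rightarrow> 'a \<Rightarrow> real"
  assumes S: "open S" "convex S" "t0 \<in> S"
    and int: "\<And>t. t \<in> S \<Longrightarrow> integrable M (f t)"
    and meas: "f' t0 \<in> borel_measurable M"
    and deriv: "AE x in M. \<forall>t\<in>S. ((\<lambda>t. f t x) has_real_derivative f' t x) (at t)"
    and bound: "AE x in M. \<forall>t\<in>S. \<bar>f' t x\<bar> \<le> w x"
    and w: "integrable M w"
  shows "((\<lambda>t. \<integral>x. f t x \<partial>M) has_real_derivative (\<integral>x. f' t0 x \<partial>M)) (at t0)"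
proof -
  have "((\<lambda>t. ((\<integral>x. f t x \<partial>M) - (\<integral>x. f t0 x \<partial>M)) / (t - t0)) \<longlongrightarrow> (\<integral>x. f' t0 x \<partial>M)) (at t0 within S)"
    unfolding tendsto_at_iff_sequentially
  proof (intro allI impI)
    fix X assume X: "\<forall>i. X i \<in> S - {t0}" "X \<longlonglongrightarrow> t0"
    have lim: "(\<lambda>n. \<integral>x. (f (X n) x - f t0 x) / (X n - t0) \<partial>M) \<longlonglongrightarrow> (\<integral>x. f' t0 x \<partial>M)"
    proof (rule integral_dominated_convergence[where w = w])
      show "AE x in M. (\<lambda>n. (f (X n) x - f t0 x) / (X n - t0)) \<longlonglongrightarrow> f' t0 x"
        using deriv
      proof eventually_elim
        case (elim x)
        then have "((\<lambda>t. (f t x - f t0 x) / (t - t0)) \<longlongrightarrow> f' t0 x) (at t0)"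
          using S by (auto simp: has_field_derivative_iff)
        then show ?case
          using X by (auto simp: tendsto_at_iff_sequentially o_def)
      qed
      show "AE x in M. norm ((f (X n) x - f t0 x) / (X n - t0)) \<le> w x" for n
        using deriv bound
      proof eventually_elim
        case (elim x)
        have Xn: "X n \<in> S" "X n \<noteq> t0" using X by auto
        have "norm (f (X n) x - f t0 x) \<le> w x * norm (X n - t0)"
          by (rule field_differentiable_bound[OF S(2), where f' = "\<lambda>t. f' t x"])
             (use elim S Xn in \<open>auto intro: has_field_derivative_at_within\<close>)
        then show ?case using Xn by (simp add: divide_le_eq)
      qed
    qed (use meas w int S X in \<open>auto intro!: borel_measurable_divide borel_measurable_diff borel_measurable_integrable\<close>)
    have eq: "(\<integral>x. (f (X n) x - f t0 x) / (X n - t0) \<partial>M) =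
        ((\<integral>x. f (X n) x \<partial>M) - (\<integral>x. f t0 x \<partial>M)) / (X n - t0)" for n
      using int[of "X n"] int[of t0] X S by auto
    show "((\<lambda>t. ((\<integral>x. f t x \<partial>M) - (\<integral>x. f t0 x \<partial>M)) / (t - t0)) \<circ> X)
        \<longlonglongrightarrow> (\<integral>x. f' t0 x \<partial>M)"
      using lim unfolding o_def eq .
  qed
  then show ?thesis
    unfolding has_field_derivative_iff at_within_open[OF S(3,1)] .
qed

text \<open>
  By Scheffe's lemma the bounds \<open>g n\<close> converge to \<open>g0\<close> in the mean. The functions \<open>f n\<close> therefore
  differ little in the mean from their truncations at \<open>g0\<close>, and to these the dominated convergence
  theorem applies.
\<close>

lemma tendsto_integral_moving_bound:
  fixes f g :: "nat \<Rightarrow> 'a \<Rightarrow> real"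
  assumes f [measurable]: "\<And>n. f n \<in> borel_measurable M" "f0 \<in> borel_measurable M"
    and g: "\<And>n. integrable M (g n)" "integrable M g0"
    and bound: "\<And>n x. \<bar>f n x\<bar> \<le> g n x"
    and f_lim: "\<And>x. (\<lambda>n. f n x) \<longlonglongrightarrow> f0 x"
    and g_lim: "\<And>x. (\<lambda>n. g n x) \<longlonglongrightarrow> g0 x"
    and g_int: "(\<lambda>n. integral\<^sup>L M (g n)) \<longlonglongrightarrow> integral\<^sup>L M g0"
  shows "(\<lambda>n. integral\<^sup>L M (f n)) \<longlonglongrightarrow> integral\<^sup>L M f0"
proof -
  have g_nn: "g n x \<ge> 0" for n x using bound[of n x] by linarith
  have g0_nn: "g0 x \<ge> 0" for x using LIMSEQ_le_const[OF g_lim[of x]] g_nn by blast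
  have f0_le: "\<bar>f0 x\<bar> \<le> g0 x" for x
    by (rule LIMSEQ_le[OF tendsto_rabs[OF f_lim] g_lim]) (use bound in blast)
  have [measurable]: "g n \<in> borel_measurable M" "g0 \<in> borel_measurable M" for n using g by auto
  have int_f: "integrable M (f n)" for n
    by (rule Bochner_Integration.integrable_bound[OF g(1)[of n]]) (use bound g_nn in auto)
  \<comment> \<open>clamping \<open>f n\<close> to the limit bound makes ordinary dominated convergence applicable\<close>
  define c where "c = (\<lambda>n x. max (- g0 x) (min (g0 x) (f n x)))"
  have c_le: "\<bar>c n x\<bar> \<le> g0 x" for n x
    unfolding c_def using g0_nn[of x] by linarith
  have [measurable]: "c n \<in> borel_measurable M" for n unfolding c_def by measurable
  have c: "(\<lambda>n. integral\<^sup>L M (c n)) \<longlonglongrightarrow> integral\<^sup>L M f0"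
  proof (rule integral_dominated_convergence[where w = g0])
    show "AE x in M. (\<lambda>n. c n x) \<longlonglongrightarrow> f0 x"
    proof (rule AE_I2)
      fix x
      have "(\<lambda>n. c n x) \<longlonglongrightarrow> max (- g0 x) (min (g0 x) (f0 x))"
        unfolding c_def by (intro tendsto_intros f_lim)
      then show "(\<lambda>n. c n x) \<longlonglongrightarrow> f0 x" using f0_le[of x] by (simp add: abs_le_iff)
    qed
    show "AE x in M. norm (c n x) \<le> g0 x" for n
      using c_le[of n] by simp
  qed (use g in measurable)
  have int_c: "integrable M (c n)" for n
    by (rule Bochner_Integration.integrable_bound[OF g(2)]) (use order_trans[OF c_le abs_ge_self] in simp_all)
  have "(\<lambda>n. \<integral>\<^sup>+x. norm (g n x - g0 x) \<partial>M) \<longlonglongrightarrow> 0"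
  proof (rule Scheffe_lemma1)
    have "(\<lambda>n. \<integral>\<^sup>+x. norm (g n x) \<partial>M) \<longlonglongrightarrow> (\<integral>\<^sup>+x. norm (g0 x) \<partial>M)"
      using g g_nn g0_nn g_int by (simp add: nn_integral_eq_integral tendsto_ennrealI)
    then show "limsup (\<lambda>n. \<integral>\<^sup>+x. norm (g n x) \<partial>M) \<le> (\<integral>\<^sup>+x. norm (g0 x) \<partial>M)"
      by (simp add: lim_imp_Limsup)
  qed (use g g_lim in auto)
  then have L1: "(\<lambda>n. \<integral>x. \<bar>g n x - g0 x\<bar> \<partial>M) \<longlonglongrightarrow> 0"
    using g by (subst (asm) nn_integral_eq_integral) (auto simp: tendsto_ennreal_iff[of _ _ 0, simplified])
  have "(\<lambda>n. integral\<^sup>L M (f n) - integral\<^sup>L M (c n)) \<longlonglongrightarrow> 0"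
  proof (rule Lim_null_comparison[OF _ L1], rule always_eventually, rule allI)
    fix n
    have "integral\<^sup>L M (f n) - integral\<^sup>L M (c n) = (\<integral>x. f n x - c n x \<partial>M)"
      using int_f int_c by simp
    also have "norm \<dots> \<le> (\<integral>x. \<bar>f n x - c n x\<bar> \<partial>M)"
      by (simp add: integral_norm_bound[of M "\<lambda>x. f n x - c n x", simplified])
    also have "\<dots> \<le> (\<integral>x. \<bar>g n x - g0 x\<bar> \<partial>M)"
    proof (rule integral_mono)
      show "\<bar>f n x - c n x\<bar> \<le> \<bar>g n x - g0 x\<bar>" for x
        using bound[of n x] g0_nn[of x] unfolding c_def by linarith
    qed (use int_f int_c g in auto)
    finally show "norm (integral\<^sup>L M (f n) - integral\<^sup>L M (c n)) \<le> (\<integral>x. \<bar>g n x - g0 x\<bar> \<partial>M)" .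
  qed
  from tendsto_add[OF this c] show ?thesis by simp
qed

text \<open>
  Integrability of \<open>g\<close> is part of the conclusion: the fundamental theorem on compact intervals bounds
  its integrals there, and since \<open>g\<close> is nonnegative they increase to the integral on the half line.
\<close>

lemma integration_by_parts_half_line:
  fixes f g G :: "real \<Rightarrow> real"
  assumes G: "\<And>y. y > 0 \<Longrightarrow> (G has_real_derivative f y + g y) (at y)"
    and cont: "continuous_on {0<..} f" "continuous_on {0<..} g"
    and g_nn: "\<And>y. y > 0 \<Longrightarrow> g y \<ge> 0"
    and f_int: "integrable lborel (\<lambda>y. indicator {0<..} y * f y)"
    and lim0: "(G \<longlongrightarrow> 0) (at_right 0)" and lim_top: "(G \<longlongrightarrow> 0) at_top"
  shows "has_bochner_integral lborel (\<lambda>y. indicator {0<..} y * g y) (- (\<integral>y. indicator {0<..} y * f y \<partial>lborel))"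
proof -
  \<comment> \<open>The intervals \<open>{1 / (n + 1)..n + 1}\<close> exhaust the half line.\<close>
  define l u :: "nat \<Rightarrow> real" where "l = (\<lambda>n. inverse (real (Suc n)))" and "u = (\<lambda>n. real (Suc n))"
  have lu: "0 < l n" "l n \<le> u n" for n
  proof -
    show "0 < l n" by (simp add: l_def)
    have "l n \<le> 1" by (simp add: l_def field_simps)
    also have "1 \<le> u n" by (simp add: u_def)
    finally show "l n \<le> u n" .
  qed
  have sub: "{l n..u n} \<subseteq> {0<..}" for n using lu(1)[of n] by auto
  have int_on: "integrable lborel (\<lambda>y. indicator {l n..u n} y * h y)" if "continuous_on {0<..} h" for n and h :: "real \<Rightarrow> real"
    using borel_integrable_atLeastAtMost'[OF continuous_on_subset[OF that sub[of n]]]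
    by (simp add: set_integrable_def)
  have FTC: "(\<integral>y. indicator {l n..u n} y * f y \<partial>lborel) + (\<integral>y. indicator {l n..u n} y * g y \<partial>lborel) = G (u n) - G (l n)" for n
  proof -
    have "(\<integral>y. indicator {l n..u n} y *\<^sub>R (f y + g y) \<partial>lborel) = G (u n) - G (l n)"
    proof (rule integral_FTC_Icc)
      show "l n \<le> u n" by (rule lu)
      show "(G has_vector_derivative f x + g x) (at x within {l n..u n})" if "l n \<le> x" "x \<le> u n" for x
        using G[of x] that lu(1)[of n]
        by (auto simp: has_real_derivative_iff_has_vector_derivative intro: has_vector_derivative_at_within)
      show "continuous_on {l n..u n} (\<lambda>x. f x + g x)"
        using cont by (intro continuous_on_add) (auto intro: continuous_on_subset[OF _ sub])
    qed
    then show ?thesis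
      using int_on[OF cont(1), of n] int_on[OF cont(2), of n] by (simp add: distrib_left)
  qed
  have l0: "filterlim l (at_right 0) sequentially"
    unfolding filterlim_at using LIMSEQ_inverse_real_of_nat by (auto simp: l_def)
  have uT: "filterlim u at_top sequentially"
    unfolding u_def using filterlim_real_sequentially by (rule filterlim_compose) (rule filterlim_Suc)
  have in_eventually: "eventually (\<lambda>n. indicator {l n..u n} y = (indicator {0<..} y :: real)) sequentially" for y
  proof (cases "y > 0")
    case True
    have "eventually (\<lambda>n. l n < y) sequentially"
      using LIMSEQ_inverse_real_of_nat True by (auto simp: l_def intro: order_tendstoD)
    moreover have "eventually (\<lambda>n. u n \<ge> y) sequentially"
      using uT by (auto simp: filterlim_at_top)
    ultimately show ?thesis by eventually_elim (use True in \<open>auto simp: indicator_def\<close>)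
  next
    case False
    have "y < l n" for n using lu(1)[of n] False by linarith
    with False show ?thesis by (intro always_eventually allI) (auto simp: indicator_def not_le)
  qed
  have F: "(\<lambda>n. \<integral>y. indicator {l n..u n} y * f y \<partial>lborel) \<longlonglongrightarrow> (\<integral>y. indicator {0<..} y * f y \<partial>lborel)"
  proof (rule integral_dominated_convergence[where w = "\<lambda>y. \<bar>indicator {0<..} y * f y\<bar>"])
    show "AE y in lborel. (\<lambda>n. indicator {l n..u n} y * f y) \<longlonglongrightarrow> indicator {0<..} y * f y"
      by (rule AE_I2, rule tendsto_eventually, rule eventually_mono[OF in_eventually]) auto
    show "AE y in lborel. norm (indicator {l n..u n} y * f y) \<le> \<bar>indicator {0<..} y * f y\<bar>" for n
      using sub[of n] by (intro AE_I2) (auto simp: indicator_def)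
  qed (use f_int int_on[OF cont(1)] in \<open>auto intro: borel_measurable_integrable\<close>)
  have GG: "(\<lambda>n. G (u n) - G (l n)) \<longlonglongrightarrow> 0 - 0"
    by (intro tendsto_diff filterlim_compose[OF lim_top uT] filterlim_compose[OF lim0 l0])
  have eqg: "(\<integral>y. indicator {l n..u n} y * g y \<partial>lborel) =
      (G (u n) - G (l n)) - (\<integral>y. indicator {l n..u n} y * f y \<partial>lborel)" for n
    using FTC[of n] by linarith
  have Glim: "(\<lambda>n. \<integral>y. indicator {l n..u n} y * g y \<partial>lborel) \<longlonglongrightarrow> - (\<integral>y. indicator {0<..} y * f y \<partial>lborel)"
    unfolding eqg using tendsto_diff[OF GG F] by simp
  show ?thesis
  proof (rule has_bochner_integral_monotone_convergence[OF _ _ _ Glim])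
    show "integrable lborel (\<lambda>y. indicator {l n..u n} y * g y)" for n
      by (rule int_on[OF cont(2)])
    show "AE y in lborel. mono (\<lambda>n. indicator {l n..u n} y * g y)"
    proof (intro AE_I2 incseq_SucI)
      fix y n
      have "l (Suc n) \<le> l n" "u n \<le> u (Suc n)" by (auto simp: l_def u_def field_simps)
      then show "indicator {l n..u n} y * g y \<le> indicator {l (Suc n)..u (Suc n)} y * g y"
        using g_nn[of y] lu(1)[of "Suc n"] by (auto simp: indicator_def)
    qed
    show "AE y in lborel. (\<lambda>n. indicator {l n..u n} y * g y) \<longlonglongrightarrow> indicator {0<..} y * g y"
      by (rule AE_I2, rule tendsto_eventually, rule eventually_mono[OF in_eventually]) auto
    show "(\<lambda>y. indicator {0<..} y * g y) \<in> borel_measurable lborel"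
      using borel_measurable_continuous_on_indicator[OF _ cont(2)] by simp
  qed
qed

section \<open>Likelihood ratios\<close>

locale qgamma_channel = gamma_rate +
  fixes \<alpha> :: real
  assumes alpha_ge: "\<alpha> \<ge> 1/2"
begin

abbreviation base :: "real \<Rightarrow> real" where "base \<equiv> gamma_density \<alpha> lam"

text \<open>
  The likelihood ratio of the output at noncentrality \<open>s\<close> with respect to the output at \<open>0\<close>.
\<close>

definition lik :: "real \<Rightarrow> real \<Rightarrow> real" where
  "lik s y = Gamma \<alpha> * exp (- lam * s) * bessel_series \<alpha> (lam\<^sup>2 * s * y)"

text \<open>
  The density of raised shape \<open>\<alpha> + 1\<close>, still with respect to \<open>base\<close>. It carries both derivatives
  of \<open>lik\<close>.
\<close>

definition lik_up :: "real \<Rightarrow> real \<Rightarrow> real" where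
  "lik_up s y = Gamma \<alpha> * exp (- lam * s) * (lam * y) * bessel_series (\<alpha> + 1) (lam\<^sup>2 * s * y)"

lemma Gamma_alpha_pos: "Gamma \<alpha> > 0" "Gamma (\<alpha> + 1) = \<alpha> * Gamma \<alpha>"
  using alpha_ge by (auto intro!: Gamma_real_pos Gamma_plus1_real)

lemma base_nonneg: "base y \<ge> 0"
  using alpha_ge by (intro gamma_density_nonneg) auto

lemma base_pos: "y > 0 \<Longrightarrow> base y > 0"
  using Gamma_alpha_pos lam_pos by (simp add: gamma_density_def)

lemma base_outside: "y \<le> 0 \<Longrightarrow> base y = 0"
  by (simp add: gamma_density_def)

lemma borel_measurable_lik [measurable]:
  assumes [measurable]: "f \<in> borel_measurable N" "g \<in> borel_measurable N"
  shows "(\<lambda>x. lik (f x) (g x)) \<in> borel_measurable N" "(\<lambda>x. lik_up (f x) (g x)) \<in> borel_measurable N"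
  unfolding lik_def lik_up_def by measurable

lemma ncgamma_eq_base_lik: "ncgamma \<alpha> s y = base y * lik s y"
  using Gamma_alpha_pos lam_pos
  by (simp add: ncgamma_def lik_def gamma_density_def ring_distribs exp_add exp_diff exp_minus field_simps)

lemma ncgamma_eq_base_lik_up: "ncgamma (\<alpha> + 1) s y = base y * lik_up s y"
proof (cases "y > 0")
  case True
  have "lam powr (\<alpha> + 1) = lam powr \<alpha> * lam" "y powr \<alpha> = y powr (\<alpha> - 1) * y"
    using lam_pos True by (simp_all add: powr_add powr_diff)
  then show ?thesis
    using Gamma_alpha_pos lam_pos True
    by (simp add: ncgamma_def lik_up_def gamma_density_def ring_distribs exp_add exp_diff exp_minus field_simps)
qed (simp add: gamma_density_def)

text \<open>
  This is \<open>0 \<le> lam * (sqrt s - sqrt y)\<^sup>2\<close>. It removes the noncentrality from the bounds on the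
  likelihood ratios, so that random inputs can be averaged at a fixed output.
\<close>

lemma exp_sqrt_le:
  assumes "s \<ge> 0" "y \<ge> 0"
  shows "exp (- lam * s) * exp (2 * sqrt (lam\<^sup>2 * s * y)) \<le> exp (lam * y)"
proof -
  have "0 \<le> lam * (sqrt s - sqrt y)\<^sup>2" using lam_pos by simp
  then have "2 * (lam * sqrt s * sqrt y) \<le> lam * s + lam * y"
    using assms by (simp add: power2_diff algebra_simps)
  moreover have "sqrt (lam\<^sup>2 * s * y) = lam * sqrt s * sqrt y"
    using lam_pos by (simp add: real_sqrt_mult)
  ultimately have "- lam * s + 2 * sqrt (lam\<^sup>2 * s * y) \<le> lam * y" by simp
  then show ?thesis unfolding exp_add[symmetric] by simp
qed

lemma lik_bounds:
  assumes "s \<ge> 0" "y \<ge> 0"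
  shows "exp (- lam * s) \<le> lik s y" "lik s y \<le> exp (lam * y)" "lik s y > 0"
proof -
  have t: "lam\<^sup>2 * s * y \<ge> 0" using assms by simp
  have "1 \<le> Gamma \<alpha> * bessel_series \<alpha> (lam\<^sup>2 * s * y)"
    using bessel_series_pos(1)[OF alpha_ge t] Gamma_alpha_pos by (simp add: divide_le_eq mult.commute)
  then have "exp (- lam * s) * 1 \<le> exp (- lam * s) * (Gamma \<alpha> * bessel_series \<alpha> (lam\<^sup>2 * s * y))"
    by (intro mult_left_mono) auto
  then show 1: "exp (- lam * s) \<le> lik s y" by (simp add: lik_def mult_ac)
  have "exp (- lam * s) * (Gamma \<alpha> * bessel_series \<alpha> (lam\<^sup>2 * s * y)) \<le> exp (- lam * s) * exp (2 * sqrt (lam\<^sup>2 * s * y))"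
    by (intro mult_left_mono bessel_series_le_exp alpha_ge t) auto
  also have "\<dots> \<le> exp (lam * y)" by (rule exp_sqrt_le[OF assms])
  finally show "lik s y \<le> exp (lam * y)" by (simp add: lik_def mult_ac)
  show "lik s y > 0" using 1 exp_gt_zero[of "- lam * s"] by linarith
qed

lemma lik_up_bounds:
  assumes "s \<ge> 0" "y \<ge> 0"
  shows "lik_up s y \<ge> 0" "lik_up s y \<le> lam * y / \<alpha> * exp (lam * y)"
proof -
  have t: "lam\<^sup>2 * s * y \<ge> 0" using assms by simp
  have a: "\<alpha> > 0" "\<alpha> + 1 \<ge> 1/2" using alpha_ge by auto
  show "lik_up s y \<ge> 0"
    using Gamma_alpha_pos lam_pos assms bessel_series_pos(2)[OF a(2) t] by (simp add: lik_up_def)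
  have "exp (- lam * s) * (Gamma (\<alpha> + 1) * bessel_series (\<alpha> + 1) (lam\<^sup>2 * s * y)) \<le> exp (- lam * s) * exp (2 * sqrt (lam\<^sup>2 * s * y))"
    by (intro mult_left_mono bessel_series_le_exp a t) auto
  also have "\<dots> \<le> exp (lam * y)" by (rule exp_sqrt_le[OF assms])
  finally have "lam * y / \<alpha> * (exp (- lam * s) * (Gamma (\<alpha> + 1) * bessel_series (\<alpha> + 1) (lam\<^sup>2 * s * y))) \<le> lam * y / \<alpha> * exp (lam * y)"
    using lam_pos a assms by (intro mult_left_mono) auto
  then show "lik_up s y \<le> lam * y / \<alpha> * exp (lam * y)"
    using a by (simp add: lik_up_def Gamma_alpha_pos mult_ac)
qed

lemma DERIV_lik_noncentrality: "((\<lambda>s. lik s y) has_real_derivative lam * (lik_up s y - lik s y)) (at s)"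
  unfolding lik_def
  by (rule derivative_eq_intros DERIV_chain2[OF DERIV_bessel_series] alpha_ge refl)+
     (simp add: lik_up_def lik_def power2_eq_square algebra_simps)

lemma DERIV_lik_output:
  assumes "y > 0"
  shows "((\<lambda>y. lik s y) has_real_derivative lam * s / y * lik_up s y) (at y)"
  unfolding lik_def
  by (rule derivative_eq_intros DERIV_chain2[OF DERIV_bessel_series] alpha_ge refl)+
     (use assms in \<open>simp add: lik_up_def power2_eq_square field_simps\<close>)

lemma continuous_lik:
  "continuous_on A (\<lambda>s. lik_up s y)" "continuous_on A (\<lambda>y. lik_up s y)"
  "continuous_on A (\<lambda>s. lik s y)" "continuous_on A (\<lambda>y. lik s y)"
proof -
  have c: "continuous_on UNIV (bessel_series (\<alpha> + 1))" "continuous_on UNIV (bessel_series \<alpha>)"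
    using alpha_ge by (auto intro!: continuous_bessel_series)
  show "continuous_on A (\<lambda>s. lik_up s y)" "continuous_on A (\<lambda>y. lik_up s y)"
    "continuous_on A (\<lambda>s. lik s y)" "continuous_on A (\<lambda>y. lik s y)"
    unfolding lik_up_def lik_def
    by (intro continuous_intros continuous_on_compose2[OF c(1)] continuous_on_compose2[OF c(2)]; simp)+
qed

end

locale random_input = qgamma_channel lam \<alpha> + prob_space M
  for lam \<alpha> :: real and M :: "'a measure" +
  fixes X :: "'a \<Rightarrow> real"
  assumes X_measurable [measurable]: "X \<in> borel_measurable M"
    and X_nonneg: "AE w in M. X w \<ge> 0"
    and X_sq_integrable: "integrable M (\<lambda>w. (X w)\<^sup>2)"
begin

lemma X_integrable: "integrable M X"
proof (rule Bochner_Integration.integrable_bound)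
  show "integrable M (\<lambda>w. 1 + (X w)\<^sup>2)" using X_sq_integrable by simp
  have "\<bar>x\<bar> \<le> 1 + x\<^sup>2" for x :: real
  proof -
    have "0 \<le> (\<bar>x\<bar> - 1)\<^sup>2" by simp
    then have "2 * \<bar>x\<bar> \<le> 1 + x\<^sup>2" by (simp add: power2_diff)
    then show ?thesis by linarith
  qed
  then show "AE w in M. norm (X w) \<le> norm (1 + (X w)\<^sup>2)" by simp
qed measurable

text \<open>
  The density of the output at the random input, with respect to \<open>base\<close>. The functions \<open>ell_up\<close> and
  \<open>ell_X\<close> are the two terms of its derivative in \<open>r\<close>.
\<close>

definition ell :: "real \<Rightarrow> real \<Rightarrow> real" where
  "ell r y = (\<integral>w. lik (r * X w) y \<partial>M)"

definition ell_up :: "real \<Rightarrow> real \<Rightarrow> real" where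
  "ell_up r y = (\<integral>w. X w * lik_up (r * X w) y \<partial>M)"

definition ell_X :: "real \<Rightarrow> real \<Rightarrow> real" where
  "ell_X r y = (\<integral>w. X w * lik (r * X w) y \<partial>M)"

lemma borel_measurable_ell [measurable]:
  assumes [measurable]: "f \<in> borel_measurable N" "g \<in> borel_measurable N"
  shows "(\<lambda>x. ell (f x) (g x)) \<in> borel_measurable N" "(\<lambda>x. ell_up (f x) (g x)) \<in> borel_measurable N"
    "(\<lambda>x. ell_X (f x) (g x)) \<in> borel_measurable N"
  unfolding ell_def ell_up_def ell_X_def by measurable

lemma integrable_lik_input:
  assumes "r \<ge> 0" "y \<ge> 0"
  shows "integrable M (\<lambda>w. lik (r * X w) y)"
proof (rule integrable_const_bound[where B = "exp (lam * y)"])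
  show "AE w in M. norm (lik (r * X w) y) \<le> exp (lam * y)"
    using X_nonneg
  proof eventually_elim
    case (elim w)
    then have "r * X w \<ge> 0" using assms by simp
    from lik_bounds[OF this assms(2)] show ?case by simp
  qed
qed measurable

lemma lik_up_input_bound:
  assumes "r \<ge> 0" "y \<ge> 0" "X w \<ge> 0"
  shows "\<bar>X w * lik_up (r * X w) y\<bar> \<le> X w * (lam * y / \<alpha> * exp (lam * y))"
    "\<bar>X w * lik (r * X w) y\<bar> \<le> X w * exp (lam * y)"
proof -
  have s: "r * X w \<ge> 0" using assms by simp
  show "\<bar>X w * lik_up (r * X w) y\<bar> \<le> X w * (lam * y / \<alpha> * exp (lam * y))"
    using lik_up_bounds[OF s assms(2)] assms(3) by (simp only: abs_mult) (intro mult_mono, auto)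
  show "\<bar>X w * lik (r * X w) y\<bar> \<le> X w * exp (lam * y)"
    using lik_bounds[OF s assms(2)] assms(3) by (simp only: abs_mult) (intro mult_mono, auto)
qed

lemma integrable_X_lik_input:
  assumes "r \<ge> 0" "y \<ge> 0"
  shows "integrable M (\<lambda>w. X w * lik_up (r * X w) y)" "integrable M (\<lambda>w. X w * lik (r * X w) y)"
proof -
  show "integrable M (\<lambda>w. X w * lik_up (r * X w) y)"
    by (rule Bochner_Integration.integrable_bound[OF integrable_mult_left[OF X_integrable, of "lam * y / \<alpha> * exp (lam * y)"]])
       (simp, use X_nonneg in eventually_elim, unfold real_norm_def,
        rule order_trans[OF lik_up_input_bound(1)[OF assms] abs_ge_self])
  show "integrable M (\<lambda>w. X w * lik (r * X w) y)"
    by (rule Bochner_Integration.integrable_bound[OF integrable_mult_left[OF X_integrable, of "exp (lam * y)"]])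
       (simp, use X_nonneg in eventually_elim, unfold real_norm_def,
        rule order_trans[OF lik_up_input_bound(2)[OF assms] abs_ge_self])
qed

lemma ell_up_nonneg:
  assumes "r \<ge> 0" "y \<ge> 0"
  shows "ell_up r y \<ge> 0" "ell_X r y \<ge> 0"
proof -
  have "AE w in M. 0 \<le> X w * lik_up (r * X w) y \<and> 0 \<le> X w * lik (r * X w) y"
    using X_nonneg
  proof eventually_elim
    case (elim w)
    then have "r * X w \<ge> 0" using assms by simp
    then show ?case
      using lik_up_bounds(1) less_imp_le[OF lik_bounds(3)] elim assms by simp
  qed
  then show "ell_up r y \<ge> 0" "ell_X r y \<ge> 0"
    unfolding ell_up_def ell_X_def by (auto intro!: integral_nonneg_AE)
qed

text \<open>
  The number \<open>exp (- log_floor R)\<close> bounds \<open>ell r y\<close> from below for all rates in \<open>{0..R}\<close> and all outputs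
  \<open>y \<ge> 0\<close>, because \<open>lik s y\<close> is at least \<open>exp (- lam * s)\<close>.
\<close>

definition log_floor :: "real \<Rightarrow> real" where
  "log_floor R = - ln (\<integral>w. exp (- lam * (R * X w)) \<partial>M)"

text \<open>
  The bounds on \<open>lik\<close> average to a constant lower and an exponential upper bound. What matters below is
  that \<open>ln (ell r y)\<close> grows at most linearly in \<open>y\<close>.
\<close>

lemma ell_bounds:
  assumes "0 \<le> r" "r \<le> R" "y \<ge> 0"
  shows "exp (- log_floor R) \<le> ell r y" "ell r y \<le> exp (lam * y)" "ell r y > 0"
    "\<bar>ln (ell r y)\<bar> \<le> log_floor R + lam * y" "log_floor R \<ge> 0"
proof -
  have R: "R \<ge> 0" using assms by simp
  have e_le: "AE w in M. exp (- lam * (R * X w)) \<le> 1"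
    using X_nonneg by eventually_elim (use R lam_pos in simp)
  have e_int: "integrable M (\<lambda>w. exp (- lam * (R * X w)))"
    by (rule integrable_const_bound[where B = 1]) (use e_le in auto)
  define e where "e = (\<integral>w. exp (- lam * (R * X w)) \<partial>M)"
  have "e > 0"
    unfolding e_def using integral_less_AE_space[of "\<lambda>_. 0" "\<lambda>w. exp (- lam * (R * X w))"] e_int
    by (simp add: emeasure_space_1)
  have "e \<le> (\<integral>w. 1 \<partial>M)" unfolding e_def by (rule integral_mono_AE) (use e_int e_le in auto)
  then have "e \<le> 1" by (simp add: prob_space)
  have ex: "exp (- log_floor R) = e" using \<open>e > 0\<close> by (simp add: log_floor_def e_def)
  show log_floor: "log_floor R \<ge> 0" using \<open>e > 0\<close> \<open>e \<le> 1\<close> unfolding log_floor_def e_def[symmetric] by simp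
  show 1: "exp (- log_floor R) \<le> ell r y"
    unfolding ex unfolding e_def ell_def
  proof (rule integral_mono_AE[OF e_int integrable_lik_input[OF assms(1,3)]])
    show "AE w in M. exp (- lam * (R * X w)) \<le> lik (r * X w) y"
      using X_nonneg
    proof eventually_elim
      case (elim w)
      then have "lam * (r * X w) \<le> lam * (R * X w)"
        using assms lam_pos by (intro mult_left_mono mult_right_mono) auto
      then have "exp (- lam * (R * X w)) \<le> exp (- lam * (r * X w))" by simp
      also have "\<dots> \<le> lik (r * X w) y"
        using elim assms by (intro lik_bounds) auto
      finally show ?case .
    qed
  qed
  have "ell r y \<le> (\<integral>w. exp (lam * y) \<partial>M)"
    unfolding ell_def
    by (rule integral_mono_AE[OF integrable_lik_input[OF assms(1,3)]])
       (use X_nonneg assms in \<open>auto elim!: eventually_mono intro!: lik_bounds\<close>)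
  then show 2: "ell r y \<le> exp (lam * y)" by (simp add: prob_space)
  show pos: "ell r y > 0" using 1 exp_gt_zero[of "- log_floor R"] by linarith
  have "- log_floor R \<le> ln (ell r y)" using 1 pos by (simp add: ln_ge_iff)
  moreover have "ln (ell r y) \<le> lam * y" using 2 pos by (metis exp_gt_zero ln_exp ln_le_cancel_iff)
  moreover have "lam * y \<ge> 0" using lam_pos assms by simp
  ultimately show "\<bar>ln (ell r y)\<bar> \<le> log_floor R + lam * y" using log_floor by linarith
qed

lemma DERIV_ell_rate:
  assumes "r > 0" "y \<ge> 0"
  shows "((\<lambda>r. ell r y) has_real_derivative lam * (ell_up r y - ell_X r y)) (at r)"
proof -
  have "((\<lambda>r. \<integral>w. lik (r * X w) y \<partial>M) has_real_derivative
      (\<integral>w. lam * (X w * lik_up (r * X w) y - X w * lik (r * X w) y) \<partial>M)) (at r)"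
  proof (rule has_real_derivative_integral[where S = "{0<..}" and
        f' = "\<lambda>r w. lam * (X w * lik_up (r * X w) y - X w * lik (r * X w) y)" and
        w = "\<lambda>w. X w * (lam * (lam * y / \<alpha> * exp (lam * y) + exp (lam * y)))"])
    show "AE w in M. \<forall>t\<in>{0<..}. ((\<lambda>t. lik (t * X w) y) has_real_derivative
        lam * (X w * lik_up (t * X w) y - X w * lik (t * X w) y)) (at t)"
    proof (intro AE_I2 ballI)
      fix w and t :: real
      have "((\<lambda>t. lik (t * X w) y) has_real_derivative
          lam * (lik_up (t * X w) y - lik (t * X w) y) * X w) (at t)"
        by (rule DERIV_chain2[OF DERIV_lik_noncentrality]) (auto intro!: derivative_eq_intros)
      then show "((\<lambda>t. lik (t * X w) y) has_real_derivative
          lam * (X w * lik_up (t * X w) y - X w * lik (t * X w) y)) (at t)"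
        by (rule DERIV_cong) (simp add: algebra_simps)
    qed
    show "AE w in M. \<forall>t\<in>{0<..}. \<bar>lam * (X w * lik_up (t * X w) y - X w * lik (t * X w) y)\<bar> \<le>
        X w * (lam * (lam * y / \<alpha> * exp (lam * y) + exp (lam * y)))"
      using X_nonneg
    proof (eventually_elim, intro ballI)
      fix w and t :: real assume "X w \<ge> 0" "t \<in> {0<..}"
      then have "\<bar>X w * lik_up (t * X w) y - X w * lik (t * X w) y\<bar> \<le>
          X w * (lam * y / \<alpha> * exp (lam * y)) + X w * exp (lam * y)"
        using lik_up_input_bound[of t y w] assms by (auto intro!: order_trans[OF abs_triangle_ineq4] add_mono)
      then have "lam * \<bar>X w * lik_up (t * X w) y - X w * lik (t * X w) y\<bar> \<le>
          lam * (X w * (lam * y / \<alpha> * exp (lam * y)) + X w * exp (lam * y))"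
        using lam_pos by (intro mult_left_mono) auto
      then show "\<bar>lam * (X w * lik_up (t * X w) y - X w * lik (t * X w) y)\<bar> \<le>
        X w * (lam * (lam * y / \<alpha> * exp (lam * y) + exp (lam * y)))"
        by (simp only: abs_mult[of lam] abs_of_pos[OF lam_pos]) (simp add: algebra_simps)
    qed
  qed (use assms X_integrable in \<open>auto intro!: integrable_lik_input\<close>)
  then show ?thesis
    using integrable_X_lik_input[of r y] assms by (simp add: ell_def ell_up_def ell_X_def)
qed

lemma DERIV_ell_output:
  assumes "r \<ge> 0" "y > 0"
  shows "((\<lambda>y. ell r y) has_real_derivative lam * r / y * ell_up r y) (at y)"
proof -
  have "((\<lambda>y. \<integral>w. lik (r * X w) y \<partial>M) has_real_derivative
      (\<integral>w. lam * r / y * (X w * lik_up (r * X w) y) \<partial>M)) (at y)"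
  proof (rule has_real_derivative_integral[where S = "{0<..<y + 1}" and
        f' = "\<lambda>y w. lam * r / y * (X w * lik_up (r * X w) y)" and
        w = "\<lambda>w. X w * (lam * r * (lam / \<alpha> * exp (lam * (y + 1))))"])
    show "AE w in M. \<forall>t\<in>{0<..<y + 1}. ((\<lambda>y. lik (r * X w) y) has_real_derivative
        lam * r / t * (X w * lik_up (r * X w) t)) (at t)"
      by (intro AE_I2 ballI DERIV_cong[OF DERIV_lik_output]) auto
    show "AE w in M. \<forall>t\<in>{0<..<y + 1}. \<bar>lam * r / t * (X w * lik_up (r * X w) t)\<bar> \<le>
        X w * (lam * r * (lam / \<alpha> * exp (lam * (y + 1))))"
      using X_nonneg
    proof (eventually_elim, intro ballI)
      fix w and t :: real assume X: "X w \<ge> 0" and t: "t \<in> {0<..<y + 1}"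
      have "lam * r / t * \<bar>X w * lik_up (r * X w) t\<bar> \<le> lam * r / t * (X w * (lam * t / \<alpha> * exp (lam * t)))"
        using lam_pos assms t X by (intro mult_left_mono lik_up_input_bound) auto
      also have "\<dots> = X w * (lam * r * (lam / \<alpha> * exp (lam * t)))"
        using t by simp
      also have "\<dots> \<le> X w * (lam * r * (lam / \<alpha> * exp (lam * (y + 1))))"
        using lam_pos assms t X alpha_ge by (intro mult_left_mono) auto
      finally show "\<bar>lam * r / t * (X w * lik_up (r * X w) t)\<bar> \<le>
          X w * (lam * r * (lam / \<alpha> * exp (lam * (y + 1))))"
        using lam_pos assms t by (simp add: abs_mult)
    qed
  qed (use assms X_integrable in \<open>auto intro!: integrable_lik_input\<close>)
  then show ?thesis by (simp add: ell_def ell_up_def)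
qed

lemma continuous_ell_rate:
  assumes "y \<ge> 0"
  shows "continuous_on {0<..} (\<lambda>r. ell r y)" "continuous_on {0<..} (\<lambda>r. ell_up r y)"
    "continuous_on {0<..} (\<lambda>r. ell_X r y)"
proof -
  show "continuous_on {0<..} (\<lambda>r. ell r y)"
    using DERIV_ell_rate[OF _ assms] by (intro DERIV_continuous_on) (auto intro: has_field_derivative_at_within)
  show "continuous_on {0<..} (\<lambda>r. ell_up r y)"
    unfolding ell_up_def
  proof (rule continuous_on_integral_dominated[where w = "\<lambda>w. X w * (lam * y / \<alpha> * exp (lam * y))"])
    show "AE w in M. \<forall>t\<in>{0<..}. \<bar>X w * lik_up (t * X w) y\<bar> \<le> X w * (lam * y / \<alpha> * exp (lam * y))"
      using X_nonneg
    proof (eventually_elim, intro ballI)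
      fix w and t :: real assume "X w \<ge> 0" "t \<in> {0<..}"
      then show "\<bar>X w * lik_up (t * X w) y\<bar> \<le> X w * (lam * y / \<alpha> * exp (lam * y))"
        by (intro lik_up_input_bound assms) auto
    qed
  qed (use X_integrable in \<open>auto intro!: AE_I2 continuous_intros continuous_on_compose2[OF continuous_lik(1)[of UNIV]]\<close>)
  show "continuous_on {0<..} (\<lambda>r. ell_X r y)"
    unfolding ell_X_def
  proof (rule continuous_on_integral_dominated[where w = "\<lambda>w. X w * exp (lam * y)"])
    show "AE w in M. \<forall>t\<in>{0<..}. \<bar>X w * lik (t * X w) y\<bar> \<le> X w * exp (lam * y)"
      using X_nonneg by eventually_elim (use assms in \<open>auto intro!: lik_up_input_bound\<close>)
  qed (use X_integrable in \<open>auto intro!: AE_I2 continuous_intros continuous_on_compose2[OF continuous_lik(3)[of UNIV]]\<close>)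
qed

lemma continuous_ell_up_output:
  assumes "r \<ge> 0"
  shows "continuous_on {0<..} (\<lambda>y. ell_up r y)"
proof -
  have "continuous_on {0<..<b} (\<lambda>y. ell_up r y)" for b
    unfolding ell_up_def
  proof (rule continuous_on_integral_dominated[where w = "\<lambda>w. X w * (lam * b / \<alpha> * exp (lam * b))"])
    show "AE w in M. \<forall>t\<in>{0<..<b}. \<bar>X w * lik_up (r * X w) t\<bar> \<le> X w * (lam * b / \<alpha> * exp (lam * b))"
      using X_nonneg
    proof (eventually_elim, intro ballI)
      fix w and t :: real assume X: "X w \<ge> 0" and t: "t \<in> {0<..<b}"
      have "\<bar>X w * lik_up (r * X w) t\<bar> \<le> X w * (lam * t / \<alpha> * exp (lam * t))"
        using X t assms by (intro lik_up_input_bound) auto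
      also have "\<dots> \<le> X w * (lam * b / \<alpha> * exp (lam * b))"
        using X t alpha_ge lam_pos by (intro mult_mono divide_right_mono mult_left_mono) auto
      finally show "\<bar>X w * lik_up (r * X w) t\<bar> \<le> X w * (lam * b / \<alpha> * exp (lam * b))" .
    qed
  qed (use X_integrable in \<open>auto intro!: AE_I2 continuous_intros continuous_lik\<close>)
  then have "isCont (\<lambda>y. ell_up r y) y" if "y > 0" for y
    using that by (meson continuous_on_eq_continuous_at greaterThanLessThan_iff less_add_one open_greaterThanLessThan)
  then show ?thesis by (simp add: continuous_at_imp_continuous_on)
qed

end

section \<open>Relative entropy of the output\<close>

context gamma_rate begin

text \<open>
  Test functions of at most linear growth need only the mass and the mean of the density.
\<close>

lemma linear_growth_integral:
  assumes a: "a \<ge> 1/2" and s: "s \<ge> 0" and [measurable]: "\<phi> \<in> borel_measurable borel"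
    and A: "A \<ge> 0" "B \<ge> 0" and \<phi>: "\<And>y. y > 0 \<Longrightarrow> \<bar>\<phi> y\<bar> \<le> A + B * y"
  shows "integrable lborel (\<lambda>y. ncgamma a s y * \<phi> y)"
    "(\<integral>y. \<bar>ncgamma a s y * \<phi> y\<bar> \<partial>lborel) \<le> A + B * (a / lam + s)"
proof -
  have int: "integrable lborel (\<lambda>y. A * ncgamma a s y + B * (y * ncgamma a s y))"
    using integrable_ncgamma[OF a s] integrable_ncgamma_mean[OF a s] by auto
  have le: "\<bar>ncgamma a s y * \<phi> y\<bar> \<le> A * ncgamma a s y + B * (y * ncgamma a s y)" for y
  proof (cases "y > 0")
    case True
    have "\<bar>ncgamma a s y * \<phi> y\<bar> \<le> ncgamma a s y * (A + B * y)"
      using \<phi>[OF True] ncgamma_nonneg[OF a s, of y] by (simp add: abs_mult mult_left_mono)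
    then show ?thesis by (simp add: algebra_simps)
  qed simp
  show 1: "integrable lborel (\<lambda>y. ncgamma a s y * \<phi> y)"
    by (rule Bochner_Integration.integrable_bound[OF int])
       (use order_trans[OF le abs_ge_self] in simp_all)
  have "(\<integral>y. \<bar>ncgamma a s y * \<phi> y\<bar> \<partial>lborel) \<le> (\<integral>y. A * ncgamma a s y + B * (y * ncgamma a s y) \<partial>lborel)"
    using 1 int le by (intro integral_mono) auto
  also have "\<dots> = A + B * (a / lam + s)"
    using integrable_ncgamma[OF a s] integrable_ncgamma_mean[OF a s] by simp
  finally show "(\<integral>y. \<bar>ncgamma a s y * \<phi> y\<bar> \<partial>lborel) \<le> A + B * (a / lam + s)" .
qed

end

context random_input begin

lemma integrable_weighted_output:
  assumes a: "a \<ge> 1/2" and r: "r \<ge> 0" and [measurable]: "\<phi> \<in> borel_measurable borel"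
    and A: "A \<ge> 0" "B \<ge> 0" and \<phi>: "\<And>y. y > 0 \<Longrightarrow> \<bar>\<phi> y\<bar> \<le> A + B * y"
    and Z: "integrable M Z" "integrable M (\<lambda>w. Z w * X w)"
  shows "integrable (M \<Otimes>\<^sub>M lborel) (\<lambda>(w, y). Z w * (ncgamma a (r * X w) y * \<phi> y))"
proof -
  interpret P: pair_sigma_finite M lborel ..
  have [measurable]: "Z \<in> borel_measurable M" using Z by simp
  have lg: "AE w in M. integrable lborel (\<lambda>y. ncgamma a (r * X w) y * \<phi> y) \<and>
      (\<integral>y. \<bar>ncgamma a (r * X w) y * \<phi> y\<bar> \<partial>lborel) \<le> A + B * (a / lam + r * X w)"
    using X_nonneg
  proof eventually_elim
    case (elim w)
    then have "r * X w \<ge> 0" using r by simp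
    from linear_growth_integral[OF a this _ A \<phi>] show ?case by simp
  qed
  let ?J = "\<lambda>w. \<integral>y. norm (case (w, y) of (w, y) \<Rightarrow> Z w * (ncgamma a (r * X w) y * \<phi> y)) \<partial>lborel"
  show ?thesis
  proof (rule P.Fubini_integrable)
    show "(\<lambda>(w, y). Z w * (ncgamma a (r * X w) y * \<phi> y)) \<in> borel_measurable (M \<Otimes>\<^sub>M lborel)"
      by measurable
    show "AE w in M. integrable lborel (\<lambda>y. case (w, y) of (w, y) \<Rightarrow> Z w * (ncgamma a (r * X w) y * \<phi> y))"
      using lg by eventually_elim simp
    have "integrable M (\<lambda>w. \<bar>Z w\<bar> * (A + B * a / lam) + B * r * \<bar>Z w * X w\<bar>)"
      using Z by auto
    then show "integrable M (\<lambda>w. \<integral>y. norm (case (w, y) of (w, y) \<Rightarrow> Z w * (ncgamma a (r * X w) y * \<phi> y)) \<partial>lborel)"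
    proof (rule Bochner_Integration.integrable_bound)
      show "AE w in M. norm (?J w)
          \<le> norm (\<bar>Z w\<bar> * (A + B * a / lam) + B * r * \<bar>Z w * X w\<bar>)"
        using lg X_nonneg
      proof eventually_elim
        case (elim w)
        have "(?J w)
            = \<bar>Z w\<bar> * (\<integral>y. \<bar>ncgamma a (r * X w) y * \<phi> y\<bar> \<partial>lborel)"
          by (simp add: abs_mult)
        also have "\<dots> \<le> \<bar>Z w\<bar> * (A + B * (a / lam + r * X w))"
          using elim by (intro mult_left_mono) auto
        also have "\<dots> = \<bar>Z w\<bar> * (A + B * a / lam) + B * r * \<bar>Z w * X w\<bar>"
          using elim by (simp add: abs_mult algebra_simps)
        finally have "(?J w)
            \<le> \<bar>Z w\<bar> * (A + B * a / lam) + B * r * \<bar>Z w * X w\<bar>" .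
        moreover have "0 \<le> (?J w)"
          by (rule Bochner_Integration.integral_nonneg) simp
        ultimately show ?case by (simp only: real_norm_def)
      qed
    qed measurable
  qed
qed

text \<open>
  Fubini's theorem between the input and the output, for weights such as \<open>1\<close> and \<open>X\<close>.
\<close>

lemma weighted_output_swap:
  assumes a: "a \<ge> 1/2" and r: "r \<ge> 0" and [measurable]: "\<phi> \<in> borel_measurable borel"
    and A: "A \<ge> 0" "B \<ge> 0" and \<phi>: "\<And>y. y > 0 \<Longrightarrow> \<bar>\<phi> y\<bar> \<le> A + B * y"
    and Z: "integrable M Z" "integrable M (\<lambda>w. Z w * X w)"
  shows "integrable lborel (\<lambda>y. (\<integral>w. Z w * ncgamma a (r * X w) y \<partial>M) * \<phi> y)"
    "integrable M (\<lambda>w. Z w * (\<integral>y. ncgamma a (r * X w) y * \<phi> y \<partial>lborel))"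
    "(\<integral>y. (\<integral>w. Z w * ncgamma a (r * X w) y \<partial>M) * \<phi> y \<partial>lborel) =
      (\<integral>w. Z w * (\<integral>y. ncgamma a (r * X w) y * \<phi> y \<partial>lborel) \<partial>M)"
proof -
  interpret P: pair_sigma_finite M lborel ..
  note int = integrable_weighted_output[OF assms]
  have eq: "(\<integral>w. Z w * (ncgamma a (r * X w) y * \<phi> y) \<partial>M) = (\<integral>w. Z w * ncgamma a (r * X w) y \<partial>M) * \<phi> y" for y
    by (simp only: mult.assoc[symmetric] integral_mult_left_zero)
  show "integrable lborel (\<lambda>y. (\<integral>w. Z w * ncgamma a (r * X w) y \<partial>M) * \<phi> y)"
    using P.integrable_snd[OF int] unfolding eq .
  show "integrable M (\<lambda>w. Z w * (\<integral>y. ncgamma a (r * X w) y * \<phi> y \<partial>lborel))"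
    using P.integrable_fst[OF int] by simp
  show "(\<integral>y. (\<integral>w. Z w * ncgamma a (r * X w) y \<partial>M) * \<phi> y \<partial>lborel) =
      (\<integral>w. Z w * (\<integral>y. ncgamma a (r * X w) y * \<phi> y \<partial>lborel) \<partial>M)"
    using P.Fubini_integral[OF int] unfolding eq by simp
qed

lemma averaged_densities:
  shows "(\<integral>w. ncgamma \<alpha> (r * X w) y \<partial>M) = base y * ell r y"
    "(\<integral>w. X w * ncgamma \<alpha> (r * X w) y \<partial>M) = base y * ell_X r y"
    "(\<integral>w. X w * ncgamma (\<alpha> + 1) (r * X w) y \<partial>M) = base y * ell_up r y"
  unfolding ncgamma_eq_base_lik ncgamma_eq_base_lik_up ell_def ell_X_def ell_up_def
  by (simp_all only: mult.left_commute[of "X _"] integral_mult_right_zero)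

text \<open>
  The relative entropy of the output law with respect to the output law at input \<open>0\<close>.
\<close>

definition rel_entropy :: "real \<Rightarrow> real" where
  "rel_entropy r = (\<integral>y. base y * (ell r y * ln (ell r y)) \<partial>lborel)"

text \<open>
  The derivative in \<open>r\<close> of the integrand of \<open>rel_entropy\<close>.
\<close>

definition entropy_flux :: "real \<Rightarrow> real \<Rightarrow> real" where
  "entropy_flux r y = base y * (lam * (ell_up r y - ell_X r y) * (1 + ln (ell r y)))"

lemma borel_measurable_entropy_flux [measurable]:
  assumes [measurable]: "f \<in> borel_measurable N" "g \<in> borel_measurable N"
  shows "(\<lambda>x. entropy_flux (f x) (g x)) \<in> borel_measurable N"
  unfolding entropy_flux_def by measurable

lemma integrable_rel_entropy:
  assumes "r \<ge> 0"
  shows "integrable lborel (\<lambda>y. base y * (ell r y * ln (ell r y)))"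
proof -
  have "integrable lborel (\<lambda>y. (\<integral>w. 1 * ncgamma \<alpha> (r * X w) y \<partial>M) * ln (ell r y))"
    by (rule weighted_output_swap(1)[where A = "log_floor r" and B = lam])
       (use assms ell_bounds[of r r] lam_pos X_integrable alpha_ge in auto)
  then show ?thesis by (simp add: averaged_densities mult.assoc)
qed

text \<open>
  A bound for the flux at all rates up to \<open>R\<close>. It still depends on \<open>r\<close>, but continuously, and its
  integral is an affine function of \<open>r\<close> with coefficients given by moments of \<open>X\<close>.
\<close>

definition flux_bound :: "real \<Rightarrow> real \<Rightarrow> real \<Rightarrow> real" where
  "flux_bound R r y = base y * (lam * (ell_up r y + ell_X r y) * (1 + log_floor R + lam * y))"

lemma entropy_flux_le:
  assumes "0 \<le> r" "r \<le> R"
  shows "\<bar>entropy_flux r y\<bar> \<le> flux_bound R r y"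
proof (cases "y > 0")
  case True
  then have y: "y \<ge> 0" by simp
  have 1: "\<bar>1 + ln (ell r y)\<bar> \<le> 1 + log_floor R + lam * y"
    using ell_bounds(4)[OF assms y] by linarith
  have "\<bar>ell_up r y - ell_X r y\<bar> \<le> ell_up r y + ell_X r y"
    using ell_up_nonneg[OF assms(1) y] by linarith
  then have "lam * \<bar>ell_up r y - ell_X r y\<bar> * \<bar>1 + ln (ell r y)\<bar> \<le>
      lam * (ell_up r y + ell_X r y) * (1 + log_floor R + lam * y)"
    using 1 ell_up_nonneg[OF assms(1) y] lam_pos by (intro mult_mono) auto
  then have "base y * (lam * \<bar>ell_up r y - ell_X r y\<bar> * \<bar>1 + ln (ell r y)\<bar>) \<le> flux_bound R r y"
    unfolding flux_bound_def by (intro mult_left_mono base_nonneg)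
  then show ?thesis
    using lam_pos base_nonneg[of y] by (simp add: entropy_flux_def abs_mult)
qed (simp add: entropy_flux_def flux_bound_def base_outside)

lemma flux_bound_integral:
  assumes "0 \<le> r" "R \<ge> 0"
  shows "integrable lborel (flux_bound R r)"
    "integral\<^sup>L lborel (flux_bound R r) =
      lam * ((2 * (1 + log_floor R) + (2 * \<alpha> + 1)) * expectation X + 2 * lam * r * expectation (\<lambda>w. (X w)\<^sup>2))"
proof -
  define \<phi> where "\<phi> = (\<lambda>y. 1 + log_floor R + lam * y)"
  have [measurable]: "\<phi> \<in> borel_measurable borel" unfolding \<phi>_def by measurable
  have log_floor: "log_floor R \<ge> 0" using ell_bounds(5)[of 0 R 0] assms by simp
  have b: "y > 0 \<Longrightarrow> \<bar>\<phi> y\<bar> \<le> (1 + log_floor R) + lam * y" for y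
    using log_floor lam_pos by (simp add: \<phi>_def)
  have sq: "integrable M (\<lambda>w. X w * X w)"
    using X_sq_integrable by (simp add: power2_eq_square)
  have a: "\<alpha> + 1 \<ge> 1/2" using alpha_ge by simp
  have A: "1 + log_floor R \<ge> 0" "lam \<ge> 0" using log_floor lam_pos by auto
  note up = weighted_output_swap[OF a assms(1) _ A b X_integrable sq, simplified]
  note X = weighted_output_swap[OF alpha_ge assms(1) _ A b X_integrable sq, simplified]
  have eq: "flux_bound R r = (\<lambda>y. lam * ((\<integral>w. X w * ncgamma (\<alpha> + 1) (r * X w) y \<partial>M) * \<phi> y +
      (\<integral>w. X w * ncgamma \<alpha> (r * X w) y \<partial>M) * \<phi> y))"
    unfolding averaged_densities by (auto simp: flux_bound_def \<phi>_def fun_eq_iff algebra_simps)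
  show "integrable lborel (flux_bound R r)"
    unfolding eq using up(1) X(1) by auto
  have inner: "(\<integral>y. ncgamma c s y * \<phi> y \<partial>lborel) = 1 + log_floor R + lam * (c / lam + s)" if "c \<ge> 1/2" "s \<ge> 0" for c s
    unfolding \<phi>_def using integrable_ncgamma[OF that] integrable_ncgamma_mean[OF that]
    by (simp add: distrib_left mult.left_commute[of _ lam] mult.commute[of "ncgamma _ _ _"])
  have "integral\<^sup>L lborel (flux_bound R r) =
      lam * (\<integral>w. X w * (\<integral>y. ncgamma (\<alpha> + 1) (r * X w) y * \<phi> y \<partial>lborel) +
        X w * (\<integral>y. ncgamma \<alpha> (r * X w) y * \<phi> y \<partial>lborel) \<partial>M)"
    unfolding eq using up X by simp
  also have "(\<integral>w. X w * (\<integral>y. ncgamma (\<alpha> + 1) (r * X w) y * \<phi> y \<partial>lborel) +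
        X w * (\<integral>y. ncgamma \<alpha> (r * X w) y * \<phi> y \<partial>lborel) \<partial>M) =
      (\<integral>w. X w * (2 * (1 + log_floor R) + (2 * \<alpha> + 1)) + 2 * lam * r * (X w)\<^sup>2 \<partial>M)"
  proof (rule integral_cong_AE)
    show "AE w in M. X w * (\<integral>y. ncgamma (\<alpha> + 1) (r * X w) y * \<phi> y \<partial>lborel) +
        X w * (\<integral>y. ncgamma \<alpha> (r * X w) y * \<phi> y \<partial>lborel) =
        X w * (2 * (1 + log_floor R) + (2 * \<alpha> + 1)) + 2 * lam * r * (X w)\<^sup>2"
      using X_nonneg
    proof eventually_elim
      case (elim w)
      then have "r * X w \<ge> 0" using assms by simp
      show ?case
        unfolding inner[OF a \<open>r * X w \<ge> 0\<close>] inner[OF alpha_ge \<open>r * X w \<ge> 0\<close>]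
        using lam_pos by (simp add: field_simps power2_eq_square)
    qed
  qed measurable
  finally show "integral\<^sup>L lborel (flux_bound R r) =
      lam * ((2 * (1 + log_floor R) + (2 * \<alpha> + 1)) * expectation X + 2 * lam * r * expectation (\<lambda>w. (X w)\<^sup>2))"
    using X_integrable X_sq_integrable by simp
qed

lemma borel_measurable_flux_bound [measurable]:
  assumes [measurable]: "f \<in> borel_measurable N" "g \<in> borel_measurable N"
  shows "(\<lambda>x. flux_bound R (f x) (g x)) \<in> borel_measurable N"
  unfolding flux_bound_def by measurable

lemma integrable_entropy_flux:
  assumes "r \<ge> 0"
  shows "integrable lborel (entropy_flux r)"
  by (rule Bochner_Integration.integrable_bound[OF flux_bound_integral(1)[OF assms assms]])
     (use order_trans[OF entropy_flux_le[OF assms order_refl] abs_ge_self] in simp_all)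

lemma continuous_entropy_flux: "continuous_on {0<..} (\<lambda>r. entropy_flux r y)"
proof (cases "y > 0")
  case True
  then have "ell r y \<noteq> 0" if "r > 0" for r using ell_bounds(3)[of r r y] that by auto
  then show ?thesis
    unfolding entropy_flux_def using True
    by (intro continuous_intros continuous_ell_rate) auto
qed (simp add: entropy_flux_def base_outside)

lemma DERIV_entropy_density:
  assumes "r > 0"
  shows "((\<lambda>r. base y * (ell r y * ln (ell r y))) has_real_derivative entropy_flux r y) (at r)"
proof (cases "y > 0")
  case True
  have pos: "ell r y > 0" using ell_bounds(3)[of r r y] assms True by auto
  have D: "((\<lambda>r. ell r y) has_real_derivative lam * (ell_up r y - ell_X r y)) (at r)"
    using True assms by (intro DERIV_ell_rate) auto
  have L: "((\<lambda>r. ln (ell r y)) has_real_derivative 1 / ell r y * (lam * (ell_up r y - ell_X r y))) (at r)"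
    using pos by (intro DERIV_chain2[OF DERIV_ln_divide D])
  show ?thesis
    by (rule DERIV_cong[OF DERIV_cmult[OF DERIV_mult[OF D L]]])
       (use pos in \<open>simp add: entropy_flux_def field_simps\<close>)
qed (simp add: base_outside entropy_flux_def)

definition entropy_rate :: "real \<Rightarrow> real" where
  "entropy_rate r = integral\<^sup>L lborel (entropy_flux r)"

text \<open>
  Along a convergent sequence of rates the bounds \<open>flux_bound R\<close> converge together with their integrals,
  which is the situation of \<open>tendsto_integral_moving_bound\<close>.
\<close>

lemma continuous_entropy_rate: "continuous_on {0<..} entropy_rate"
  unfolding continuous_on_sequentially
proof (intro allI ballI impI, elim conjE)
  fix S :: "nat \<Rightarrow> real" and r :: real assume r: "r \<in> {0<..}" and S: "\<forall>n. S n \<in> {0<..}" "S \<longlonglongrightarrow> r"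
  obtain R where R: "\<And>n. S n \<le> R"
    using Bseq_bdd_above[OF convergent_imp_Bseq[OF convergentI[OF S(2)]]] by (auto simp: bdd_above_def)
  have rR: "r \<le> R" by (rule LIMSEQ_le_const2[OF S(2)]) (use R in blast)
  have R0: "R \<ge> 0" using rR r by auto
  have Snn: "S n \<ge> 0" for n using S(1) by (simp add: less_imp_le)
  have seq: "(\<lambda>n. f (S n)) \<longlonglongrightarrow> f r" if "continuous_on {0<..} f" for f :: "real \<Rightarrow> real"
    using that r S by (auto simp: continuous_on_sequentially o_def)
  have "(\<lambda>n. integral\<^sup>L lborel (entropy_flux (S n))) \<longlonglongrightarrow> integral\<^sup>L lborel (entropy_flux r)"
  proof (rule tendsto_integral_moving_bound[where g = "\<lambda>n. flux_bound R (S n)" and ?g0.0 = "flux_bound R r"])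
    show "\<bar>entropy_flux (S n) y\<bar> \<le> flux_bound R (S n) y" for n y
      by (intro entropy_flux_le Snn R)
    show "(\<lambda>n. entropy_flux (S n) y) \<longlonglongrightarrow> entropy_flux r y" for y
      by (rule seq) (rule continuous_entropy_flux)
    show "(\<lambda>n. flux_bound R (S n) y) \<longlonglongrightarrow> flux_bound R r y" for y
    proof (cases "y > 0")
      case True
      then have "continuous_on {0<..} (\<lambda>r. flux_bound R r y)"
        unfolding flux_bound_def by (intro continuous_intros continuous_ell_rate) auto
      then show ?thesis by (rule seq)
    qed (simp add: flux_bound_def base_outside)
    show "(\<lambda>n. integral\<^sup>L lborel (flux_bound R (S n))) \<longlonglongrightarrow> integral\<^sup>L lborel (flux_bound R r)"
      using r by (simp add: flux_bound_integral(2) Snn R0) (intro tendsto_intros S(2))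
  qed (use Snn R0 r in \<open>auto intro!: flux_bound_integral(1)\<close>)
  then show "(entropy_rate \<circ> S) \<longlonglongrightarrow> entropy_rate r"
    by (simp add: entropy_rate_def o_def)
qed

text \<open>
  The flux is integrable over \<open>{r1..r2}\<close> times the output axis. For a fixed output its integral in \<open>r\<close>
  is an increment of the integrand of \<open>rel_entropy\<close>, so exchanging the integrals gives the claim.
\<close>

lemma rel_entropy_increment:
  assumes "0 < r1" "r1 \<le> r2"
  shows "rel_entropy r2 - rel_entropy r1 = (\<integral>r. indicator {r1..r2} r * entropy_rate r \<partial>lborel)"
proof -
  have R: "r2 \<ge> 0" using assms by simp
  have on: "r \<ge> 0" "r \<le> r2" if "r \<in> {r1..r2}" for r using that assms by auto
  define f where "f = (\<lambda>(r, y). indicator {r1..r2} r * entropy_flux r y)"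
  have int: "integrable (lborel \<Otimes>\<^sub>M lborel) f"
  proof (rule lborel_pair.Fubini_integrable)
    show [measurable]: "f \<in> borel_measurable (lborel \<Otimes>\<^sub>M lborel)" unfolding f_def by measurable
    show "AE r in lborel. integrable lborel (\<lambda>y. f (r, y))"
    proof (rule AE_I2)
      fix r
      show "integrable lborel (\<lambda>y. f (r, y))"
        using integrable_entropy_flux[of r] on(1)[of r] by (cases "r \<in> {r1..r2}") (simp_all add: f_def)
    qed
    define b where "b = (\<lambda>r. lam * ((2 * (1 + log_floor r2) + (2 * \<alpha> + 1)) * expectation X + 2 * lam * r * expectation (\<lambda>w. (X w)\<^sup>2)))"
    have "set_integrable lborel {r1..r2} b"
      unfolding b_def by (intro borel_integrable_atLeastAtMost' continuous_intros)
    then have "integrable lborel (\<lambda>r. indicator {r1..r2} r *\<^sub>R b r)"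
      by (simp only: set_integrable_def)
    then show "integrable lborel (\<lambda>r. \<integral>y. norm (f (r, y)) \<partial>lborel)"
    proof (rule Bochner_Integration.integrable_bound)
      show "AE r in lborel. norm (\<integral>y. norm (f (r, y)) \<partial>lborel) \<le> norm (indicator {r1..r2} r *\<^sub>R b r)"
      proof (rule AE_I2)
        fix r
        show "norm (\<integral>y. norm (f (r, y)) \<partial>lborel) \<le> norm (indicator {r1..r2} r *\<^sub>R b r)"
        proof (cases "r \<in> {r1..r2}")
          case True
          have "(\<integral>y. \<bar>entropy_flux r y\<bar> \<partial>lborel) \<le> integral\<^sup>L lborel (flux_bound r2 r)"
            by (intro integral_mono integrable_abs integrable_entropy_flux flux_bound_integral(1) entropy_flux_le on[OF True] R)
          also have "\<dots> = b r"
            unfolding b_def by (intro flux_bound_integral(2) on[OF True] R)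
          finally have "(\<integral>y. \<bar>entropy_flux r y\<bar> \<partial>lborel) \<le> b r" .
          then show ?thesis using True by (simp add: f_def)
        qed (simp add: f_def)
      qed
    qed measurable
  qed
  have FTC: "(\<integral>r. f (r, y) \<partial>lborel) = base y * (ell r2 y * ln (ell r2 y)) - base y * (ell r1 y * ln (ell r1 y))" for y
  proof -
    have "(\<integral>r. indicator {r1..r2} r *\<^sub>R entropy_flux r y \<partial>lborel) =
        base y * (ell r2 y * ln (ell r2 y)) - base y * (ell r1 y * ln (ell r1 y))"
    proof (rule integral_FTC_Icc)
      fix r assume "r1 \<le> r" "r \<le> r2"
      then show "((\<lambda>r. base y * (ell r y * ln (ell r y))) has_vector_derivative entropy_flux r y) (at r within {r1..r2})"
        using DERIV_entropy_density[of r y] assms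
        by (auto simp: has_real_derivative_iff_has_vector_derivative intro: has_vector_derivative_at_within)
    qed (use assms in \<open>auto intro: continuous_on_subset[OF continuous_entropy_flux]\<close>)
    then show ?thesis by (simp add: f_def)
  qed
  have "rel_entropy r2 - rel_entropy r1 = (\<integral>y. (\<integral>r. f (r, y) \<partial>lborel) \<partial>lborel)"
    unfolding FTC rel_entropy_def
    using integrable_rel_entropy[of r1] integrable_rel_entropy[of r2] assms by simp
  also have "\<dots> = (\<integral>r. (\<integral>y. f (r, y) \<partial>lborel) \<partial>lborel)"
    using lborel_pair.Fubini_integral[of "\<lambda>r y. f (r, y)"] int by simp
  also have "\<dots> = (\<integral>r. indicator {r1..r2} r * entropy_rate r \<partial>lborel)"
    by (simp add: f_def entropy_rate_def)
  finally show ?thesis .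
qed

lemma DERIV_rel_entropy:
  assumes "r > 0"
  shows "(rel_entropy has_real_derivative entropy_rate r) (at r)"
proof -
  define a b where "a = r / 2" and "b = r + 1"
  have ab: "0 < a" "a < r" "r < b" using assms by (auto simp: a_def b_def)
  have cont: "continuous_on {a..b} entropy_rate"
    by (rule continuous_on_subset[OF continuous_entropy_rate]) (use ab in auto)
  have eq: "rel_entropy t = rel_entropy a + integral {a..t} entropy_rate" if "t \<in> {a..b}" for t
  proof -
    have "set_integrable lborel {a..t} entropy_rate"
      by (rule borel_integrable_atLeastAtMost') (rule continuous_on_subset[OF cont], use that in auto)
    from set_borel_integral_eq_integral(2)[OF this]
    show ?thesis
      using rel_entropy_increment[of a t] ab that by (simp add: set_lebesgue_integral_def)
  qed
  have "((\<lambda>t. rel_entropy a + integral {a..t} entropy_rate) has_real_derivative 0 + entropy_rate r) (at r within {a..b})"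
    using ab by (intro DERIV_add integral_has_real_derivative[OF cont] DERIV_const) auto
  then have "((\<lambda>t. rel_entropy a + integral {a..t} entropy_rate) has_real_derivative entropy_rate r) (at r)"
    using ab by (simp add: at_within_Icc_at)
  then show ?thesis
  proof (rule has_field_derivative_transform_within_open[of _ _ _ "{a<..<b}"])
    show "rel_entropy a + integral {a..t} entropy_rate = rel_entropy t" if "t \<in> {a<..<b}" for t
      using that by (intro eq[symmetric]) auto
  qed (use ab in auto)
qed

end

section \<open>Integration by parts and the posterior mean\<close>

context qgamma_channel begin

text \<open>
  Half of the exponential decay absorbs the growth of the series: \<open>2 sqrt (s y) \<le> y/2 + 2 s\<close>. This
  kills the boundary terms of the integration by parts.
\<close>

lemma ncgamma_tail_bound:
  assumes "s \<ge> 0" "y > 0"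
  shows "ncgamma (\<alpha> + 1) s y \<le>
    lam powr (\<alpha> + 1) / Gamma (\<alpha> + 1) * exp (lam * s) * (y powr \<alpha> * exp (- (lam / 2) * y))"
proof -
  have t: "lam\<^sup>2 * s * y \<ge> 0" using assms by simp
  have a: "\<alpha> + 1 \<ge> 1/2" using alpha_ge by simp
  have G: "Gamma (\<alpha> + 1) > 0" using alpha_ge by (intro Gamma_real_pos) auto
  have "0 \<le> lam * (sqrt (y / 2) - sqrt (2 * s))\<^sup>2" using lam_pos by simp
  then have "lam * (2 * (sqrt s * sqrt y)) \<le> lam * (y / 2 + 2 * s)"
    using assms lam_pos by (simp add: power2_diff real_sqrt_divide real_sqrt_mult field_simps)
  moreover have "sqrt (lam\<^sup>2 * s * y) = lam * (sqrt s * sqrt y)"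
    using lam_pos by (simp add: real_sqrt_mult)
  ultimately have "- lam * (s + y) + 2 * sqrt (lam\<^sup>2 * s * y) \<le> lam * s + - (lam / 2) * y"
    by (simp add: algebra_simps)
  then have e: "exp (- lam * (s + y)) * exp (2 * sqrt (lam\<^sup>2 * s * y)) \<le> exp (lam * s) * exp (- (lam / 2) * y)"
    unfolding exp_add[symmetric] by simp
  have b: "bessel_series (\<alpha> + 1) (lam\<^sup>2 * s * y) \<le> exp (2 * sqrt (lam\<^sup>2 * s * y)) / Gamma (\<alpha> + 1)"
    using bessel_series_le_exp[OF a t] G by (simp add: field_simps)
  have "ncgamma (\<alpha> + 1) s y =
      lam powr (\<alpha> + 1) * y powr \<alpha> * (exp (- lam * (s + y)) * bessel_series (\<alpha> + 1) (lam\<^sup>2 * s * y))"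
    using assms by (simp add: ncgamma_def)
  also have "\<dots> \<le> lam powr (\<alpha> + 1) * y powr \<alpha> * (exp (- lam * (s + y)) * (exp (2 * sqrt (lam\<^sup>2 * s * y)) / Gamma (\<alpha> + 1)))"
    using b by (intro mult_left_mono) auto
  also have "\<dots> = lam powr (\<alpha> + 1) * y powr \<alpha> / Gamma (\<alpha> + 1) * (exp (- lam * (s + y)) * exp (2 * sqrt (lam\<^sup>2 * s * y)))"
    by simp
  also have "\<dots> \<le> lam powr (\<alpha> + 1) * y powr \<alpha> / Gamma (\<alpha> + 1) * (exp (lam * s) * exp (- (lam / 2) * y))"
    using e G by (intro mult_left_mono) auto
  finally show ?thesis by (simp add: mult_ac)
qed

lemma tendsto_ncgamma_linear_growth:
  assumes s: "s \<ge> 0" and \<phi>: "\<And>y. y > 0 \<Longrightarrow> \<bar>\<phi> y\<bar> \<le> A + B * y"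
  shows "((\<lambda>y. ncgamma (\<alpha> + 1) s y * \<phi> y) \<longlongrightarrow> 0) (at_right 0)"
    "((\<lambda>y. ncgamma (\<alpha> + 1) s y * \<phi> y) \<longlongrightarrow> 0) at_top"
proof -
  define K where "K = lam powr (\<alpha> + 1) / Gamma (\<alpha> + 1) * exp (lam * s)"
  have al: "\<alpha> > 0" using alpha_ge by simp
  have le: "norm (ncgamma (\<alpha> + 1) s y * \<phi> y) \<le> K * (y powr \<alpha> * exp (- (lam / 2) * y)) * (A + B * y)" if "y > 0" for y
  proof -
    have "\<bar>ncgamma (\<alpha> + 1) s y\<bar> * \<bar>\<phi> y\<bar> \<le> K * (y powr \<alpha> * exp (- (lam / 2) * y)) * (A + B * y)"
      using ncgamma_tail_bound[OF s that] ncgamma_nonneg[of "\<alpha> + 1" s y] \<phi>[OF that] s alpha_ge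
      unfolding K_def[symmetric] by (intro mult_mono) auto
    then show ?thesis by (simp add: abs_mult)
  qed
  show "((\<lambda>y. ncgamma (\<alpha> + 1) s y * \<phi> y) \<longlongrightarrow> 0) (at_right 0)"
  proof (rule Lim_null_comparison)
    show "eventually (\<lambda>y. norm (ncgamma (\<alpha> + 1) s y * \<phi> y) \<le> K * (y powr \<alpha> * exp (- (lam / 2) * y)) * (A + B * y)) (at_right 0)"
      using eventually_at_right_less by eventually_elim (rule le)
    show "((\<lambda>y. K * (y powr \<alpha> * exp (- (lam / 2) * y)) * (A + B * y)) \<longlongrightarrow> 0) (at_right 0)"
      using al by real_asymp
  qed
  show "((\<lambda>y. ncgamma (\<alpha> + 1) s y * \<phi> y) \<longlongrightarrow> 0) at_top"
  proof (rule Lim_null_comparison)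
    show "eventually (\<lambda>y. norm (ncgamma (\<alpha> + 1) s y * \<phi> y) \<le> K * (y powr \<alpha> * exp (- (lam / 2) * y)) * (A + B * y)) at_top"
      using eventually_gt_at_top[of 0] by eventually_elim (rule le)
    have "((\<lambda>y. y powr \<alpha> * exp (- (lam / 2) * y)) \<longlongrightarrow> 0) at_top"
      "((\<lambda>y. y * (y powr \<alpha> * exp (- (lam / 2) * y))) \<longlongrightarrow> 0) at_top"
      using al lam_pos by real_asymp+
    then have "((\<lambda>y. K * (A * (y powr \<alpha> * exp (- (lam / 2) * y)) + B * (y * (y powr \<alpha> * exp (- (lam / 2) * y))))) \<longlongrightarrow> K * (A * 0 + B * 0)) at_top"
      by (intro tendsto_intros)
    then show "((\<lambda>y. K * (y powr \<alpha> * exp (- (lam / 2) * y)) * (A + B * y)) \<longlongrightarrow> 0) at_top"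
      by (simp add: algebra_simps)
  qed
qed

lemma continuous_ncgamma_output:
  "continuous_on {0<..} (ncgamma \<alpha> s)" "continuous_on {0<..} (ncgamma (\<alpha> + 1) s)"
proof -
  define c where "c = lam powr \<alpha> / Gamma \<alpha>"
  have 1: "continuous_on {0<..} (\<lambda>y. c * y powr (\<alpha> - 1) * exp (- lam * y) * lik s y)"
     "continuous_on {0<..} (\<lambda>y. c * y powr (\<alpha> - 1) * exp (- lam * y) * lik_up s y)"
    by (intro continuous_intros continuous_lik; auto)+
  show "continuous_on {0<..} (ncgamma \<alpha> s)"
    by (rule continuous_on_eq[OF 1(1)]) (simp add: ncgamma_eq_base_lik gamma_density_def c_def)
  show "continuous_on {0<..} (ncgamma (\<alpha> + 1) s)"
    by (rule continuous_on_eq[OF 1(2)]) (simp add: ncgamma_eq_base_lik_up gamma_density_def c_def)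
qed

end

context random_input begin

text \<open>
  The conditional expectation of \<open>sqrt X * V_r\<close> given that the output is \<open>y\<close>; see
  \<open>cond_exp_weighted_ratio\<close>.
\<close>

definition posterior_mean :: "real \<Rightarrow> real \<Rightarrow> real" where
  "posterior_mean r y = sqrt r / sqrt y * (ell_up r y / ell r y)"

lemma borel_measurable_posterior_mean [measurable]:
  assumes [measurable]: "f \<in> borel_measurable N" "g \<in> borel_measurable N"
  shows "(\<lambda>x. posterior_mean (f x) (g x)) \<in> borel_measurable N"
  unfolding posterior_mean_def by measurable

lemma posterior_mean_nonneg: "r \<ge> 0 \<Longrightarrow> y \<ge> 0 \<Longrightarrow> posterior_mean r y \<ge> 0"
  unfolding posterior_mean_def using ell_up_nonneg[of r y] ell_bounds(3)[of r r y]
  by (intro mult_nonneg_nonneg divide_nonneg_nonneg) auto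

text \<open>
  The difference of the two densities is a derivative by \<open>DERIV_ncgamma_Suc\<close>, and the derivative of
  \<open>1 + ln (ell r y)\<close> is nonnegative. The noncentrality \<open>s\<close> stays fixed here, so that the decay at infinity
  is explicit; averaging over the input comes afterwards.
\<close>

lemma entropy_by_parts:
  assumes r: "r > 0" and s: "s \<ge> 0"
  shows "has_bochner_integral lborel (\<lambda>y. indicator {0<..} y * (ncgamma (\<alpha> + 1) s y * (lam * r / y * ell_up r y / ell r y)))
    (lam * ((\<integral>y. ncgamma (\<alpha> + 1) s y * (1 + ln (ell r y)) \<partial>lborel) - (\<integral>y. ncgamma \<alpha> s y * (1 + ln (ell r y)) \<partial>lborel)))"
proof -
  define h where "h = (\<lambda>y. 1 + ln (ell r y))"
  define f where "f = (\<lambda>y. lam * (ncgamma \<alpha> s y - ncgamma (\<alpha> + 1) s y) * h y)"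
  have [measurable]: "h \<in> borel_measurable borel" unfolding h_def by measurable
  have pos: "ell r y > 0" if "y > 0" for y using ell_bounds(3)[of r r y] r that by simp
  have h: "\<bar>h y\<bar> \<le> (1 + log_floor r) + lam * y" if "y > 0" for y
    using ell_bounds(4)[of r r y] r that by (auto simp: h_def)
  have log_floor: "1 + log_floor r \<ge> 0" "lam \<ge> 0" using ell_bounds(5)[of r r 0] r lam_pos by auto
  have a: "\<alpha> + 1 \<ge> 1/2" using alpha_ge by simp
  note int = linear_growth_integral(1)[OF a s _ log_floor h, simplified] linear_growth_integral(1)[OF alpha_ge s _ log_floor h, simplified]
  have Dh: "(h has_real_derivative lam * r / y * ell_up r y / ell r y) (at y)" if "y > 0" for y
  proof -
    have "((\<lambda>y. ln (ell r y)) has_real_derivative 1 / ell r y * (lam * r / y * ell_up r y)) (at y)"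
      using r that pos[OF that] by (intro DERIV_chain2[OF DERIV_ln_divide DERIV_ell_output]) auto
    then have "(h has_real_derivative 0 + 1 / ell r y * (lam * r / y * ell_up r y)) (at y)"
      unfolding h_def by (intro DERIV_add DERIV_const)
    then show ?thesis by (rule DERIV_cong) simp
  qed
  have ch: "continuous_on {0<..} h"
    using Dh by (intro DERIV_continuous_on) (auto intro: has_field_derivative_at_within)
  have cell: "continuous_on {0<..} (\<lambda>y. ell r y)"
    using DERIV_ell_output[of r] r by (intro DERIV_continuous_on) (auto intro: has_field_derivative_at_within)
  have "has_bochner_integral lborel (\<lambda>y. indicator {0<..} y * (ncgamma (\<alpha> + 1) s y * (lam * r / y * ell_up r y / ell r y)))
      (- (\<integral>y. indicator {0<..} y * f y \<partial>lborel))"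
  proof (rule integration_by_parts_half_line)
    show "((\<lambda>y. ncgamma (\<alpha> + 1) s y * h y) has_real_derivative f y + ncgamma (\<alpha> + 1) s y * (lam * r / y * ell_up r y / ell r y)) (at y)"
      if "y > 0" for y
      by (rule DERIV_cong[OF DERIV_mult[OF DERIV_ncgamma_Suc[OF alpha_ge that] Dh[OF that]]])
         (simp add: f_def algebra_simps)
    show "continuous_on {0<..} f"
      unfolding f_def by (intro continuous_intros ch continuous_ncgamma_output)
    show "continuous_on {0<..} (\<lambda>y. ncgamma (\<alpha> + 1) s y * (lam * r / y * ell_up r y / ell r y))"
      using pos by (intro continuous_intros continuous_ncgamma_output cell continuous_ell_up_output) (use r in force)+
    show "ncgamma (\<alpha> + 1) s y * (lam * r / y * ell_up r y / ell r y) \<ge> 0" if "y > 0" for y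
      using ncgamma_nonneg[OF a s, of y] ell_up_nonneg[of r y] pos[OF that] that r lam_pos by simp
    have eq: "indicator {0<..} y * f y = lam * (ncgamma \<alpha> s y * h y - ncgamma (\<alpha> + 1) s y * h y)" for y
      by (cases "y > 0") (auto simp: f_def algebra_simps)
    show "integrable lborel (\<lambda>y. indicator {0<..} y * f y)"
      unfolding eq using int by simp
  qed (intro tendsto_ncgamma_linear_growth[OF s h]; assumption)+
  also have "- (\<integral>y. indicator {0<..} y * f y \<partial>lborel) =
      lam * ((\<integral>y. ncgamma (\<alpha> + 1) s y * h y \<partial>lborel) - (\<integral>y. ncgamma \<alpha> s y * h y \<partial>lborel))"
  proof -
    have eq: "indicator {0<..} y * f y = lam * (ncgamma \<alpha> s y * h y - ncgamma (\<alpha> + 1) s y * h y)" for y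
      by (cases "y > 0") (auto simp: f_def algebra_simps)
    show ?thesis unfolding eq using int by (simp add: algebra_simps)
  qed
  finally show ?thesis by (simp add: h_def)
qed

text \<open>
  The factor \<open>\<kappa>\<close> is the derivative of \<open>ln (ell r y)\<close>, a multiple of \<open>ell_up / (y * ell)\<close>. Averaging the
  density of raised shape with the weight \<open>X\<close> produces a second factor \<open>ell_up\<close>, which completes the
  square.
\<close>

lemma entropy_rate_eq_posterior:
  assumes r: "r > 0"
  shows "integrable lborel (\<lambda>y. base y * ell r y * (posterior_mean r y)\<^sup>2)"
    "entropy_rate r = lam * (\<integral>y. base y * ell r y * (posterior_mean r y)\<^sup>2 \<partial>lborel)"
proof -
  interpret P: pair_sigma_finite M lborel ..
  define h where "h = (\<lambda>y. 1 + ln (ell r y))"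
  define \<kappa> where "\<kappa> = (\<lambda>y. indicator {0<..} y * (lam * r / y * ell_up r y / ell r y))"
  have [measurable]: "h \<in> borel_measurable borel" "\<kappa> \<in> borel_measurable borel"
    unfolding h_def \<kappa>_def by measurable
  have h: "\<bar>h y\<bar> \<le> (1 + log_floor r) + lam * y" if "y > 0" for y
    using ell_bounds(4)[of r r y] r that by (auto simp: h_def)
  have log_floor: "1 + log_floor r \<ge> 0" "lam \<ge> 0" using ell_bounds(5)[of r r 0] r lam_pos by auto
  have a: "\<alpha> + 1 \<ge> 1/2" using alpha_ge by simp
  have r0: "r \<ge> 0" using r by simp
  have sq: "integrable M (\<lambda>w. X w * X w)"
    using X_sq_integrable by (simp add: power2_eq_square)
  note up = weighted_output_swap[OF a r0 _ log_floor h X_integrable sq, simplified]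
  note X = weighted_output_swap[OF alpha_ge r0 _ log_floor h X_integrable sq, simplified]
  define J where "J = (\<lambda>w. lam * ((\<integral>y. ncgamma (\<alpha> + 1) (r * X w) y * h y \<partial>lborel) - (\<integral>y. ncgamma \<alpha> (r * X w) y * h y \<partial>lborel)))"
  have J: "AE w in M. has_bochner_integral lborel (\<lambda>y. ncgamma (\<alpha> + 1) (r * X w) y * \<kappa> y) (J w)"
    using X_nonneg
  proof eventually_elim
    case (elim w)
    then have "r * X w \<ge> 0" using r by simp
    from entropy_by_parts[OF r this] show ?case
      by (simp add: J_def h_def \<kappa>_def mult.left_commute)
  qed
  have \<kappa>_nn: "\<kappa> y \<ge> 0" for y
    using ell_up_nonneg[of r y] ell_bounds(3)[of r r y] r lam_pos by (auto simp: \<kappa>_def indicator_def)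
  have XJ: "(\<lambda>w. X w * J w) = (\<lambda>w. lam * (X w * (\<integral>y. ncgamma (\<alpha> + 1) (r * X w) y * h y \<partial>lborel) - X w * (\<integral>y. ncgamma \<alpha> (r * X w) y * h y \<partial>lborel)))"
    by (simp add: J_def fun_eq_iff algebra_simps)
  have int_XJ: "integrable M (\<lambda>w. X w * J w)"
    unfolding XJ using up(2) X(2) by simp
  have rate: "entropy_rate r = (\<integral>w. X w * J w \<partial>M)"
  proof -
    have "entropy_flux r = (\<lambda>y. lam * ((\<integral>w. X w * ncgamma (\<alpha> + 1) (r * X w) y \<partial>M) * h y - (\<integral>w. X w * ncgamma \<alpha> (r * X w) y \<partial>M) * h y))"
      unfolding averaged_densities by (simp add: entropy_flux_def h_def fun_eq_iff algebra_simps)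
    then show ?thesis
      unfolding entropy_rate_def XJ using up X by simp
  qed
  have int: "integrable (M \<Otimes>\<^sub>M lborel) (\<lambda>(w, y). X w * (ncgamma (\<alpha> + 1) (r * X w) y * \<kappa> y))"
  proof (rule P.Fubini_integrable)
    show "AE w in M. integrable lborel (\<lambda>y. case (w, y) of (w, y) \<Rightarrow> X w * (ncgamma (\<alpha> + 1) (r * X w) y * \<kappa> y))"
      using J by eventually_elim (auto simp: has_bochner_integral_iff)
    show "integrable M (\<lambda>w. \<integral>y. norm (case (w, y) of (w, y) \<Rightarrow> X w * (ncgamma (\<alpha> + 1) (r * X w) y * \<kappa> y)) \<partial>lborel)"
    proof (rule integrable_cong_AE_imp[OF int_XJ])
      show "AE w in M. X w * J w = (\<integral>y. norm (case (w, y) of (w, y) \<Rightarrow> X w * (ncgamma (\<alpha> + 1) (r * X w) y * \<kappa> y)) \<partial>lborel)"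
        using J X_nonneg
      proof eventually_elim
        case (elim w)
        then have "ncgamma (\<alpha> + 1) (r * X w) y \<ge> 0" for y
          using r by (intro ncgamma_nonneg a) auto
        then show ?case
          using elim \<kappa>_nn by (simp add: abs_mult has_bochner_integral_iff)
      qed
    qed measurable
  qed measurable
  have kernel: "(\<integral>w. X w * (ncgamma (\<alpha> + 1) (r * X w) y * \<kappa> y) \<partial>M) = lam * (base y * ell r y * (posterior_mean r y)\<^sup>2)" for y
  proof -
    have "(\<integral>w. X w * (ncgamma (\<alpha> + 1) (r * X w) y * \<kappa> y) \<partial>M) = base y * ell_up r y * \<kappa> y"
      unfolding averaged_densities(3)[symmetric] by (simp only: mult.assoc[symmetric] integral_mult_left_zero)
    also have "\<dots> = lam * (base y * ell r y * (posterior_mean r y)\<^sup>2)"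
    proof (cases "y > 0")
      case True
      then have "ell r y \<noteq> 0" using ell_bounds(3)[of r r y] r by simp
      then show ?thesis
        using True r by (simp add: \<kappa>_def posterior_mean_def power_mult_distrib power_divide power2_eq_square[of "ell r y"] power2_eq_square[of "ell_up r y"])
    qed (simp add: base_outside)
    finally show ?thesis .
  qed
  show "integrable lborel (\<lambda>y. base y * ell r y * (posterior_mean r y)\<^sup>2)"
    using P.integrable_snd[OF int] lam_pos unfolding kernel by simp
  have "(\<integral>w. X w * J w \<partial>M) = (\<integral>w. (\<integral>y. X w * (ncgamma (\<alpha> + 1) (r * X w) y * \<kappa> y) \<partial>lborel) \<partial>M)"
  proof (rule integral_cong_AE)
    show "AE w in M. X w * J w = (\<integral>y. X w * (ncgamma (\<alpha> + 1) (r * X w) y * \<kappa> y) \<partial>lborel)"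
      using J by eventually_elim (simp add: has_bochner_integral_iff)
  qed (use int_XJ in \<open>auto intro: borel_measurable_integrable\<close>)
  also have "\<dots> = (\<integral>y. (\<integral>w. X w * (ncgamma (\<alpha> + 1) (r * X w) y * \<kappa> y) \<partial>M) \<partial>lborel)"
    using P.Fubini_integral[OF int] by simp
  finally show "entropy_rate r = lam * (\<integral>y. base y * ell r y * (posterior_mean r y)\<^sup>2 \<partial>lborel)"
    unfolding rate kernel by simp
qed

end

lemma (in prob_space) finite_measure_subalgebra_vimage:
  assumes "Z \<in> borel_measurable M"
  shows "finite_measure_subalgebra M (vimage_algebra (space M) Z borel)"
proof
  show "subalgebra M (vimage_algebra (space M) Z borel)"
    unfolding subalgebra_def sets_vimage_algebra
    by (auto intro!: sets.sigma_sets_subset measurable_sets[OF assms])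
qed

lemma (in prob_space) cond_exp_on_cmult:
  assumes [measurable]: "Z \<in> borel_measurable M" and f: "integrable M f"
  shows "AE w in M. cond_exp_on M (\<lambda>w. c * f w) Z w = c * cond_exp_on M f Z w"
proof -
  interpret finite_measure_subalgebra M "vimage_algebra (space M) Z borel"
    by (rule finite_measure_subalgebra_vimage) measurable
  show ?thesis
    unfolding cond_exp_on_def
    by (rule real_cond_exp_mult) (use f in auto)
qed

text \<open>
  Independence enters as a formula for iterated integrals, which holds just as well for constant inputs.
\<close>

locale channel_run = random_input lam \<alpha> M X
  for lam \<alpha> :: real and M :: "'a measure" and X :: "'a \<Rightarrow> real" +
  fixes G N :: "'a \<Rightarrow> real"
  assumes G_measurable [measurable]: "G \<in> borel_measurable M"
    and N_measurable [measurable]: "N \<in> borel_measurable M"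
    and G_nonneg: "AE w in M. G w \<ge> 0"
    and independent_noise: "\<And>f. f \<in> borel_measurable (borel \<Otimes>\<^sub>M borel \<Otimes>\<^sub>M borel) \<Longrightarrow>
      (\<integral>\<^sup>+w. f (X w, G w, N w) \<partial>M) =
      (\<integral>\<^sup>+w. \<integral>\<^sup>+g. \<integral>\<^sup>+n. f (X w, g, n) \<partial>density lborel std_normal_density \<partial>gamma_law (\<alpha> - 1/2) lam \<partial>M)"
begin

definition received :: "real \<Rightarrow> 'a \<Rightarrow> real" where
  "received r w = qgc_X lam G N r (X w) w"

definition ratio :: "real \<Rightarrow> 'a \<Rightarrow> real" where
  "ratio r w = qgc_V lam G N r (X w) w"

lemma received_measurable [measurable]: "received r \<in> borel_measurable M" "ratio r \<in> borel_measurable M"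
  unfolding received_def ratio_def qgc_V_def qgc_X_def qgc_Y_def by measurable

lemma joint_law:
  assumes r: "r \<ge> 0" and [measurable]: "f \<in> borel_measurable (borel \<Otimes>\<^sub>M borel)"
  shows "(\<integral>\<^sup>+w. f (X w, received r w) \<partial>M) =
    (\<integral>\<^sup>+w. \<integral>\<^sup>+y. f (X w, y) * ennreal (ncgamma \<alpha> (r * X w) y) \<partial>lborel \<partial>M)"
proof -
  define F where "F = (\<lambda>(x, g, n). f (x, g + (sqrt (r * x) + n / sqrt (2 * lam))\<^sup>2))"
  have [measurable]: "F \<in> borel_measurable (borel \<Otimes>\<^sub>M borel \<Otimes>\<^sub>M borel)" unfolding F_def by measurable
  have "(\<integral>\<^sup>+w. f (X w, received r w) \<partial>M) = (\<integral>\<^sup>+w. F (X w, G w, N w) \<partial>M)"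
    by (simp add: F_def received_def qgc_X_def qgc_Y_def)
  also have "\<dots> = (\<integral>\<^sup>+w. \<integral>\<^sup>+g. \<integral>\<^sup>+n. F (X w, g, n) \<partial>density lborel std_normal_density \<partial>gamma_law (\<alpha> - 1/2) lam \<partial>M)"
    by (rule independent_noise) measurable
  also have "\<dots> = (\<integral>\<^sup>+w. \<integral>\<^sup>+y. f (X w, y) * ennreal (ncgamma \<alpha> (r * X w) y) \<partial>lborel \<partial>M)"
    using X_nonneg
  proof (intro nn_integral_cong_AE, eventually_elim)
    case (elim w)
    have "(\<lambda>y. f (X w, y)) \<in> borel_measurable borel" by measurable
    then show ?case
      using channel_output_law[of "\<alpha> - 1/2" "r * X w" "\<lambda>y. f (X w, y)"] elim r alpha_ge
      by (simp add: F_def o_def)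
  qed
  finally show ?thesis .
qed

lemma nn_mixed_density:
  assumes "r \<ge> 0"
  shows "(\<integral>\<^sup>+w. ennreal (ncgamma \<alpha> (r * X w) y) \<partial>M) = ennreal (base y * ell r y)"
    "(\<integral>\<^sup>+w. ennreal (X w * ncgamma (\<alpha> + 1) (r * X w) y) \<partial>M) = ennreal (base y * ell_up r y)"
proof -
  have a: "\<alpha> + 1 \<ge> 1/2" using alpha_ge by simp
  have 1: "integrable M (\<lambda>w. ncgamma \<alpha> (r * X w) y)" "integrable M (\<lambda>w. X w * ncgamma (\<alpha> + 1) (r * X w) y)"
    unfolding ncgamma_eq_base_lik ncgamma_eq_base_lik_up mult.left_commute[of "X _"]
    using integrable_lik_input[OF assms, of y] integrable_X_lik_input(1)[OF assms, of y]
    by (cases "y > 0"; simp add: base_outside)+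
  have 2: "AE w in M. 0 \<le> ncgamma \<alpha> (r * X w) y" "AE w in M. 0 \<le> X w * ncgamma (\<alpha> + 1) (r * X w) y"
    using X_nonneg by (eventually_elim, use assms alpha_ge a in \<open>simp add: ncgamma_nonneg\<close>)+
  show "(\<integral>\<^sup>+w. ennreal (ncgamma \<alpha> (r * X w) y) \<partial>M) = ennreal (base y * ell r y)"
    using nn_integral_eq_integral[OF 1(1) 2(1)] by (simp add: averaged_densities)
  show "(\<integral>\<^sup>+w. ennreal (X w * ncgamma (\<alpha> + 1) (r * X w) y) \<partial>M) = ennreal (base y * ell_up r y)"
    using nn_integral_eq_integral[OF 1(2) 2(2)] by (simp add: averaged_densities)
qed

lemma received_law:
  fixes f :: "real \<Rightarrow> ennreal"
  assumes r: "r \<ge> 0" and [measurable]: "f \<in> borel_measurable borel"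
  shows "(\<integral>\<^sup>+w. f (received r w) \<partial>M) = (\<integral>\<^sup>+y. f y * ennreal (base y * ell r y) \<partial>lborel)"
proof -
  interpret P: pair_sigma_finite M lborel ..
  have "(\<integral>\<^sup>+w. f (received r w) \<partial>M) =
      (\<integral>\<^sup>+w. \<integral>\<^sup>+y. f y * ennreal (ncgamma \<alpha> (r * X w) y) \<partial>lborel \<partial>M)"
    using joint_law[OF r, of "\<lambda>(x, y). f y"] by simp
  also have "\<dots> = (\<integral>\<^sup>+y. \<integral>\<^sup>+w. f y * ennreal (ncgamma \<alpha> (r * X w) y) \<partial>M \<partial>lborel)"
    by (rule P.Fubini'[symmetric]) simp
  also have "\<dots> = (\<integral>\<^sup>+y. f y * ennreal (base y * ell r y) \<partial>lborel)"
    by (simp add: nn_integral_cmult nn_mixed_density r)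
  finally show ?thesis .
qed

text \<open>
  The ratio lies in \<open>{-1..1}\<close> because the gamma noise is nonnegative.
\<close>

lemma integrable_weighted_ratio:
  "integrable M (\<lambda>w. sqrt (X w) * ratio r w)"
proof (rule Bochner_Integration.integrable_bound)
  show "integrable M (\<lambda>w. 1 + X w)" using X_integrable by simp
  show "AE w in M. norm (sqrt (X w) * ratio r w) \<le> norm (1 + X w)"
    using X_nonneg G_nonneg
  proof eventually_elim
    case (elim w)
    define u where "u = qgc_Y lam N r (X w) w"
    have "\<bar>u\<bar> = sqrt (u\<^sup>2)" by simp
    also have "\<dots> \<le> sqrt (G w + u\<^sup>2)" using elim by (intro real_sqrt_le_mono) simp
    finally have le: "\<bar>u\<bar> \<le> sqrt (G w + u\<^sup>2)" .
    have "\<bar>ratio r w\<bar> \<le> 1"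
    proof (cases "G w + u\<^sup>2 > 0")
      case True
      then show ?thesis using le by (simp add: ratio_def qgc_V_def qgc_X_def u_def[symmetric] divide_le_eq_1)
    next
      case False
      with elim have "G w + u\<^sup>2 = 0" by (simp add: not_less add_nonneg_nonneg antisym)
      then show ?thesis by (simp add: ratio_def qgc_V_def qgc_X_def u_def[symmetric])
    qed
    moreover have "sqrt (X w) \<le> 1 + X w"
    proof -
      have "0 \<le> (sqrt (X w) - 1)\<^sup>2 + sqrt (X w)" using elim by simp
      then show ?thesis using elim by (simp add: power2_diff)
    qed
    ultimately have "\<bar>sqrt (X w)\<bar> * \<bar>ratio r w\<bar> \<le> (1 + X w) * 1"
      using elim by (intro mult_mono) auto
    then show ?case using elim by (simp add: abs_mult)
  qed
qed measurable

text \<open>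
  \<open>channel_output_law_tilted\<close> averaged over the input, with test function \<open>\<phi> y / sqrt y\<close>: the weighted
  density of raised shape that appears is the posterior mean times the output density.
\<close>

lemma tilted_law:
  fixes \<phi> :: "real \<Rightarrow> ennreal"
  assumes r: "r \<ge> 0" and [measurable]: "\<phi> \<in> borel_measurable borel"
  shows "(\<integral>\<^sup>+w. ennreal (sqrt (X w) * ratio r w) * \<phi> (received r w) \<partial>M) =
    (\<integral>\<^sup>+w. ennreal (- (sqrt (X w) * ratio r w)) * \<phi> (received r w) \<partial>M) +
    (\<integral>\<^sup>+w. ennreal (posterior_mean r (received r w)) * \<phi> (received r w) \<partial>M)"
proof -
  interpret P: pair_sigma_finite M lborel ..
  have sets [measurable_cong]: "sets (gamma_law (\<alpha> - 1/2) lam) = sets borel"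
    by (simp add: gamma_law_def)
  interpret N: sigma_finite_measure "density lborel std_normal_density"
    by (simp add: prob_space_normal_density prob_space_imp_sigma_finite)
  interpret Gl: prob_space "gamma_law (\<alpha> - 1/2) lam"
    using alpha_ge by (intro gamma_law_prob_space) simp
  define f where "f = (\<lambda>y. ennreal (1 / sqrt y) * \<phi> y)"
  have [measurable]: "f \<in> borel_measurable borel" unfolding f_def by measurable
  define U where "U = (\<lambda>x n. sqrt (r * x) + n / sqrt (2 * lam))"
  define F where "F = (\<lambda>c (x, g, n). ennreal (sqrt x) * (ennreal (c * U x n) * f (g + (U x n)\<^sup>2)))"
  have [measurable]: "F c \<in> borel_measurable (borel \<Otimes>\<^sub>M borel \<Otimes>\<^sub>M borel)" for c :: real
    unfolding F_def U_def by measurable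
  define S where "S = (\<lambda>c w. \<integral>\<^sup>+g. \<integral>\<^sup>+n. ennreal (c * U (X w) n) * f (g + (U (X w) n)\<^sup>2)
      \<partial>density lborel std_normal_density \<partial>gamma_law (\<alpha> - 1/2) lam)"
  have [measurable]: "S c \<in> borel_measurable M" for c :: real
    unfolding S_def U_def by measurable
  have signed: "(\<integral>\<^sup>+w. ennreal (c * (sqrt (X w) * ratio r w)) * \<phi> (received r w) \<partial>M) =
      (\<integral>\<^sup>+w. ennreal (sqrt (X w)) * S c w \<partial>M)" for c :: real
  proof -
    have "(\<integral>\<^sup>+w. ennreal (c * (sqrt (X w) * ratio r w)) * \<phi> (received r w) \<partial>M) = (\<integral>\<^sup>+w. F c (X w, G w, N w) \<partial>M)"
    proof (rule nn_integral_cong_AE)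
      show "AE w in M. ennreal (c * (sqrt (X w) * ratio r w)) * \<phi> (received r w) = F c (X w, G w, N w)"
        using X_nonneg G_nonneg
      proof eventually_elim
        case (elim w)
        define u z where "u = U (X w) (N w)" and "z = G w + u\<^sup>2"
        have z: "z \<ge> 0" using elim by (simp add: z_def)
        have o: "received r w = z" "ratio r w = u / sqrt z"
          by (simp_all add: received_def ratio_def qgc_V_def qgc_X_def qgc_Y_def z_def u_def U_def)
        have "ennreal (c * (sqrt (X w) * (u / sqrt z))) = ennreal (sqrt (X w) * (c * u) * (1 / sqrt z))"
          by (simp add: mult_ac)
        also have "\<dots> = ennreal (sqrt (X w)) * ennreal (c * u) * ennreal (1 / sqrt z)"
          using elim z by (subst ennreal_mult'', simp, subst ennreal_mult', simp, simp)
        finally show ?case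
          unfolding o by (simp add: F_def f_def u_def[symmetric] z_def[symmetric] mult_ac)
      qed
    qed
    also have "\<dots> = (\<integral>\<^sup>+w. \<integral>\<^sup>+g. \<integral>\<^sup>+n. F c (X w, g, n) \<partial>density lborel std_normal_density \<partial>gamma_law (\<alpha> - 1/2) lam \<partial>M)"
      by (rule independent_noise) measurable
    also have "\<dots> = (\<integral>\<^sup>+w. ennreal (sqrt (X w)) * S c w \<partial>M)"
      unfolding S_def F_def U_def by (intro nn_integral_cong) (simp add: nn_integral_cmult)
    finally show ?thesis .
  qed
  have "(\<integral>\<^sup>+w. ennreal (1 * (sqrt (X w) * ratio r w)) * \<phi> (received r w) \<partial>M) =
      (\<integral>\<^sup>+w. ennreal (sqrt (X w)) * S (- 1) w +
        ennreal (sqrt r * X w) * (\<integral>\<^sup>+y. f y * ennreal (ncgamma (\<alpha> + 1) (r * X w) y) \<partial>lborel) \<partial>M)"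
    unfolding signed
  proof (rule nn_integral_cong_AE)
    show "AE w in M. ennreal (sqrt (X w)) * S 1 w =
      ennreal (sqrt (X w)) * S (- 1) w +
        ennreal (sqrt r * X w) * (\<integral>\<^sup>+y. f y * ennreal (ncgamma (\<alpha> + 1) (r * X w) y) \<partial>lborel)"
      using X_nonneg
    proof eventually_elim
      case (elim w)
      have "sqrt (X w) * sqrt (r * X w) = sqrt r * X w"
        using elim by (simp add: real_sqrt_mult)
      then have m: "ennreal (sqrt (X w)) * ennreal (sqrt (r * X w)) = ennreal (sqrt r * X w)"
        using elim r by (simp add: ennreal_mult'[symmetric])
      have e: "\<alpha> - 1/2 + 3/2 = \<alpha> + 1" by simp
      have "0 \<le> \<alpha> - 1/2" "0 \<le> r * X w" using alpha_ge elim r by auto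
      from channel_output_law_tilted[OF this \<open>f \<in> borel_measurable borel\<close>]
      show ?case
        unfolding e S_def U_def by (simp add: distrib_left mult.assoc[symmetric] m)
    qed
  qed
  also have "\<dots> = (\<integral>\<^sup>+w. ennreal (sqrt (X w)) * S (- 1) w \<partial>M) +
      (\<integral>\<^sup>+w. ennreal (sqrt r * X w) * (\<integral>\<^sup>+y. f y * ennreal (ncgamma (\<alpha> + 1) (r * X w) y) \<partial>lborel) \<partial>M)"
    by (intro nn_integral_add) measurable
  also have "(\<integral>\<^sup>+w. ennreal (sqrt r * X w) * (\<integral>\<^sup>+y. f y * ennreal (ncgamma (\<alpha> + 1) (r * X w) y) \<partial>lborel) \<partial>M) =
      (\<integral>\<^sup>+w. \<integral>\<^sup>+y. ennreal (sqrt r) * f y * ennreal (X w * ncgamma (\<alpha> + 1) (r * X w) y) \<partial>lborel \<partial>M)"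
    using X_nonneg
  proof (intro nn_integral_cong_AE, eventually_elim)
    case (elim w)
    have "ennreal (sqrt r) * f y * ennreal (X w * ncgamma (\<alpha> + 1) (r * X w) y) =
        ennreal (sqrt r * X w) * (f y * ennreal (ncgamma (\<alpha> + 1) (r * X w) y))" for y
      using elim r by (simp add: ennreal_mult' mult_ac)
    then show ?case by (simp add: nn_integral_cmult)
  qed
  also have "\<dots> = (\<integral>\<^sup>+y. \<integral>\<^sup>+w. ennreal (sqrt r) * f y * ennreal (X w * ncgamma (\<alpha> + 1) (r * X w) y) \<partial>M \<partial>lborel)"
    by (rule P.Fubini'[symmetric]) simp
  also have "\<dots> = (\<integral>\<^sup>+y. ennreal (sqrt r) * f y * ennreal (base y * ell_up r y) \<partial>lborel)"
    by (simp add: nn_integral_cmult nn_mixed_density r)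
  also have "\<dots> = (\<integral>\<^sup>+y. ennreal (posterior_mean r y) * \<phi> y * ennreal (base y * ell r y) \<partial>lborel)"
  proof (rule nn_integral_cong)
    fix y
    show "ennreal (sqrt r) * f y * ennreal (base y * ell_up r y) = ennreal (posterior_mean r y) * \<phi> y * ennreal (base y * ell r y)"
    proof (cases "y > 0")
      case True
      have pos: "ell r y > 0" using ell_bounds(3)[of r r y] r True by simp
      have "sqrt r * (1 / sqrt y) * (base y * ell_up r y) = posterior_mean r y * (base y * ell r y)"
        using pos by (simp add: posterior_mean_def)
      moreover have nn: "0 \<le> sqrt r" "0 \<le> 1 / sqrt y" "0 \<le> base y * ell_up r y" "0 \<le> posterior_mean r y" "0 \<le> base y * ell r y"
        using True r pos posterior_mean_nonneg[OF r, of y] base_nonneg[of y] ell_up_nonneg[OF r, of y] by simp_all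
      have "ennreal (sqrt r) * ennreal (1 / sqrt y) * ennreal (base y * ell_up r y) =
          ennreal (sqrt r * (1 / sqrt y) * (base y * ell_up r y))"
        by (simp only: ennreal_mult[OF mult_nonneg_nonneg[OF nn(1,2)] nn(3)] ennreal_mult[OF nn(1,2)])
      ultimately have "ennreal (sqrt r) * ennreal (1 / sqrt y) * ennreal (base y * ell_up r y) =
          ennreal (posterior_mean r y) * ennreal (base y * ell r y)"
        by (simp only: ennreal_mult[OF nn(4,5)])
      then show ?thesis by (simp add: f_def mult_ac)
    qed (simp add: base_outside)
  qed
  also have "\<dots> = (\<integral>\<^sup>+w. ennreal (posterior_mean r (received r w)) * \<phi> (received r w) \<partial>M)"
    by (rule received_law[OF r, symmetric]) measurable
  finally show ?thesis
    using signed[of "- 1"] by simp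
qed

text \<open>
  The events of the conditioning sigma-algebra are those determined by the output, and \<open>tilted_law\<close>
  with an indicator as test function says that both sides have the same integral over them.
\<close>

lemma cond_exp_weighted_ratio:
  assumes r: "r \<ge> 0"
  shows "AE w in M. cond_exp_on M (\<lambda>w. sqrt (X w) * ratio r w) (received r) w = posterior_mean r (received r w)"
proof -
  define F where "F = vimage_algebra (space M) (received r) borel"
  interpret finite_measure_subalgebra M F
    unfolding F_def by (rule finite_measure_subalgebra_vimage) measurable
  have Zm: "received r \<in> F \<rightarrow>\<^sub>M borel"
    unfolding F_def by (rule measurable_vimage_algebra1) simp
  have Z_nn: "AE w in M. received r w \<ge> 0"
    using G_nonneg by eventually_elim (simp add: received_def qgc_X_def)
  note f_int = integrable_weighted_ratio[of r]
  have nn_le: "(\<integral>\<^sup>+w. ennreal (c * (sqrt (X w) * ratio r w)) * indicator B (received r w) \<partial>M) < \<infinity>"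
    if c: "c = 1 \<or> c = - 1" and B: "B \<in> sets borel" for c and B
  proof -
    have "(\<integral>\<^sup>+w. ennreal (c * (sqrt (X w) * ratio r w)) * indicator B (received r w) \<partial>M) \<le>
        (\<integral>\<^sup>+w. ennreal (norm (sqrt (X w) * ratio r w)) \<partial>M)"
      using c by (intro nn_integral_mono) (auto simp: indicator_def intro!: ennreal_leI)
    also have "\<dots> < \<infinity>" using f_int by (simp add: integrable_iff_bounded)
    finally show ?thesis .
  qed
  have g_int: "integrable M (\<lambda>w. posterior_mean r (received r w))"
  proof (rule integrableI_nonneg)
    show "AE w in M. 0 \<le> posterior_mean r (received r w)"
      using Z_nn by eventually_elim (rule posterior_mean_nonneg[OF r])
    have "(\<integral>\<^sup>+w. ennreal (posterior_mean r (received r w)) \<partial>M) \<le>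
        (\<integral>\<^sup>+w. ennreal (1 * (sqrt (X w) * ratio r w)) * indicator UNIV (received r w) \<partial>M)"
      using tilted_law[OF r, of "\<lambda>_. 1"] by simp
    also have "\<dots> < \<infinity>" by (rule nn_le) auto
    finally show "(\<integral>\<^sup>+w. ennreal (posterior_mean r (received r w)) \<partial>M) < \<infinity>" .
  qed measurable
  have "AE w in M. real_cond_exp M F (\<lambda>w. sqrt (X w) * ratio r w) w = posterior_mean r (received r w)"
  proof (rule real_cond_exp_charact[OF _ f_int g_int])
    fix A assume "A \<in> sets F"
    then obtain B where B [measurable]: "B \<in> sets borel" and A: "A = received r -` B \<inter> space M"
      unfolding F_def sets_vimage_algebra2[of "received r" "space M" borel, simplified] by auto
    have ind: "indicator A w = (indicator B (received r w) :: real)" if "w \<in> space M" for w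
      using that by (auto simp: A indicator_def)
    define f where "f = (\<lambda>w. indicator B (received r w) * (sqrt (X w) * ratio r w))"
    define g where "g = (\<lambda>w. indicator B (received r w) * posterior_mean r (received r w))"
    have fi: "integrable M f"
      unfolding f_def using f_int
      by (rule Bochner_Integration.integrable_bound) (auto simp: indicator_def)
    have gi: "integrable M g"
      unfolding g_def using g_int
      by (rule Bochner_Integration.integrable_bound) (auto simp: indicator_def)
    have eq: "(\<integral>\<^sup>+w. ennreal (f w) \<partial>M) = (\<integral>\<^sup>+w. ennreal (- f w) \<partial>M) + (\<integral>\<^sup>+w. ennreal (g w) \<partial>M)"
    proof -
      have i: "ennreal (indicator B z * t) = ennreal t * indicator B z" "ennreal (- (indicator B z * t)) = ennreal (- t) * indicator B z" for z t :: real
        by (auto simp: indicator_def)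
      show ?thesis
        using tilted_law[OF r, of "indicator B"] unfolding f_def g_def i by simp
    qed
    have fin: "(\<integral>\<^sup>+w. ennreal (- f w) \<partial>M) \<noteq> \<infinity>" "(\<integral>\<^sup>+w. ennreal (g w) \<partial>M) \<noteq> \<infinity>"
      using integrableD(2,3)[OF fi] integrableD(2)[OF gi] by auto
    have "(\<integral>w. f w \<partial>M) = enn2real (\<integral>\<^sup>+w. ennreal (g w) \<partial>M)"
      unfolding real_lebesgue_integral_def[OF fi] eq using fin
      by (simp add: enn2real_plus less_top)
    also have "\<dots> = (\<integral>w. g w \<partial>M)"
    proof (rule integral_eq_nn_integral[symmetric])
      show "AE w in M. 0 \<le> g w"
        using Z_nn by eventually_elim (simp add: g_def posterior_mean_nonneg[OF r])
    qed (use gi in \<open>auto intro: borel_measurable_integrable\<close>)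
    finally have "(\<integral>w. f w \<partial>M) = (\<integral>w. g w \<partial>M)" .
    then show "(\<integral>w\<in>A. (sqrt (X w) * ratio r w) \<partial>M) = (\<integral>w\<in>A. posterior_mean r (received r w) \<partial>M)"
      unfolding set_lebesgue_integral_def f_def g_def
      by (simp add: ind cong: Bochner_Integration.integral_cong)
  qed (use Zm in measurable)
  then show ?thesis by (simp add: cond_exp_on_def F_def)
qed

lemma entropy_rate_eq_cond_exp:
  assumes r: "r > 0"
  shows "entropy_rate r =
    lam * (\<integral>w. (cond_exp_on M (\<lambda>w. sqrt (X w) * ratio r w) (received r) w)\<^sup>2 \<partial>M)"
proof -
  have r0: "r \<ge> 0" using r by simp
  have meas: "cond_exp_on M (\<lambda>w. sqrt (X w) * ratio r w) (received r) \<in> borel_measurable M"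
    unfolding cond_exp_on_def by measurable
  have "(\<integral>w. (cond_exp_on M (\<lambda>w. sqrt (X w) * ratio r w) (received r) w)\<^sup>2 \<partial>M) =
      (\<integral>w. (posterior_mean r (received r w))\<^sup>2 \<partial>M)"
    using cond_exp_weighted_ratio[OF r0] meas
    by (intro integral_cong_AE) (auto elim!: eventually_mono)
  also have "\<dots> = enn2real (\<integral>\<^sup>+w. ennreal ((posterior_mean r (received r w))\<^sup>2) \<partial>M)"
    by (rule integral_eq_nn_integral) auto
  also have "\<dots> = enn2real (\<integral>\<^sup>+y. ennreal ((posterior_mean r y)\<^sup>2) * ennreal (base y * ell r y) \<partial>lborel)"
    by (subst received_law[OF r0]) auto
  also have "\<dots> = enn2real (\<integral>\<^sup>+y. ennreal (base y * ell r y * (posterior_mean r y)\<^sup>2) \<partial>lborel)"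
  proof -
    have "ennreal ((posterior_mean r y)\<^sup>2) * ennreal (base y * ell r y) = ennreal (base y * ell r y * (posterior_mean r y)\<^sup>2)" for y
    proof -
      have "0 \<le> base y * ell r y"
        using ell_bounds(3)[of r r y] r base_nonneg[of y] by (cases "y > 0") (auto simp: base_outside)
      then show ?thesis
        by (simp add: ennreal_mult mult.commute[of "ennreal ((posterior_mean r y)\<^sup>2)"])
    qed
    then show ?thesis by simp
  qed
  also have "\<dots> = (\<integral>y. base y * ell r y * (posterior_mean r y)\<^sup>2 \<partial>lborel)"
  proof (rule integral_eq_nn_integral[symmetric])
    show "AE y in lborel. 0 \<le> base y * ell r y * (posterior_mean r y)\<^sup>2"
    proof (rule AE_I2)
      fix y
      show "0 \<le> base y * ell r y * (posterior_mean r y)\<^sup>2"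
        using ell_bounds(3)[of r r y] r base_nonneg[of y] by (cases "y > 0") (auto simp: base_outside)
    qed
  qed measurable
  finally show ?thesis
    using entropy_rate_eq_posterior(2)[OF r] by simp
qed

end

section \<open>Mutual information\<close>

context qgamma_channel begin

text \<open>
  The relative entropy of the output at the fixed noncentrality \<open>s\<close>; \<open>divergence_rate x\<close> is its derivative
  along \<open>s = r * x\<close>.
\<close>

definition noise_divergence :: "real \<Rightarrow> real" where
  "noise_divergence s = (\<integral>y. ncgamma \<alpha> s y * ln (lik s y) \<partial>lborel)"

definition divergence_rate :: "real \<Rightarrow> real \<Rightarrow> real" where
  "divergence_rate x r = (\<integral>y. base y * (lam * (x * lik_up (r * x) y - x * lik (r * x) y) * (1 + ln (lik (r * x) y))) \<partial>lborel)"

lemma borel_measurable_divergence [measurable]: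
  assumes [measurable]: "f \<in> borel_measurable N"
  shows "(\<lambda>x. noise_divergence (f x)) \<in> borel_measurable N" "(\<lambda>x. divergence_rate (f x) r) \<in> borel_measurable N"
  unfolding noise_divergence_def divergence_rate_def by measurable

lemma abs_ln_lik_le:
  assumes "s \<ge> 0" "y > 0"
  shows "\<bar>ln (lik s y)\<bar> \<le> lam * s + lam * y"
proof -
  have y: "y \<ge> 0" using assms by simp
  have "- lam * s \<le> ln (lik s y)"
    using lik_bounds(1)[OF assms(1) y] lik_bounds(3)[OF assms(1) y] by (simp add: ln_ge_iff)
  moreover have "ln (lik s y) \<le> lam * y"
    using lik_bounds(2)[OF assms(1) y] lik_bounds(3)[OF assms(1) y] by (metis exp_gt_zero ln_exp ln_le_cancel_iff)
  moreover have "lam * s \<ge> 0" "lam * y \<ge> 0" using assms lam_pos by auto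
  ultimately show ?thesis by linarith
qed

lemma noise_divergence_le:
  assumes "s \<ge> 0"
  shows "\<bar>noise_divergence s\<bar> \<le> \<alpha> + 2 * lam * s"
proof -
  have "\<bar>noise_divergence s\<bar> \<le> (\<integral>y. \<bar>ncgamma \<alpha> s y * ln (lik s y)\<bar> \<partial>lborel)"
    unfolding noise_divergence_def by (rule integral_abs_bound)
  also have "\<dots> \<le> lam * s + lam * (\<alpha> / lam + s)"
    using assms lam_pos by (intro linear_growth_integral(2) alpha_ge abs_ln_lik_le) auto
  finally show ?thesis using lam_pos by (simp add: algebra_simps)
qed

end

text \<open>
  A deterministic input is a random input with a one-point law, so \<open>DERIV_rel_entropy\<close> also
  differentiates \<open>noise_divergence\<close>.
\<close>

locale constant_input = qgamma_channel lam \<alpha> + prob_space M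
  for lam \<alpha> :: real and M :: "'a measure" +
  fixes x :: real
  assumes x_nonneg: "x \<ge> 0"
begin

sublocale const: random_input lam \<alpha> M "\<lambda>_. x"
  by unfold_locales (use x_nonneg in auto)

lemma const_simps:
  "const.ell r y = lik (r * x) y" "const.ell_up r y = x * lik_up (r * x) y" "const.ell_X r y = x * lik (r * x) y"
  "const.log_floor R = lam * (R * x)" "const.rel_entropy r = noise_divergence (r * x)"
  "const.entropy_rate r = divergence_rate x r"
proof -
  show 1: "const.ell r y = lik (r * x) y" "const.ell_up r y = x * lik_up (r * x) y" "const.ell_X r y = x * lik (r * x) y" for r y
    by (simp_all add: const.ell_def const.ell_up_def const.ell_X_def prob_space)
  show "const.log_floor R = lam * (R * x)" by (simp add: const.log_floor_def prob_space)
  show "const.rel_entropy r = noise_divergence (r * x)"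
    by (simp add: const.rel_entropy_def noise_divergence_def 1 ncgamma_eq_base_lik mult.assoc)
  show "const.entropy_rate r = divergence_rate x r"
    by (simp add: const.entropy_rate_def const.entropy_flux_def[abs_def] divergence_rate_def 1)
qed

lemma DERIV_noise_divergence:
  "r > 0 \<Longrightarrow> ((\<lambda>r. noise_divergence (r * x)) has_real_derivative divergence_rate x r) (at r)"
  using const.DERIV_rel_entropy[of r] by (simp add: const_simps[abs_def])

text \<open>
  The bound is quadratic in \<open>x\<close>, so that it can be averaged over the input.
\<close>

lemma divergence_rate_le:
  assumes "0 \<le> r" "r \<le> R"
  shows "\<bar>divergence_rate x r\<bar> \<le> lam * ((2 * \<alpha> + 3) * x + 4 * lam * R * x\<^sup>2)"
proof -
  have R: "R \<ge> 0" using assms by simp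
  have "\<bar>const.entropy_rate r\<bar> \<le> (\<integral>y. \<bar>const.entropy_flux r y\<bar> \<partial>lborel)"
    unfolding const.entropy_rate_def by (rule integral_abs_bound)
  also have "\<dots> \<le> integral\<^sup>L lborel (const.flux_bound R r)"
    by (intro integral_mono integrable_abs const.integrable_entropy_flux const.flux_bound_integral(1) const.entropy_flux_le assms R)
  also have "\<dots> = lam * ((2 * (1 + lam * (R * x)) + (2 * \<alpha> + 1)) * x + 2 * lam * r * x\<^sup>2)"
    by (simp add: const.flux_bound_integral(2) assms R const_simps prob_space)
  also have "\<dots> \<le> lam * ((2 * \<alpha> + 3) * x + 4 * lam * R * x\<^sup>2)"
  proof (rule mult_left_mono)
    have "2 * lam * r * x\<^sup>2 \<le> 2 * lam * R * x\<^sup>2"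
      using assms lam_pos by (intro mult_right_mono mult_left_mono) auto
    then show "(2 * (1 + lam * (R * x)) + (2 * \<alpha> + 1)) * x + 2 * lam * r * x\<^sup>2 \<le> (2 * \<alpha> + 3) * x + 4 * lam * R * x\<^sup>2"
      by (simp add: algebra_simps power2_eq_square)
  qed (use lam_pos in simp)
  finally show ?thesis by (simp add: const_simps)
qed

end

context random_input begin

lemma constant_inputI: "x \<ge> 0 \<Longrightarrow> constant_input lam \<alpha> M x"
  by unfold_locales

lemma integrable_noise_divergence:
  assumes "r \<ge> 0"
  shows "integrable M (\<lambda>w. noise_divergence (r * X w))"
proof (rule Bochner_Integration.integrable_bound)
  show "integrable M (\<lambda>w. \<alpha> + 2 * lam * (r * X w))" using X_integrable by simp
  show "AE w in M. norm (noise_divergence (r * X w)) \<le> norm (\<alpha> + 2 * lam * (r * X w))"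
    using X_nonneg
  proof eventually_elim
    case (elim w)
    then have "r * X w \<ge> 0" using assms by simp
    from noise_divergence_le[OF this] show ?case
      unfolding real_norm_def by (rule order_trans[OF _ abs_ge_self])
  qed
qed measurable

lemma DERIV_mean_noise_divergence:
  assumes r: "r > 0"
  shows "((\<lambda>r. \<integral>w. noise_divergence (r * X w) \<partial>M) has_real_derivative (\<integral>w. divergence_rate (X w) r \<partial>M)) (at r)"
proof (rule has_real_derivative_integral[where S = "{0<..<r + 1}" and
      w = "\<lambda>w. lam * ((2 * \<alpha> + 3) * X w + 4 * lam * (r + 1) * (X w)\<^sup>2)" and f' = "\<lambda>r w. divergence_rate (X w) r"])
  show "AE w in M. \<forall>t\<in>{0<..<r + 1}. ((\<lambda>t. noise_divergence (t * X w)) has_real_derivative divergence_rate (X w) t) (at t)"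
    using X_nonneg
    by eventually_elim (use constant_input.DERIV_noise_divergence[OF constant_inputI] in auto)
  show "AE w in M. \<forall>t\<in>{0<..<r + 1}. \<bar>divergence_rate (X w) t\<bar> \<le> lam * ((2 * \<alpha> + 3) * X w + 4 * lam * (r + 1) * (X w)\<^sup>2)"
    using X_nonneg
    by eventually_elim (use constant_input.divergence_rate_le[OF constant_inputI] in auto)
qed (use r X_integrable X_sq_integrable in \<open>auto intro!: integrable_noise_divergence\<close>)

end

context channel_run begin

text \<open>
  The joint law of input and output has the density \<open>lik / ell\<close> with respect to the product of its
  marginals; the two terms are the two parts of its logarithm.
\<close>

lemma mutual_info_decomposition:
  assumes r: "r > 0"
  shows "mutual_info M X (received r) = (\<integral>w. noise_divergence (r * X w) \<partial>M) - rel_entropy r"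
proof -
  have r0: "r \<ge> 0" using r by simp
  interpret information_space M "exp 1" by unfold_locales simp
  interpret P: pair_sigma_finite M lborel ..
  define \<mu> where "\<mu> = distr M borel X"
  interpret \<mu>: prob_space \<mu> unfolding \<mu>_def by (rule prob_space_distr) measurable
  have [measurable_cong]: "sets \<mu> = sets borel" by (simp add: \<mu>_def)
  have ell_pos: "ell r y > 0" if "y > 0" for y using ell_bounds(3)[of r r y] r that by simp
  define Py where "Py = (\<lambda>y. base y * ell r y)"
  \<comment> \<open>The truncation at \<open>0\<close> makes the density nonnegative also on the null set of negative inputs.\<close>
  define Pxy where "Pxy = (\<lambda>(x, y). ncgamma \<alpha> (r * max 0 x) y)"
  have [measurable]: "Py \<in> borel_measurable borel" "Pxy \<in> borel_measurable (borel \<Otimes>\<^sub>M borel)"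
    unfolding Py_def Pxy_def by measurable
  have Py_nn: "Py y \<ge> 0" for y
    using ell_pos[of y] base_nonneg[of y] by (cases "y > 0") (auto simp: Py_def base_outside)
  have Pxy_nn: "Pxy (x, y) \<ge> 0" for x y
    using r alpha_ge by (auto simp: Pxy_def intro!: ncgamma_nonneg)
  have dX: "distributed M \<mu> X (\<lambda>_. ennreal 1)"
    unfolding distributed_def using X_measurable
    by (auto simp: \<mu>_def density_1 cong: distr_cong)
  have dY: "distributed M lborel (received r) Py"
    unfolding distributed_def
  proof (intro conjI)
    show "distr M lborel (received r) = density lborel (\<lambda>y. ennreal (Py y))"
    proof (rule measure_eqI)
      fix A assume "A \<in> sets (distr M lborel (received r))"
      then have [measurable]: "A \<in> sets borel" by simp
      have "emeasure (distr M lborel (received r)) A = (\<integral>\<^sup>+w. indicator A (received r w) \<partial>M)"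
        by (simp add: nn_integral_indicator[symmetric] nn_integral_distr del: nn_integral_indicator)
      also have "\<dots> = emeasure (density lborel (\<lambda>y. ennreal (Py y))) A"
        by (simp add: received_law[OF r0] emeasure_density Py_def mult.commute)
      finally show "emeasure (distr M lborel (received r)) A = emeasure (density lborel (\<lambda>y. ennreal (Py y))) A" .
    qed simp
  qed auto
  have dXY: "distributed M (\<mu> \<Otimes>\<^sub>M lborel) (\<lambda>w. (X w, received r w)) Pxy"
    unfolding distributed_def
  proof (intro conjI)
    show "distr M (\<mu> \<Otimes>\<^sub>M lborel) (\<lambda>w. (X w, received r w)) = density (\<mu> \<Otimes>\<^sub>M lborel) (\<lambda>p. ennreal (Pxy p))"
    proof (rule measure_eqI)
      fix A assume "A \<in> sets (distr M (\<mu> \<Otimes>\<^sub>M lborel) (\<lambda>w. (X w, received r w)))"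
      then have A: "A \<in> sets (\<mu> \<Otimes>\<^sub>M lborel)" by simp
      have sets_eq: "sets (\<mu> \<Otimes>\<^sub>M lborel) = sets (borel \<Otimes>\<^sub>M borel)"
        by (intro sets_pair_measure_cong) (auto simp: \<mu>_def)
      have [measurable]: "A \<in> sets (borel \<Otimes>\<^sub>M borel)" using A unfolding sets_eq .
      have "emeasure (distr M (\<mu> \<Otimes>\<^sub>M lborel) (\<lambda>w. (X w, received r w))) A =
          (\<integral>\<^sup>+w. indicator A (X w, received r w) \<partial>M)"
        using A by (simp add: nn_integral_indicator[symmetric] nn_integral_distr del: nn_integral_indicator)
      also have "\<dots> = (\<integral>\<^sup>+w. \<integral>\<^sup>+y. indicator A (X w, y) * ennreal (ncgamma \<alpha> (r * X w) y) \<partial>lborel \<partial>M)"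
        by (rule joint_law[OF r0]) measurable
      also have "\<dots> = (\<integral>\<^sup>+w. \<integral>\<^sup>+y. ennreal (Pxy (X w, y)) * indicator A (X w, y) \<partial>lborel \<partial>M)"
        using X_nonneg
        by (intro nn_integral_cong_AE, eventually_elim) (simp add: Pxy_def mult.commute max_def)
      also have "\<dots> = (\<integral>\<^sup>+x. \<integral>\<^sup>+y. ennreal (Pxy (x, y)) * indicator A (x, y) \<partial>lborel \<partial>\<mu>)"
        unfolding \<mu>_def by (subst nn_integral_distr) auto
      also have "\<dots> = (\<integral>\<^sup>+p. ennreal (Pxy p) * indicator A p \<partial>(\<mu> \<Otimes>\<^sub>M lborel))"
        by (subst lborel.nn_integral_fst[symmetric]) auto
      also have "\<dots> = emeasure (density (\<mu> \<Otimes>\<^sub>M lborel) (\<lambda>p. ennreal (Pxy p))) A"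
        by (simp add: emeasure_density)
      finally show "emeasure (distr M (\<mu> \<Otimes>\<^sub>M lborel) (\<lambda>w. (X w, received r w))) A =
          emeasure (density (\<mu> \<Otimes>\<^sub>M lborel) (\<lambda>p. ennreal (Pxy p))) A" .
    qed simp
  qed auto
  define f where "f = (\<lambda>(x, y). Pxy (x, y) * ln (Pxy (x, y) / Py y))"
  have [measurable]: "f \<in> borel_measurable (borel \<Otimes>\<^sub>M borel)" unfolding f_def by measurable
  have MI: "mutual_info M X (received r) = (\<integral>p. f p \<partial>(\<mu> \<Otimes>\<^sub>M lborel))"
  proof -
    have "mutual_info M X (received r) = mutual_information (exp 1) \<mu> lborel X (received r)"
    proof -
      have e1: "distr M borel X = distr M \<mu> X" "distr M borel (received r) = distr M lborel (received r)"
        by (auto intro!: distr_cong simp: \<mu>_def)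
      have "sets (borel \<Otimes>\<^sub>M borel) = sets (\<mu> \<Otimes>\<^sub>M lborel)"
        by (intro sets_pair_measure_cong) (auto simp: \<mu>_def)
      then have e2: "distr M (borel \<Otimes>\<^sub>M borel) (\<lambda>w. (X w, received r w)) = distr M (\<mu> \<Otimes>\<^sub>M lborel) (\<lambda>w. (X w, received r w))"
        by (intro distr_cong) auto
      show ?thesis unfolding mutual_info_def mutual_information_def e1 e2 ..
    qed
    also have "\<dots> = (\<integral>p. Pxy p * log (exp 1) (Pxy p / (1 * Py (snd p))) \<partial>(\<mu> \<Otimes>\<^sub>M lborel))"
      by (rule mutual_information_distr[OF _ _ dX _ dY _ dXY])
         (auto simp: Py_nn Pxy_nn \<mu>.sigma_finite_measure_axioms lborel.sigma_finite_measure_axioms)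
    also have "\<dots> = (\<integral>p. f p \<partial>(\<mu> \<Otimes>\<^sub>M lborel))"
      by (simp add: f_def log_def split_beta')
    finally show ?thesis .
  qed
  have "\<mu> \<Otimes>\<^sub>M (lborel :: real measure) = distr (M \<Otimes>\<^sub>M lborel) (borel \<Otimes>\<^sub>M borel) (\<lambda>(w, y). (X w, y))"
  proof -
    have id: "distr lborel borel (\<lambda>y. y) = (lborel :: real measure)"
      by (intro distr_id2) simp
    have fin: "sigma_finite_measure (distr lborel borel (\<lambda>y. y :: real))"
      unfolding id by (rule lborel.sigma_finite_measure_axioms)
    have "(\<lambda>y. y) \<in> lborel \<rightarrow>\<^sub>M (borel :: real measure)" by simp
    from pair_measure_distr[OF X_measurable this fin] show ?thesis
      unfolding \<mu>_def id .
  qed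
  then have MI2: "mutual_info M X (received r) = (\<integral>(w, y). f (X w, y) \<partial>(M \<Otimes>\<^sub>M lborel))"
    unfolding MI by (simp add: integral_distr split_beta')
  have f_eq: "f (x, y) = ncgamma \<alpha> (r * x) y * (ln (lik (r * x) y) - ln (ell r y))" if "x \<ge> 0" for x y
  proof (cases "y > 0")
    case True
    have "lik (r * x) y > 0" using that r True by (intro lik_bounds(3)) auto
    then have "ln (Pxy (x, y) / Py y) = ln (lik (r * x) y) - ln (ell r y)"
      using that base_pos[OF True] ell_pos[OF True]
      by (simp add: Pxy_def Py_def ncgamma_eq_base_lik max_def ln_div)
    then show ?thesis using that by (simp add: f_def Pxy_def max_def)
  qed (use that in \<open>simp add: f_def Pxy_def\<close>)
  have log_floor: "log_floor r \<ge> 0" using ell_bounds(5)[of r r 0] r by simp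
  have e_bound: "\<bar>ln (ell r y)\<bar> \<le> log_floor r + lam * y" if "y > 0" for y
    using ell_bounds(4)[of r r y] r that by simp
  have split: "integrable lborel (\<lambda>y. ncgamma \<alpha> s y * ln (lik s y))" "integrable lborel (\<lambda>y. ncgamma \<alpha> s y * ln (ell r y))"
    "(\<integral>y. \<bar>ncgamma \<alpha> s y * (ln (lik s y) - ln (ell r y))\<bar> \<partial>lborel) \<le> (lam * s + log_floor r) + 2 * lam * (\<alpha> / lam + s)"
    if s: "s \<ge> 0" for s
  proof -
    show "integrable lborel (\<lambda>y. ncgamma \<alpha> s y * ln (lik s y))"
      using lam_pos s by (intro linear_growth_integral(1)[OF alpha_ge s _ _ _ abs_ln_lik_le[OF s]]) auto
    show "integrable lborel (\<lambda>y. ncgamma \<alpha> s y * ln (ell r y))"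
      using lam_pos log_floor by (intro linear_growth_integral(1)[OF alpha_ge s _ _ _ e_bound]) auto
    show "(\<integral>y. \<bar>ncgamma \<alpha> s y * (ln (lik s y) - ln (ell r y))\<bar> \<partial>lborel) \<le> (lam * s + log_floor r) + 2 * lam * (\<alpha> / lam + s)"
    proof (rule linear_growth_integral(2)[OF alpha_ge s])
      fix y :: real assume y: "y > 0"
      show "\<bar>ln (lik s y) - ln (ell r y)\<bar> \<le> lam * s + log_floor r + 2 * lam * y"
        using abs_ln_lik_le[OF s y] e_bound[OF y] by (simp add: abs_le_iff)
    qed (use lam_pos log_floor s in auto)
  qed
  have int: "integrable (M \<Otimes>\<^sub>M lborel) (\<lambda>(w, y). f (X w, y))"
  proof (rule P.Fubini_integrable)
    show "AE w in M. integrable lborel (\<lambda>y. case (w, y) of (w, y) \<Rightarrow> f (X w, y))"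
      using X_nonneg
    proof eventually_elim
      case (elim w)
      then have "r * X w \<ge> 0" using r by simp
      from split(1,2)[OF this] show ?case using elim by (simp add: f_eq right_diff_distrib)
    qed
    show "integrable M (\<lambda>w. \<integral>y. norm (case (w, y) of (w, y) \<Rightarrow> f (X w, y)) \<partial>lborel)"
    proof (rule Bochner_Integration.integrable_bound)
      show "integrable M (\<lambda>w. (lam * (r * X w) + log_floor r) + 2 * lam * (\<alpha> / lam + r * X w))"
        using X_integrable by simp
      show "AE w in M. norm (\<integral>y. norm (case (w, y) of (w, y) \<Rightarrow> f (X w, y)) \<partial>lborel) \<le>
          norm ((lam * (r * X w) + log_floor r) + 2 * lam * (\<alpha> / lam + r * X w))"
        using X_nonneg
      proof eventually_elim
        case (elim w)
        then have "r * X w \<ge> 0" using r by simp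
        from split(3)[OF this]
        have "(\<integral>y. norm (case (w, y) of (w, y) \<Rightarrow> f (X w, y)) \<partial>lborel) \<le> (lam * (r * X w) + log_floor r) + 2 * lam * (\<alpha> / lam + r * X w)"
          using elim by (simp add: f_eq)
        moreover have "0 \<le> (\<integral>y. norm (case (w, y) of (w, y) \<Rightarrow> f (X w, y)) \<partial>lborel)"
          by (rule Bochner_Integration.integral_nonneg) simp
        ultimately show ?case unfolding real_norm_def by linarith
      qed
    qed measurable
  qed measurable
  note swap = weighted_output_swap[where Z = "\<lambda>_. 1", OF alpha_ge r0 _ log_floor less_imp_le[OF lam_pos] e_bound, simplified, OF X_integrable]
  have "(\<integral>(w, y). f (X w, y) \<partial>(M \<Otimes>\<^sub>M lborel)) = (\<integral>w. (\<integral>y. f (X w, y) \<partial>lborel) \<partial>M)"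
    using P.integral_fst'[OF int] by simp
  also have "\<dots> = (\<integral>w. noise_divergence (r * X w) - (\<integral>y. ncgamma \<alpha> (r * X w) y * ln (ell r y) \<partial>lborel) \<partial>M)"
  proof (rule integral_cong_AE)
    show "AE w in M. (\<integral>y. f (X w, y) \<partial>lborel) = noise_divergence (r * X w) - (\<integral>y. ncgamma \<alpha> (r * X w) y * ln (ell r y) \<partial>lborel)"
      using X_nonneg
    proof eventually_elim
      case (elim w)
      then have "r * X w \<ge> 0" using r by simp
      from split(1,2)[OF this] show ?case
        using elim by (simp add: f_eq right_diff_distrib noise_divergence_def)
    qed
  qed measurable
  also have "\<dots> = (\<integral>w. noise_divergence (r * X w) \<partial>M) - (\<integral>w. (\<integral>y. ncgamma \<alpha> (r * X w) y * ln (ell r y) \<partial>lborel) \<partial>M)"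
    using swap(2) by (intro Bochner_Integration.integral_diff integrable_noise_divergence r0) simp
  also have "(\<integral>w. (\<integral>y. ncgamma \<alpha> (r * X w) y * ln (ell r y) \<partial>lborel) \<partial>M) = rel_entropy r"
    using swap(3) by (simp add: rel_entropy_def averaged_densities mult.assoc)
  finally show ?thesis unfolding MI2 .
qed

end

section \<open>The derivative of the mutual information\<close>

text \<open>
  Independence compares two variables with values in one space, so the input is paired with a constant
  to match the pair of noises. The second formula is the first one for a constant input.
\<close>

lemma (in prob_space) channel_noise_laws:
  fixes X G N :: "'a \<Rightarrow> real" and x :: real
  assumes indep: "indep_vars (\<lambda>_. borel) (\<lambda>i. [X, G, N] ! i) {0, 1, 2}"
    and G_law: "distr M borel G = \<gamma>" and N_law: "distr M borel N = \<nu>"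
    and f [measurable]: "f \<in> borel_measurable (borel \<Otimes>\<^sub>M borel \<Otimes>\<^sub>M borel)"
  shows "X \<in> borel_measurable M" "G \<in> borel_measurable M" "N \<in> borel_measurable M"
    "(\<integral>\<^sup>+w. f (X w, G w, N w) \<partial>M) = (\<integral>\<^sup>+w. \<integral>\<^sup>+g. \<integral>\<^sup>+n. f (X w, g, n) \<partial>\<nu> \<partial>\<gamma> \<partial>M)"
    "(\<integral>\<^sup>+w. f (x, G w, N w) \<partial>M) = (\<integral>\<^sup>+w. \<integral>\<^sup>+g. \<integral>\<^sup>+n. f (x, g, n) \<partial>\<nu> \<partial>\<gamma> \<partial>M)"
proof -
  have rv: "random_variable borel ([X, G, N] ! i)" if "i \<in> {0, 1, 2}" for i
    using indep that by (auto simp: indep_vars_def)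
  from rv[of 0] rv[of 1] rv[of 2]
  show [measurable]: "X \<in> borel_measurable M" "G \<in> borel_measurable M" "N \<in> borel_measurable M" by auto
  interpret g: prob_space \<gamma> unfolding G_law[symmetric] by (rule prob_space_distr) measurable
  interpret n: prob_space \<nu> unfolding N_law[symmetric] by (rule prob_space_distr) measurable
  have [measurable_cong]: "sets \<gamma> = sets borel" "sets \<nu> = sets borel"
    by (simp_all add: G_law[symmetric] N_law[symmetric])
  have GN: "indep_var borel G borel N"
  proof -
    have "indep_var (PiM {1} (\<lambda>_. borel)) (\<lambda>w. restrict (\<lambda>i. ([X, G, N] ! i) w) {1})
        (PiM {2} (\<lambda>_. borel)) (\<lambda>w. restrict (\<lambda>i. ([X, G, N] ! i) w) {2})"
      by (rule indep_var_restrict[OF indep]) auto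
    then have "indep_var borel ((\<lambda>h. h 1) \<circ> (\<lambda>w. restrict (\<lambda>i. ([X, G, N] ! i) w) {1}))
        borel ((\<lambda>h. h 2) \<circ> (\<lambda>w. restrict (\<lambda>i. ([X, G, N] ! i) w) {2}))"
      by (rule indep_var_compose) (auto intro: measurable_component_singleton)
    then show ?thesis by (simp add: o_def)
  qed
  have XGN: "indep_var (borel \<Otimes>\<^sub>M borel) (\<lambda>w. (X w, 0)) (borel \<Otimes>\<^sub>M borel) (\<lambda>w. (G w, N w))"
  proof -
    have "indep_var (PiM {0} (\<lambda>_. borel)) (\<lambda>w. restrict (\<lambda>i. ([X, G, N] ! i) w) {0})
        (PiM {1, 2} (\<lambda>_. borel)) (\<lambda>w. restrict (\<lambda>i. ([X, G, N] ! i) w) {1, 2})"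
      by (rule indep_var_restrict[OF indep]) auto
    then have "indep_var (borel \<Otimes>\<^sub>M borel) ((\<lambda>h. (h 0, 0 :: real)) \<circ> (\<lambda>w. restrict (\<lambda>i. ([X, G, N] ! i) w) {0}))
        (borel \<Otimes>\<^sub>M borel) ((\<lambda>h. (h 1, h 2)) \<circ> (\<lambda>w. restrict (\<lambda>i. ([X, G, N] ! i) w) {1, 2}))"
      by (rule indep_var_compose) (auto intro!: measurable_Pair measurable_component_singleton)
    then show ?thesis by (simp add: o_def)
  qed
  have noise: "distr M (borel \<Otimes>\<^sub>M borel) (\<lambda>w. (G w, N w)) = \<gamma> \<Otimes>\<^sub>M \<nu>"
    using GN unfolding indep_var_distribution_eq G_law N_law by simp
  define \<xi> where "\<xi> = distr M (borel \<Otimes>\<^sub>M borel) (\<lambda>w. (X w, 0 :: real))"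
  have [measurable_cong]: "sets \<xi> = sets (borel \<Otimes>\<^sub>M borel)" by (simp add: \<xi>_def)
  have joint: "distr M ((borel \<Otimes>\<^sub>M borel) \<Otimes>\<^sub>M (borel \<Otimes>\<^sub>M borel)) (\<lambda>w. ((X w, 0), (G w, N w))) = \<xi> \<Otimes>\<^sub>M (\<gamma> \<Otimes>\<^sub>M \<nu>)"
    using XGN unfolding indep_var_distribution_eq noise by (simp add: \<xi>_def)
  interpret gn: pair_prob_space \<gamma> \<nu> ..
  have inner: "(\<integral>\<^sup>+p. f (x, p) \<partial>(\<gamma> \<Otimes>\<^sub>M \<nu>)) = (\<integral>\<^sup>+g. \<integral>\<^sup>+n. f (x, g, n) \<partial>\<nu> \<partial>\<gamma>)" for x
    by (rule n.nn_integral_fst[symmetric]) measurable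
  have "(\<integral>\<^sup>+w. f (X w, G w, N w) \<partial>M) = (\<integral>\<^sup>+p. f (fst (fst p), snd p) \<partial>(\<xi> \<Otimes>\<^sub>M (\<gamma> \<Otimes>\<^sub>M \<nu>)))"
    unfolding joint[symmetric] by (subst nn_integral_distr) auto
  also have "\<dots> = (\<integral>\<^sup>+x. \<integral>\<^sup>+p. f (fst x, p) \<partial>(\<gamma> \<Otimes>\<^sub>M \<nu>) \<partial>\<xi>)"
    by (subst gn.nn_integral_fst[symmetric]) auto
  also have "\<dots> = (\<integral>\<^sup>+w. \<integral>\<^sup>+g. \<integral>\<^sup>+n. f (X w, g, n) \<partial>\<nu> \<partial>\<gamma> \<partial>M)"
    unfolding inner \<xi>_def by (subst nn_integral_distr) auto
  finally show "(\<integral>\<^sup>+w. f (X w, G w, N w) \<partial>M) = (\<integral>\<^sup>+w. \<integral>\<^sup>+g. \<integral>\<^sup>+n. f (X w, g, n) \<partial>\<nu> \<partial>\<gamma> \<partial>M)" .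
  have "(\<integral>\<^sup>+w. f (x, G w, N w) \<partial>M) = (\<integral>\<^sup>+p. f (x, p) \<partial>(\<gamma> \<Otimes>\<^sub>M \<nu>))"
    unfolding noise[symmetric] by (subst nn_integral_distr) auto
  then show "(\<integral>\<^sup>+w. f (x, G w, N w) \<partial>M) = (\<integral>\<^sup>+w. \<integral>\<^sup>+g. \<integral>\<^sup>+n. f (x, g, n) \<partial>\<nu> \<partial>\<gamma> \<partial>M)"
    unfolding inner by (simp add: emeasure_space_1)
qed

theorem proposition10:
  fixes M :: "'a measure"
    and X G N :: "'a \<Rightarrow> real"
    and \<alpha> lam r :: real
  assumes prob: "prob_space M"
    and alpha: "\<alpha> \<ge> 1/2"
    and lam: "lam > 0"
    and indep: "prob_space.indep_vars M (\<lambda>_. borel) (\<lambda>i. [X, G, N] ! i) {0, 1, 2}"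
    and G_law: "distr M borel G = gamma_law (\<alpha> - 1/2) lam"
    and N_law: "distr M borel N = density lborel std_normal_density"
    and X_pos: "AE \<omega> in M. X \<omega> > 0"
    and X_moment: "integrable M (\<lambda>\<omega>. X \<omega> powr (\<alpha> + 4))"
    and X_mean: "(\<integral>\<omega>. X \<omega> \<partial>M) = \<alpha> / lam"
    and r: "r > 0"
  shows "((\<lambda>r. mutual_info M X (\<lambda>\<omega>. qgc_X lam G N r (X \<omega>) \<omega>)) has_real_derivative
          lam * ((\<integral>x\<in>{0<..}. x * (\<integral>\<omega>. (cond_exp_on M (qgc_V lam G N r x) (qgc_X lam G N r x) \<omega>)\<^sup>2 \<partial>M)
                    \<partial>(distr M borel X))
               - (\<integral>\<omega>. (cond_exp_on M (\<lambda>\<omega>. sqrt (X \<omega>) * qgc_V lam G N r (X \<omega>) \<omega>)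
                                     (\<lambda>\<omega>. qgc_X lam G N r (X \<omega>) \<omega>) \<omega>)\<^sup>2 \<partial>M)))
         (at r)"
proof -
  interpret prob_space M by (rule prob)
  note laws = channel_noise_laws[OF indep G_law N_law]
  have meas [measurable]: "X \<in> borel_measurable M" "G \<in> borel_measurable M" "N \<in> borel_measurable M"
    using laws(1-3)[of "\<lambda>_. 0"] by auto
  have G_nonneg: "AE \<omega> in M. G \<omega> \<ge> 0"
  proof -
    interpret rate: gamma_rate lam by unfold_locales (rule lam)
    have "AE g in distr M borel G. g \<ge> 0"
      unfolding G_law using alpha by (intro rate.gamma_law_prob_space) auto
    then show ?thesis by (subst (asm) AE_distr_iff) auto
  qed
  have X_sq: "integrable M (\<lambda>\<omega>. (X \<omega>)\<^sup>2)"
  proof (rule Bochner_Integration.integrable_bound)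
    show "integrable M (\<lambda>\<omega>. 1 + X \<omega> powr (\<alpha> + 4))" using X_moment by simp
    show "AE \<omega> in M. norm ((X \<omega>)\<^sup>2) \<le> norm (1 + X \<omega> powr (\<alpha> + 4))"
      using X_pos
    proof eventually_elim
      case (elim \<omega>)
      show ?case
      proof (cases "X \<omega> \<le> 1")
        case True
        then have "(X \<omega>)\<^sup>2 \<le> 1" using elim by (simp add: power_le_one)
        also have "\<dots> \<le> 1 + X \<omega> powr (\<alpha> + 4)" by simp
        finally show ?thesis by simp
      next
        case False
        then have "(X \<omega>)\<^sup>2 = X \<omega> powr 2" by (simp add: powr_numeral)
        also have "\<dots> \<le> X \<omega> powr (\<alpha> + 4)" using False alpha by (intro powr_mono) auto
        finally show ?thesis by simp
      qed
    qed
  qed measurable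
  interpret channel_run lam \<alpha> M X G N
  proof unfold_locales
    show "AE \<omega> in M. X \<omega> \<ge> 0" using X_pos by eventually_elim simp
  qed (use lam alpha X_sq G_nonneg laws(4) in auto)
  have const_run: "channel_run lam \<alpha> M (\<lambda>_. x) G N" if "x \<ge> 0" for x
    by unfold_locales (use that lam alpha G_nonneg laws(5) in auto)
  \<comment> \<open>At a constant input the factor \<open>sqrt x\<close> leaves the conditional expectation and squares to \<open>x\<close>.\<close>
  define sq where "sq = (\<lambda>x. \<integral>\<omega>. (cond_exp_on M (qgc_V lam G N r x) (qgc_X lam G N r x) \<omega>)\<^sup>2 \<partial>M)"
  have fixed_input: "divergence_rate x r = lam * (x * sq x)" if x: "x > 0" for x
  proof -
    have x0: "x \<ge> 0" using x by simp
    interpret c: channel_run lam \<alpha> M "\<lambda>_. x" G N by (rule const_run[OF x0])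
    interpret ci: constant_input lam \<alpha> M x by unfold_locales (rule x0)
    have fn: "c.received r = qgc_X lam G N r x" "c.ratio r = qgc_V lam G N r x"
      by (auto simp: c.received_def c.ratio_def)
    have ratio_int: "integrable M (c.ratio r)"
      using c.integrable_weighted_ratio[of r] x by simp
    have ae: "AE \<omega> in M. cond_exp_on M (\<lambda>\<omega>. sqrt x * c.ratio r \<omega>) (c.received r) \<omega> =
        sqrt x * cond_exp_on M (c.ratio r) (c.received r) \<omega>"
      by (rule cond_exp_on_cmult[OF _ ratio_int]) measurable
    have m: "cond_exp_on M h (c.received r) \<in> borel_measurable M" for h
      unfolding cond_exp_on_def by measurable
    have "divergence_rate x r = lam * (\<integral>\<omega>. (cond_exp_on M (\<lambda>\<omega>. sqrt x * c.ratio r \<omega>) (c.received r) \<omega>)\<^sup>2 \<partial>M)"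
      using c.entropy_rate_eq_cond_exp[OF r] ci.const_simps(6) by simp
    also have "(\<integral>\<omega>. (cond_exp_on M (\<lambda>\<omega>. sqrt x * c.ratio r \<omega>) (c.received r) \<omega>)\<^sup>2 \<partial>M) =
        (\<integral>\<omega>. x * (cond_exp_on M (c.ratio r) (c.received r) \<omega>)\<^sup>2 \<partial>M)"
      using ae m x0 by (intro integral_cong_AE) (auto elim!: eventually_mono simp: power_mult_distrib)
    finally show ?thesis by (simp add: sq_def fn)
  qed
  have first: "(\<integral>\<omega>. divergence_rate (X \<omega>) r \<partial>M) = lam * (\<integral>x\<in>{0<..}. x * sq x \<partial>(distr M borel X))"
  proof -
    have eq: "indicator {0<..} x *\<^sub>R (x * sq x) = indicator {0<..} x * (divergence_rate x r / lam)" for x :: real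
      using fixed_input[of x] lam by (simp add: indicator_def)
    have "(\<integral>x\<in>{0<..}. x * sq x \<partial>(distr M borel X)) = (\<integral>\<omega>. indicator {0<..} (X \<omega>) * (divergence_rate (X \<omega>) r / lam) \<partial>M)"
      unfolding set_lebesgue_integral_def eq by (subst integral_distr) auto
    also have "\<dots> = (\<integral>\<omega>. divergence_rate (X \<omega>) r / lam \<partial>M)"
    proof (rule integral_cong_AE)
      show "AE \<omega> in M. indicator {0<..} (X \<omega>) * (divergence_rate (X \<omega>) r / lam) = divergence_rate (X \<omega>) r / lam"
        using X_pos by eventually_elim simp
    qed measurable
    finally show ?thesis using lam by simp
  qed
  have D: "((\<lambda>r. (\<integral>\<omega>. noise_divergence (r * X \<omega>) \<partial>M) - rel_entropy r) has_real_derivative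
      (\<integral>\<omega>. divergence_rate (X \<omega>) r \<partial>M) - entropy_rate r) (at r)"
    by (intro DERIV_diff DERIV_mean_noise_divergence DERIV_rel_entropy r)
  have "((\<lambda>r. mutual_info M X (received r)) has_real_derivative
      (\<integral>\<omega>. divergence_rate (X \<omega>) r \<partial>M) - entropy_rate r) (at r)"
    by (rule has_field_derivative_transform_within_open[OF D, of "{0<..}"])
       (use r in \<open>auto simp: mutual_info_decomposition\<close>)
  then show ?thesis
    unfolding first entropy_rate_eq_cond_exp[OF r]
    unfolding sq_def received_def[abs_def] ratio_def[abs_def] right_diff_distrib .
qed

end
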